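(* Assume the data generating conditions (i)-(iv) of the context; that there exist $\alpha\in(0,1]$ and a measurable $L_\mu:\mathcal U\to\mathbb R_+$ with $\int_{\mathcal U}L_\mu^2\,d\nu<\infty$ and $|\mu(u,t)-\mu(u,t')|\le L_\mu(u)|t-t'|^\alpha$ for all $u\in\mathcal U$, $t,t'\in\mathcal T$; that there are $s>0$ and a finite $C_s>0$ with $\sum_{k\ge1}k^{2s}\|\beta_k\|^2_{L^2(\mathcal U)}\le C_s$; that $\Gamma_X$ is continuous; and that $1\le m_i\le m_{\max}$ for all $i$, with $m_{\max}$ independent of $n$. Then the spacings estimator $\widehat\mu^{\rm sp}$ satisfies, for all $K\ge1$, $$\mathcal R(\widehat\mu^{\rm sp};K)\le\mathcal S^{\rm sp}C_1^{\rm sp}K+C_2^{\rm sp}\Bigl(\frac{2\mathfrak h}{M+1}\Bigr)^{2\alpha}+C_3^{\rm sp}\frac{2\mathfrak h+1}{M+1}+C_sK^{-2s},\qquad\mathcal S^{\rm sp}:=\frac{2\mathfrak h+1}{2\mathfrak h(M+1)},$$ with $C_1^{\rm sp}=(m_{\max}\|\Gamma_X\|_\infty+\|\tau\|_\infty^2\nu(\mathcal U))/g_{\min}$, $C_2^{\rm sp}=12\|L_\mu\|^2_{L^2(\mathcal U)}/g_{\min}^{2\alpha+1}$ and $C_3^{\rm sp}=8\sup_{t\in\mathcal T}\|\mu(\cdot,t)\|^2_{L^2(\mathcal U)}/g_{\min}$. The risk bound is minimized at $K^*_{\rm sp}=\bigl\{2sC_s(\mathcal S^{\rm sp}C_1^{\rm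 sp})^{-1}\bigr\}^{1/(2s+1)}$, and the resulting risk satisfies $$\mathcal R^*(\widehat\mu^{\rm sp})\le\Bigl[\tfrac{2s+1}{2s}\bigl(2sC_s\{C_1^{\rm sp}\}^{2s}\bigr)^{\frac1{2s+1}}\Bigr]M^{-\frac{2s}{2s+1}}+C_2^{\rm sp}\Bigl(\frac{2\mathfrak h}{M+1}\Bigr)^{2\alpha}+C_3^{\rm sp}\frac{2\mathfrak h+1}{M+1}.$$ In particular, $\mathcal R^*(\widehat\mu^{\rm sp})\lesssim M^{-2s/(2s+1)}$, provided $\alpha>s/(2s+1)$.
   Context: $\mathcal T\subset\mathbb R$ is a compact interval with Lebesgue measure; $(\mathcal U,d_{\mathcal U})$ is a separable metric space with its Borel $\sigma$-field and a finite Borel measure $\nu$. For subjects $i=1,\dots,n$ and visits $j=1,\dots,m_i$, one observes $(T_{ij},Y_{ij}(\cdot))$ with $$Y_{ij}(u)=\mu(u,T_{ij})+X_i(u,T_{ij})+\varepsilon_{ij}(u),\quad u\in\mathcal U,$$ where $\mu\in L^2(\mathcal U\times\mathcal T)$ is the deterministic mean function. $M=m_1+\dots+m_n$. Data generating conditions: (i) the $X_i$ are independent copies of a random field $X$ on $\mathcal U\times\mathcal T$ with $\mathbb E\|X\|^2_{L^2(\mathcal U\times\mathcal T)}<\infty$ and $\mathbb E[X(u,t)]=0$ for all $(u,t)$; (ii) the $T_{ij}$ are i.i.d. copies of $T$ with Lipschitz continuous density $g$, positive on $\mathcal T$; $g_{\min}=\inf_{\mathcal T}g$; (iii) $\varepsilon_{ij}(u)=\tau(T_{ij})\eta_{ij}(u)$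 with $\tau:\mathcal T\to\mathbb R_+$ bounded deterministic and $\eta_{ij}$ i.i.d. random fields on $\mathcal U$ with $\mathbb E[\eta_{ij}(u)]=0$, $\mathrm{Var}(\eta_{ij}(u))=1$ for all $u$; (iv) the collections $\{T_{ij}\}$, $\{X_i\}$, $\{\eta_{ij}\}$ are mutually independent. $\Gamma_X(t,t')=\mathbb E\langle X(\cdot,t),X(\cdot,t')\rangle_{L^2(\mathcal U)}$; $\|\cdot\|_\infty$ is the sup norm. $\{\phi_k\}_{k\ge1}$ is an orthonormal basis of $L^2(\mathcal T)$ made of Lipschitz continuous functions, $\beta_k(u)=\int_{\mathcal T}\mu(u,t)\phi_k(t)\,dt$. $a\lesssim b$ means $a\le Cb$ for a positive constant $C$. Spacings estimator: pool the visit times into the ordered sample $T_{(1)}\le\dots\le T_{(M)}$, and let $Y_{(l)}(\cdot)$ be the profile $Y_{ij}(\cdot)$ attached to the visit time of rank $l$. Extend by reflection: $T_{(l)}:=2T_{(1)}-T_{(2-l)}$ for $l\le0$ and $T_{(l)}:=2T_{(M)}-T_{(2M-l)}$ for $l>M$. Let $\mathfrak h=\lceil\{1+\log\log(M+20)\}/2\rceil$, $\chi_l(t)=\mathbf 1\{T_{(l-\mathfrak h)}\le t\le T_{(l+\mathfrak h)}\}$, $$\widehat\Phi_{kl}=\frac1{2\mathfrak h}\int_{\mathcal T}\phi_k(t)\chi_l(t)\,dt,\qquad\widehat\beta_k^{\rm sp}(u)=\sum_{l=1}^MY_{(l)}(u)\widehat\Phi_{kl}.$$ For an integer truncation level $K\ge1$,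 $\widehat\mu^{\rm sp}(u,t)=\sum_{k=1}^K\widehat\beta_k^{\rm sp}(u)\phi_k(t)$ and $\mathcal R(\widehat\mu^{\rm sp};K)=\mathbb E\|\widehat\mu^{\rm sp}-\mu\|^2_{L^2(\mathcal U\times\mathcal T)}$; $\mathcal R^*(\widehat\mu^{\rm sp})$ is the risk at the truncation $K^*_{\rm sp}$, the unrounded minimizer (in practice one takes the ceiling or the nearest integer).
   Formalization: The explicit bound for R* carries the extra factor (M S^sp)^{2s/(2s+1)}, since the printed display fails for some M > 2h (e.g. mu = X = 0, M = 1000, s = 5, C_s = S^sp/10); the claims about K* and R*, including the rate, assume C_1^sp > 0, without which K* is undefined. *)

theory Defs
  imports "HOL-Probability.Probability"
begin

section \<open>Norms, orthonormal bases, covariance\<close>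

definition leb_on :: "real \<Rightarrow> real \<Rightarrow> real measure" where
  "leb_on a b = restrict_space lborel {a..b}"

definition L2_norm_sq :: "'a measure \<Rightarrow> ('a \<Rightarrow> real) \<Rightarrow> real" where
  "L2_norm_sq N f = (LINT x|N. (f x)\<^sup>2)"

definition sup_norm :: "'a set \<Rightarrow> ('a \<Rightarrow> real) \<Rightarrow> real" where
  "sup_norm A f = (SUP x\<in>A. \<bar>f x\<bar>)"

text \<open>Basis functions are indexed by \<open>k \<ge> 1\<close>; the value \<open>\<phi> 0\<close> is never used.\<close>

definition orthonormal_basis_L2 :: "'a measure \<Rightarrow> (nat \<Rightarrow> 'a \<Rightarrow> real) \<Rightarrow> bool" where
  "orthonormal_basis_L2 N \<phi> \<longleftrightarrow>
     (\<forall>k\<ge>1. \<phi> k \<in> borel_measurable N \<and> integrable N (\<lambda>x. (\<phi> k x)\<^sup>2)) \<and>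
     (\<forall>j\<ge>1. \<forall>k\<ge>1. (LINT x|N. \<phi> j x * \<phi> k x) = (if j = k then 1 else 0)) \<and>
     (\<forall>f. f \<in> borel_measurable N \<longrightarrow> integrable N (\<lambda>x. (f x)\<^sup>2) \<longrightarrow>
        (\<lambda>K. L2_norm_sq N (\<lambda>x. f x - (\<Sum>k=1..K. (LINT y|N. f y * \<phi> k y) * \<phi> k x)))
          \<longlonglongrightarrow> 0)"

definition basis_coeff ::
    "real \<Rightarrow> real \<Rightarrow> (nat \<Rightarrow> real \<Rightarrow> real) \<Rightarrow> ('u \<Rightarrow> real \<Rightarrow> real) \<Rightarrow> nat \<Rightarrow> 'u \<Rightarrow> real" where
  "basis_coeff a b \<phi> \<mu> k u = (LINT t|leb_on a b. \<mu> u t * \<phi> k t)"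

definition cov_kernel ::
    "'x measure \<Rightarrow> 'u measure \<Rightarrow> ('x \<Rightarrow> 'u \<Rightarrow> real \<Rightarrow> real) \<Rightarrow> real \<Rightarrow> real \<Rightarrow> real" where
  "cov_kernel Q \<nu> X t t' = (LINT x|Q. (LINT u|\<nu>. X x u t * X x u t'))"


section \<open>The sample\<close>

text \<open>
  A random field is a jointly measurable function \<open>X x u t\<close> of a point \<open>x\<close> of a probability
  space \<open>Q\<close> and of its arguments; its independent copies are \<open>X (\<xi> i \<omega>) u t\<close> with \<open>\<xi> i\<close>
  independent of law \<open>Q\<close> (for instance, \<open>Q\<close> may be the law of \<open>X\<close> on a space of sample paths and
  \<open>X\<close> the evaluation map).  Independence of the copies and the visit times with respect to
  the cylinder sigma-algebra alone would not be enough, because the field is evaluated at the random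
  times: \<open>X\<^sub>i(u,t) = 1{T\<^sub>i\<^sub>1 = t}\<close> generates only events of probability 0 or 1, so it is
  independent of \<open>T\<^sub>i\<^sub>1\<close> in that weak sense, but \<open>X\<^sub>i(u,T\<^sub>i\<^sub>1) = 1\<close>.
\<close>

definition visit_set :: "nat \<Rightarrow> (nat \<Rightarrow> nat) \<Rightarrow> (nat \<times> nat) set" where
  "visit_set n m = Sigma {1..n} (\<lambda>i. {1..m i})"

definition generated_sigma ::
    "'w measure \<Rightarrow> 'b measure \<Rightarrow> ('i \<Rightarrow> 'w \<Rightarrow> 'b) \<Rightarrow> 'i set \<Rightarrow> 'w set set" where
  "generated_sigma P N Z I =
     sigma_sets (space P) (\<Union>i\<in>I. {Z i -` A \<inter> space P | A. A \<in> sets N})"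

definition longitudinal_sample ::
    "real \<Rightarrow> real \<Rightarrow> 'x measure \<Rightarrow> (real \<Rightarrow> real) \<Rightarrow> 'e measure \<Rightarrow>
     nat \<Rightarrow> (nat \<Rightarrow> nat) \<Rightarrow> 'w measure \<Rightarrow>
     (nat \<Rightarrow> 'w \<Rightarrow> 'x) \<Rightarrow> (nat \<Rightarrow> nat \<Rightarrow> 'w \<Rightarrow> real) \<Rightarrow> (nat \<Rightarrow> nat \<Rightarrow> 'w \<Rightarrow> 'e) \<Rightarrow> bool" where
  "longitudinal_sample a b Q g E n m P \<xi> T \<zeta> \<longleftrightarrow>
     prob_space P \<and>
     prob_space.indep_vars P (\<lambda>_. Q) \<xi> {1..n} \<and>
     (\<forall>i\<in>{1..n}. distr P Q (\<xi> i) = Q) \<and>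
     prob_space.indep_vars P (\<lambda>_. leb_on a b) (\<lambda>(i, j). T i j) (visit_set n m) \<and>
     (\<forall>(i, j)\<in>visit_set n m. distributed P (leb_on a b) (T i j) (\<lambda>t. ennreal (g t))) \<and>
     prob_space.indep_vars P (\<lambda>_. E) (\<lambda>(i, j). \<zeta> i j) (visit_set n m) \<and>
     (\<forall>(i, j)\<in>visit_set n m. distr P E (\<zeta> i j) = E) \<and>
     prob_space.indep_sets P
       (\<lambda>c. [generated_sigma P Q \<xi> {1..n},
             generated_sigma P (leb_on a b) (\<lambda>(i, j). T i j) (visit_set n m),
             generated_sigma P E (\<lambda>(i, j). \<zeta> i j) (visit_set n m)] ! c) {..<3::nat}"

definition observation ::
    "('u \<Rightarrow> real \<Rightarrow> real) \<Rightarrow> ('x \<Rightarrow> 'u \<Rightarrow> real \<Rightarrow> real) \<Rightarrow> (real \<Rightarrow> real) \<Rightarrow> ('e \<Rightarrow> 'u \<Rightarrow> real) \<Rightarrow>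
     (nat \<Rightarrow> 'w \<Rightarrow> 'x) \<Rightarrow> (nat \<Rightarrow> nat \<Rightarrow> 'w \<Rightarrow> real) \<Rightarrow> (nat \<Rightarrow> nat \<Rightarrow> 'w \<Rightarrow> 'e) \<Rightarrow>
     'w \<Rightarrow> nat \<Rightarrow> nat \<Rightarrow> 'u \<Rightarrow> real" where
  "observation \<mu> X \<tau> \<eta> \<xi> T \<zeta> \<omega> i j u =
     \<mu> u (T i j \<omega>) + X (\<xi> i \<omega>) u (T i j \<omega>) + \<tau> (T i j \<omega>) * \<eta> (\<zeta> i j \<omega>) u"


section \<open>The spacings estimator\<close>

definition total_visits :: "nat \<Rightarrow> (nat \<Rightarrow> nat) \<Rightarrow> nat" where
  "total_visits n m = (\<Sum>i=1..n. m i)"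

text \<open>
  The visits sorted by time.  Ties, which have probability zero, are broken by index order.
\<close>

definition ranked_visits ::
    "nat \<Rightarrow> (nat \<Rightarrow> nat) \<Rightarrow> (nat \<Rightarrow> nat \<Rightarrow> real) \<Rightarrow> (nat \<times> nat) list" where
  "ranked_visits n m t =
     sort_key (\<lambda>(i, j). t i j) (concat (map (\<lambda>i. map (Pair i) [1..<m i + 1]) [1..<n + 1]))"

definition order_stat ::
    "nat \<Rightarrow> (nat \<Rightarrow> nat) \<Rightarrow> (nat \<Rightarrow> nat \<Rightarrow> real) \<Rightarrow> nat \<Rightarrow> real" where
  "order_stat n m t l = (case ranked_visits n m t ! (l - 1) of (i, j) \<Rightarrow> t i j)"

definition ranked_profile ::
    "nat \<Rightarrow> (nat \<Rightarrow> nat) \<Rightarrow> (nat \<Rightarrow> nat \<Rightarrow> real) \<Rightarrow> (nat \<Rightarrow> nat \<Rightarrow> 'u \<Rightarrow> real) \<Rightarrow>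
     nat \<Rightarrow> 'u \<Rightarrow> real" where
  "ranked_profile n m t y l = (case ranked_visits n m t ! (l - 1) of (i, j) \<Rightarrow> y i j)"

text \<open>
  Extension of \<open>s 1, \<dots>, s M\<close> to all integers by reflection at both ends.  The reflections are
  iterated where one of them does not lead back into \<open>{1..M}\<close>.  For \<open>M = 1\<close> iteration never leads
  back (the reflections then only determine \<open>s 0 = s 2 = s 1\<close>) and the extension is constant.
\<close>

function reflected :: "nat \<Rightarrow> (nat \<Rightarrow> real) \<Rightarrow> int \<Rightarrow> real" where
  "reflected M s l =
     (if M \<le> 1 then s 1
      else if l \<le> 0 then 2 * s 1 - reflected M s (2 - l)
      else if l > int M then 2 * s M - reflected M s (2 * int M - l)
      else s (nat l))"
  by pat_completeness auto
termination
  by (relation "Wellfounded.measure (\<lambda>(M, s, l). nat \<bar>2 * l - (int M + 1)\<bar>)") auto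

declare reflected.simps [simp del]

definition half_width :: "nat \<Rightarrow> nat" where
  "half_width M = nat \<lceil>(1 + ln (ln (real M + 20))) / 2\<rceil>"

definition spacing_window ::
    "nat \<Rightarrow> (nat \<Rightarrow> nat) \<Rightarrow> (nat \<Rightarrow> nat \<Rightarrow> real) \<Rightarrow> nat \<Rightarrow> real set" where
  "spacing_window n m t l =
     (let M = total_visits n m; h = int (half_width M); s = reflected M (order_stat n m t)
      in {s (int l - h) .. s (int l + h)})"

definition spacing_weight ::
    "real \<Rightarrow> real \<Rightarrow> (nat \<Rightarrow> real \<Rightarrow> real) \<Rightarrow> nat \<Rightarrow> (nat \<Rightarrow> nat) \<Rightarrow> (nat \<Rightarrow> nat \<Rightarrow> real) \<Rightarrow>
     nat \<Rightarrow> nat \<Rightarrow> real" where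
  "spacing_weight a b \<phi> n m t k l =
     1 / (2 * real (half_width (total_visits n m))) *
     (LINT x|leb_on a b. \<phi> k x * indicator (spacing_window n m t l) x)"

definition spacing_coeff ::
    "real \<Rightarrow> real \<Rightarrow> (nat \<Rightarrow> real \<Rightarrow> real) \<Rightarrow> nat \<Rightarrow> (nat \<Rightarrow> nat) \<Rightarrow> (nat \<Rightarrow> nat \<Rightarrow> real) \<Rightarrow>
     (nat \<Rightarrow> nat \<Rightarrow> 'u \<Rightarrow> real) \<Rightarrow> nat \<Rightarrow> 'u \<Rightarrow> real" where
  "spacing_coeff a b \<phi> n m t y k u =
     (\<Sum>l=1..total_visits n m. ranked_profile n m t y l u * spacing_weight a b \<phi> n m t k l)"

text \<open>
  The truncation level is a real number, so that the unrounded optimal level can be used: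
  the sum runs over the integers \<open>k\<close> with \<open>1 \<le> k \<le> K\<close>.
\<close>

definition spacing_estimator ::
    "real \<Rightarrow> real \<Rightarrow> (nat \<Rightarrow> real \<Rightarrow> real) \<Rightarrow> nat \<Rightarrow> (nat \<Rightarrow> nat) \<Rightarrow> (nat \<Rightarrow> nat \<Rightarrow> real) \<Rightarrow>
     (nat \<Rightarrow> nat \<Rightarrow> 'u \<Rightarrow> real) \<Rightarrow> real \<Rightarrow> 'u \<Rightarrow> real \<Rightarrow> real" where
  "spacing_estimator a b \<phi> n m t y K u x =
     (\<Sum>k | 1 \<le> k \<and> real k \<le> K. spacing_coeff a b \<phi> n m t y k u * \<phi> k x)"

text \<open>
  The risk takes values in the extended nonnegative reals, so a bound by a real number includes
  its finiteness.
\<close>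

definition spacing_risk ::
    "real \<Rightarrow> real \<Rightarrow> 'u measure \<Rightarrow> ('u \<Rightarrow> real \<Rightarrow> real) \<Rightarrow> ('x \<Rightarrow> 'u \<Rightarrow> real \<Rightarrow> real) \<Rightarrow>
     (real \<Rightarrow> real) \<Rightarrow> ('e \<Rightarrow> 'u \<Rightarrow> real) \<Rightarrow> (nat \<Rightarrow> real \<Rightarrow> real) \<Rightarrow>
     nat \<Rightarrow> (nat \<Rightarrow> nat) \<Rightarrow> 'w measure \<Rightarrow>
     (nat \<Rightarrow> 'w \<Rightarrow> 'x) \<Rightarrow> (nat \<Rightarrow> nat \<Rightarrow> 'w \<Rightarrow> real) \<Rightarrow> (nat \<Rightarrow> nat \<Rightarrow> 'w \<Rightarrow> 'e) \<Rightarrow>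
     real \<Rightarrow> ennreal" where
  "spacing_risk a b \<nu> \<mu> X \<tau> \<eta> \<phi> n m P \<xi> T \<zeta> K =
     (\<integral>\<^sup>+\<omega>. (\<integral>\<^sup>+(u, x).
        ennreal ((spacing_estimator a b \<phi> n m (\<lambda>i j. T i j \<omega>)
                    (observation \<mu> X \<tau> \<eta> \<xi> T \<zeta> \<omega>) K u x - \<mu> u x)\<^sup>2)
        \<partial>(\<nu> \<Otimes>\<^sub>M leb_on a b)) \<partial>P)"


section \<open>Quantities in the risk bound\<close>

definition S_sp :: "nat \<Rightarrow> real" where
  "S_sp M = (2 * real (half_width M) + 1) / (2 * real (half_width M) * (real M + 1))"

definition remainder_sp :: "real \<Rightarrow> real \<Rightarrow> real \<Rightarrow> nat \<Rightarrow> real" where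
  "remainder_sp \<alpha> C2 C3 M =
     C2 * (2 * real (half_width M) / (real M + 1)) powr (2 * \<alpha>) +
     C3 * ((2 * real (half_width M) + 1) / (real M + 1))"

definition risk_bound ::
    "real \<Rightarrow> real \<Rightarrow> real \<Rightarrow> real \<Rightarrow> real \<Rightarrow> real \<Rightarrow> nat \<Rightarrow> real \<Rightarrow> real" where
  "risk_bound \<alpha> s C1 C2 C3 Cs M K =
     S_sp M * C1 * K + remainder_sp \<alpha> C2 C3 M + Cs * K powr (- 2 * s)"

definition K_opt :: "real \<Rightarrow> real \<Rightarrow> real \<Rightarrow> nat \<Rightarrow> real" where
  "K_opt s C1 Cs M = (2 * s * Cs / (S_sp M * C1)) powr (1 / (2 * s + 1))"

end

theory Submission
  imports Defs "HOL-Real_Asymp.Real_Asymp"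
begin

text \<open>
  By Pythagoras in \<open>L\<^sup>2\<close> the risk is the sum of the errors of the first \<open>K\<close> coefficients and of the
  truncation tail, and the latter is at most \<open>Cs * K powr (- 2 * s)\<close>.  Given the visit times, the
  error of a coefficient splits into a bias and a centred noise term.  The noise has second moment
  at most a constant times the sum of the squared weights; the cross terms between visits of one
  subject are absorbed by \<open>(x\<^sub>1 + \<dots> + x\<^sub>m)\<^sup>2 \<le> m * (x\<^sub>1\<^sup>2 + \<dots> + x\<^sub>m\<^sup>2)\<close>.

  Everything about the order statistics is expressed through the counting function
  \<open>N y = card {v. T v \<le> y}\<close>.  Up to null sets the window of rank \<open>l\<close> lies in
  \<open>{y. N y - h < l \<le> N y + h}\<close>, whatever the reflections do; for \<open>t\<close> in this set, its part to the
  right of \<open>t\<close> has fewer than \<open>r = l + h - N t\<close> visits between \<open>t\<close> and any of its points, and its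
  part to the left fewer than \<open>2 * h + 1 - r\<close>.  The number of visits in an interval of length \<open>x\<close>
  is binomial with success probability at least \<open>g_min * x\<close>, and
  \<open>\<integral> P (Bin(M, p) < r) dp = r / (M + 1)\<close> over \<open>0 \<le> p \<le> 1\<close>, so the expected lengths of the two parts
  add up to \<open>(2 * h + 1) / ((M + 1) * g_min)\<close> for each of the \<open>2 * h\<close> values of \<open>r\<close>.  This yields
  the constant \<open>S_sp\<close>.

  By Bessel's inequality the biases sum to at most the squared \<open>L\<^sup>2\<close> distance between \<open>\<mu>\<close> and its
  moving average over the windows.  Where \<open>h \<le> N t \<le> M - h\<close> exactly \<open>2 * h\<close> windows contain \<open>t\<close> and the
  Hoelder condition applies; the remaining \<open>t\<close> form a set of expected length at most
  \<open>2 * h / ((M + 1) * g_min)\<close>.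
\<close>

section \<open>The optimal truncation level\<close>

text \<open>The law of the order statistics is never computed. By Tonelli the expected length of a
  set of points \<open>y\<close> with fewer than \<open>r\<close> visits between \<open>x\<close>
  and \<open>y\<close> is an integral of binomial probabilities over \<open>y\<close>, and since
  these decrease in the success probability, a density that is at least \<open>g_min\<close> can be
  treated as if it were constant. Squared distances take the same form, because d^2 is twice the
  integral of |y - x| over a segment of length d that starts at \<open>x\<close>.

  The obstacle in the noise term is that the fields are evaluated at random times. The squared error
  is written as a function of two outcomes, one entering only through the visit times and the other
  only through fields and errors; independence then allows the second outcome to be drawn afresh.

  The minimum of the risk bound contains a power of \<open>real M * S_sp M\<close>. This product
  exceeds 1 as soon as \<open>M\<close> is larger than \<open>2 * half_width M\<close>, so the
  factor cannot be replaced by 1; it never exceeds 2, so the rate in \<open>M\<close> is the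
  same.\<close>

lemma ln_ln_nonneg: "0 \<le> ln (ln (real M + 20))"
proof -
  have "1 \<le> ln (real M + 20)"
    using exp_le by (subst ln_ge_iff) auto
  then show ?thesis by (rule ln_ge_zero)
qed

lemma half_width_ge_1: "1 \<le> half_width M"
proof -
  have *: "0 < (1 + x) / 2" if "0 \<le> x" for x :: real using that by simp
  have "0 < \<lceil>(1 + ln (ln (real M + 20))) / 2\<rceil>"
    using *[OF ln_ln_nonneg[of M]] by (simp only: zero_less_ceiling)
  moreover have "1 \<le> nat z" if "0 < z" for z using that by simp
  ultimately show ?thesis unfolding half_width_def by blast
qed

lemma S_sp_pos: "0 < S_sp M"
  using half_width_ge_1[of M] by (simp add: S_sp_def)

text \<open>With A = \<open>S_sp M * C1\<close> the bound is A K + \<open>Cs\<close> K^(-2s) plus a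
  constant. Its derivative vanishes exactly where \<open>Cs\<close> K^(-2s) = A K / (2s), which is
  the defining equation of \<open>K_opt\<close>, so the minimal value is (2s + 1) / (2s) times A K.
  The inequality is strict and covers all real K > 0, so the minimizer is unique.\<close>

lemma K_opt_bound:
  fixes s C1 Cs :: real
  assumes s: "0 < s" and Cs: "0 < Cs" and C1: "0 < C1" and M: "1 \<le> M"
  defines "Ks \<equiv> K_opt s C1 Cs M"
  shows "0 < Ks"
    and "\<And>K. 0 < K \<Longrightarrow> K \<noteq> Ks \<Longrightarrow>
           risk_bound \<alpha> s C1 C2 C3 Cs M Ks < risk_bound \<alpha> s C1 C2 C3 Cs M K"
    and "risk_bound \<alpha> s C1 C2 C3 Cs M Ks =
        (2 * s + 1) / (2 * s) * (2 * s * Cs * C1 powr (2 * s)) powr (1 / (2 * s + 1))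
          * (real M * S_sp M) powr (2 * s / (2 * s + 1))
          * real M powr (- (2 * s / (2 * s + 1)))
        + remainder_sp \<alpha> C2 C3 M"
proof -
  define A where "A = S_sp M * C1"
  have A: "0 < A" using S_sp_pos C1 by (simp add: A_def)
  have Ks: "Ks = (2 * s * Cs / A) powr (1 / (2 * s + 1))" by (simp add: Ks_def K_opt_def A_def)
  show Kp: "0 < Ks" unfolding Ks using s Cs A by simp
  have rb: "risk_bound \<alpha> s C1 C2 C3 Cs M K = A * K + Cs * K powr (- 2 * s) + remainder_sp \<alpha> C2 C3 M"
    for K by (simp add: risk_bound_def A_def)
  have Kpow: "Ks powr (2 * s + 1) = 2 * s * Cs / A"
    unfolding Ks powr_powr using s Cs A by simp
  have Kpow': "Cs * Ks powr (- 2 * s) = A * Ks / (2 * s)"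
  proof -
    have "Ks powr (- 2 * s) = Ks / Ks powr (2 * s + 1)"
      using Kp by (simp add: powr_minus powr_add field_simps)
    then show ?thesis unfolding Kpow using s Cs A by (simp add: field_simps)
  qed
  show "risk_bound \<alpha> s C1 C2 C3 Cs M Ks < risk_bound \<alpha> s C1 C2 C3 Cs M K"
    if K: "0 < K" "K \<noteq> Ks" for K
  proof -
    define x where "x = K / Ks"
    have x: "0 < x" "x \<noteq> 1" using K Kp by (auto simp: x_def)
    \<comment> \<open>Scaling by \<open>Ks\<close> reduces the claim to \<open>1 + 1/(2s) < x + x powr (-2s) / (2s)\<close>.\<close>
    have Kx: "K = Ks * x" using Kp by (simp add: x_def)
    \<comment> \<open>This inequality replaces calculus: it is applied to
      \<open>x powr (- 2 * s)\<close> and, multiplied by \<open>2 * s\<close>, to \<open>x\<close>;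
      in the sum the logarithms cancel.\<close>
    have lnx: "1 + ln y < y" if "0 < y" "y \<noteq> 1" for y :: real
      using ln_le_minus_one[of y] ln_eq_minus_one[of y] that by force
    have ne: "x powr (- 2 * s) \<noteq> 1"
      using x s by (simp add: powr_def)
    have "1 + ln (x powr (- 2 * s)) < x powr (- 2 * s)"
      using lnx[OF _ ne] x by simp
    then have "1 - 2 * s * ln x < x powr (- 2 * s)"
      using x by (simp add: ln_powr)
    then have "1 - 2 * s * ln x + 2 * s * (1 + ln x) < x powr (- 2 * s) + 2 * s * x"
      using lnx[OF x] s by (intro add_strict_mono) auto
    then have "1 + 2 * s < x powr (- 2 * s) + 2 * s * x" by (simp add: algebra_simps)
    then have "A * Ks / (2 * s) * (1 + 2 * s) < A * Ks / (2 * s) * (x powr (- 2 * s) + 2 * s * x)"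
      using A Kp s by (intro mult_strict_left_mono) auto
    moreover have "A * K + Cs * K powr (- 2 * s)
        = A * Ks * x + Cs * Ks powr (- 2 * s) * x powr (- 2 * s)"
      unfolding Kx using Kp x by (simp add: powr_mult)
    moreover have "A * Ks / (2 * s) * (1 + 2 * s) = A * Ks + A * Ks / (2 * s)"
      and "A * Ks / (2 * s) * (x powr (- 2 * s) + 2 * s * x)
        = A * Ks * x + A * Ks / (2 * s) * x powr (- 2 * s)"
      using s by (simp_all add: field_simps)
    ultimately show ?thesis unfolding rb Kpow' by linarith
  qed
  \<comment> \<open>\<open>A\<close> enters the root as \<open>A powr (2 * s + 1)\<close>, and one
    of these factors cancels the denominator inside \<open>Ks\<close>.\<close>
  have "A * Ks = (2 * s * Cs * A powr (2 * s)) powr (1 / (2 * s + 1))"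
  proof -
    have "A = (A powr (2 * s + 1)) powr (1 / (2 * s + 1))"
      using A s by (simp add: powr_powr)
    then have "A * Ks = (A powr (2 * s + 1) * (2 * s * Cs / A)) powr (1 / (2 * s + 1))"
      unfolding Ks using A s Cs by (metis divide_nonneg_pos less_eq_real_def mult_nonneg_nonneg
          powr_ge_zero powr_mult zero_le_numeral)
    also have "A powr (2 * s + 1) * (2 * s * Cs / A) = 2 * s * Cs * A powr (2 * s)"
      using A by (simp add: powr_add)
    finally show ?thesis .
  qed
  also have "\<dots> = (2 * s * Cs * C1 powr (2 * s)) powr (1 / (2 * s + 1))
      * S_sp M powr (2 * s / (2 * s + 1))"
    using s Cs C1 S_sp_pos[of M] by (simp add: A_def powr_mult powr_powr mult_ac)
  also have "S_sp M powr (2 * s / (2 * s + 1)) = (real M * S_sp M) powr (2 * s / (2 * s + 1))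
          * real M powr (- (2 * s / (2 * s + 1)))"
    using M S_sp_pos[of M] by (simp add: powr_mult powr_minus)
  finally have e: "A * Ks = (2 * s * Cs * C1 powr (2 * s)) powr (1 / (2 * s + 1))
      * (real M * S_sp M) powr (2 * s / (2 * s + 1))
      * real M powr (- (2 * s / (2 * s + 1)))" by (simp add: mult_ac)
  show "risk_bound \<alpha> s C1 C2 C3 Cs M Ks =
        (2 * s + 1) / (2 * s) * (2 * s * Cs * C1 powr (2 * s)) powr (1 / (2 * s + 1))
          * (real M * S_sp M) powr (2 * s / (2 * s + 1))
          * real M powr (- (2 * s / (2 * s + 1)))
        + remainder_sp \<alpha> C2 C3 M"
  proof -
    have "A * Ks + Cs * Ks powr (- 2 * s) = (2 * s + 1) / (2 * s) * (A * Ks)"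
      unfolding Kpow' using s by (simp add: field_simps)
    then show ?thesis unfolding rb e by (simp add: mult_ac)
  qed
qed

text \<open>A half width of at least 1 already makes (2h + 1) / (2h) at most 3/2; for the rate any
  constant will do.\<close>

lemma M_S_sp_le: "real M * S_sp M \<le> 2"
proof -
  have h: "1 \<le> real (half_width M)" using half_width_ge_1[of M] by simp
  have "(2 * real (half_width M) + 1) / (2 * real (half_width M)) * (real M / (real M + 1)) \<le> 2 * 1"
    using h by (intro mult_mono) (auto simp: field_simps)
  then show ?thesis by (simp add: S_sp_def mult_ac)
qed

text \<open>The half width grows like log log M, which every positive power of \<open>M\<close>
  dominates. A convergent sequence is bounded, and this gives one constant that is valid from
  \<open>M = 1\<close> on and not merely eventually.\<close>

lemma half_width_powr_bounded:
  assumes \<epsilon>: "0 < \<epsilon>"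
  obtains C where "0 < C" "\<And>M. 1 \<le> M \<Longrightarrow> 2 * real (half_width M) + 1 \<le> C * real M powr \<epsilon>"
proof -
  have "((\<lambda>x::real. (ln (ln (x + 20)) + 4) / x powr \<epsilon>) \<longlongrightarrow> 0) at_top"
    using \<epsilon> by real_asymp
  then have "(\<lambda>M. (ln (ln (real M + 20)) + 4) / real M powr \<epsilon>) \<longlonglongrightarrow> 0"
    by (rule filterlim_compose) (rule filterlim_real_sequentially)
  then have "Bseq (\<lambda>M. (ln (ln (real M + 20)) + 4) / real M powr \<epsilon>)"
    by (rule convergent_imp_Bseq[OF convergentI])
  then obtain C where C: "0 < C" "\<And>M. norm ((ln (ln (real M + 20)) + 4) / real M powr \<epsilon>) \<le> C"
    by (auto simp: Bseq_def)
  show thesis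
  proof (rule that[OF C(1)])
    fix M :: nat assume M: "1 \<le> M"
    have "2 * real (nat \<lceil>(1 + x) / 2\<rceil>) + 1 \<le> x + 4" if "0 \<le> x" for x :: real
    proof -
      have "0 \<le> \<lceil>(1 + x) / 2\<rceil>" using that by simp
      then have "real (nat \<lceil>(1 + x) / 2\<rceil>) = of_int \<lceil>(1 + x) / 2\<rceil>" by simp
      also have "\<dots> \<le> (1 + x) / 2 + 1" by (rule of_int_ceiling_le_add_one)
      finally have "real (nat \<lceil>(1 + x) / 2\<rceil>) \<le> (1 + x) / 2 + 1" .
      moreover have "2 * n + 1 \<le> x + 4" if "n \<le> (1 + x) / 2 + 1" for n using that by argo
      ultimately show ?thesis by blast
    qed
    from this[OF ln_ln_nonneg[of M]]
    have "2 * real (half_width M) + 1 \<le> ln (ln (real M + 20)) + 4"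
      unfolding half_width_def .
    also have "\<dots> \<le> C * real M powr \<epsilon>"
      using C(2)[of M] ln_ln_nonneg[of M] M by (simp add: divide_le_eq)
    finally show "2 * real (half_width M) + 1 \<le> C * real M powr \<epsilon>" .
  qed
qed

lemma remainder_sp_bounded:
  assumes s: "0 < s" and \<alpha>: "0 < \<alpha>" "s / (2 * s + 1) < \<alpha>" and C: "0 \<le> C2" "0 \<le> C3"
  obtains D where "0 < D"
    "\<And>M. 1 \<le> M \<Longrightarrow> remainder_sp \<alpha> C2 C3 M \<le> D * real M powr (- (2 * s / (2 * s + 1)))"
proof -
  define q where "q = 2 * s / (2 * s + 1)"
  have q: "0 < q" "q < 1" using s by (auto simp: q_def)
  have q\<alpha>: "q < 2 * \<alpha>" using \<alpha>(2) by (simp add: q_def)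
  \<comment> \<open>The largest exponent with both (\<epsilon> - 1) 2 \<alpha> \<le> - q and
    \<epsilon> - 1 \<le> - q. It is positive because q < 2 \<alpha>, which is the condition on
    \<open>\<alpha>\<close>, and q < 1.\<close>
  define \<epsilon> where "\<epsilon> = min (1 - q / (2 * \<alpha>)) (1 - q)"
  have \<epsilon>: "0 < \<epsilon>" using q q\<alpha> \<alpha> by (auto simp: \<epsilon>_def)
  have \<epsilon>1: "\<epsilon> - 1 \<le> - q" and \<epsilon>2: "(\<epsilon> - 1) * (2 * \<alpha>) \<le> - q"
  proof -
    show "\<epsilon> - 1 \<le> - q" by (simp add: \<epsilon>_def)
    have "(\<epsilon> - 1) * (2 * \<alpha>) \<le> (- (q / (2 * \<alpha>))) * (2 * \<alpha>)"
      using \<alpha> by (intro mult_right_mono) (auto simp: \<epsilon>_def)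
    then show "(\<epsilon> - 1) * (2 * \<alpha>) \<le> - q" using \<alpha> by simp
  qed
  obtain A where A: "0 < A" "\<And>M. 1 \<le> M \<Longrightarrow> 2 * real (half_width M) + 1 \<le> A * real M powr \<epsilon>"
    using half_width_powr_bounded[OF \<epsilon>] by blast
  show thesis
  proof (rule that[of "C2 * A powr (2 * \<alpha>) + C3 * A + 1"])
    show "0 < C2 * A powr (2 * \<alpha>) + C3 * A + 1"
      using C A by (intro add_nonneg_pos add_nonneg_nonneg mult_nonneg_nonneg) auto
    fix M :: nat assume M: "1 \<le> M"
    let ?h = "real (half_width M)"
    have h1: "(2 * ?h + 1) / (real M + 1) \<le> A * real M powr (\<epsilon> - 1)"
    proof -
      have "(2 * ?h + 1) / (real M + 1) \<le> (A * real M powr \<epsilon>) / real M"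
        using A M by (intro frac_le) auto
      then show ?thesis using M by (simp add: powr_diff)
    qed
    have "(2 * ?h / (real M + 1)) powr (2 * \<alpha>) \<le> (A * real M powr (\<epsilon> - 1)) powr (2 * \<alpha>)"
      using h1 \<alpha> M by (intro powr_mono2 order_trans[OF _ h1] divide_right_mono) auto
    also have "\<dots> = A powr (2 * \<alpha>) * real M powr ((\<epsilon> - 1) * (2 * \<alpha>))"
      using A by (simp add: powr_mult powr_powr)
    also have "\<dots> \<le> A powr (2 * \<alpha>) * real M powr (- q)"
      using M \<epsilon>2 by (intro mult_left_mono powr_mono) auto
    finally have h2: "(2 * ?h / (real M + 1)) powr (2 * \<alpha>) \<le> A powr (2 * \<alpha>) * real M powr (- q)" .
    have h3: "(2 * ?h + 1) / (real M + 1) \<le> A * real M powr (- q)"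
      using M A \<epsilon>1 by (intro order_trans[OF h1] mult_left_mono powr_mono) auto
    have "remainder_sp \<alpha> C2 C3 M \<le> C2 * (A powr (2 * \<alpha>) * real M powr (- q))
        + C3 * (A * real M powr (- q))"
      unfolding remainder_sp_def using C h2 h3 by (intro add_mono mult_left_mono) auto
    also have "\<dots> \<le> (C2 * A powr (2 * \<alpha>) + C3 * A + 1) * real M powr (- q)"
      by (simp add: algebra_simps)
    finally show "remainder_sp \<alpha> C2 C3 M \<le>
        (C2 * A powr (2 * \<alpha>) + C3 * A + 1) * real M powr (- (2 * s / (2 * s + 1)))"
      by (simp add: q_def)
  qed
qed

section \<open>Binomial distribution functions\<close>

text \<open>The probability that a binomial variable with parameters \<open>M\<close> and
  \<open>p\<close> is smaller than \<open>r\<close>, as a polynomial in \<open>p\<close> that can be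
  integrated term by term.\<close>

definition binom_lt :: "nat \<Rightarrow> nat \<Rightarrow> real \<Rightarrow> real" where
  "binom_lt M r p = (\<Sum>k<r. real (M choose k) * p ^ k * (1 - p) ^ (M - k))"

lemma binom_lt_nonneg: "0 \<le> p \<Longrightarrow> p \<le> 1 \<Longrightarrow> 0 \<le> binom_lt M r p"
  by (auto simp: binom_lt_def intro!: sum_nonneg mult_nonneg_nonneg)

lemma binom_lt_mono_r: "0 \<le> p \<Longrightarrow> p \<le> 1 \<Longrightarrow> r \<le> r' \<Longrightarrow> binom_lt M r p \<le> binom_lt M r' p"
  unfolding binom_lt_def by (intro sum_mono2) (auto intro!: mult_nonneg_nonneg)

text \<open>Condition on one of the \<open>Suc M\<close> trials: after a success fewer than
  \<open>r\<close> of the others may succeed, after a failure fewer than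
  \<open>Suc r\<close>.\<close>

lemma binom_lt_Suc: "binom_lt (Suc M) (Suc r) p = p * binom_lt M r p + (1 - p) * binom_lt M (Suc r) p"
proof (induction r)
  case 0
  then show ?case by (simp add: binom_lt_def)
next
  case (Suc r)
  have step: "real (Suc M choose Suc k) * p ^ Suc k * (1 - p) ^ (Suc M - Suc k) =
      p * (real (M choose k) * p ^ k * (1 - p) ^ (M - k)) +
      (1 - p) * (real (M choose Suc k) * p ^ Suc k * (1 - p) ^ (M - Suc k))" for k
  proof (cases "Suc k \<le> M")
    case True
    then have e: "(1 - p) ^ (M - k) = (1 - p) * (1 - p) ^ (M - Suc k)"
      by (metis Suc_diff_Suc Suc_le_lessD power_Suc)
    show ?thesis unfolding diff_Suc_Suc e by (simp add: algebra_simps)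
  next
    case False
    then show ?thesis by (simp add: algebra_simps)
  qed
  have "binom_lt (Suc M) (Suc (Suc r)) p = binom_lt (Suc M) (Suc r) p +
      real (Suc M choose Suc r) * p ^ Suc r * (1 - p) ^ (Suc M - Suc r)"
    by (simp add: binom_lt_def)
  also have "\<dots> = p * binom_lt M (Suc r) p + (1 - p) * binom_lt M (Suc (Suc r)) p"
    unfolding Suc.IH step by (simp add: binom_lt_def algebra_simps)
  finally show ?case .
qed

text \<open>By the recursion the value is a convex combination of the probabilities for
  \<open>r'\<close> and \<open>Suc r'\<close> in one trial less, with weight \<open>p\<close> on the
  smaller one. Raising \<open>p\<close> shifts weight to the smaller one and, by induction, lowers
  both.\<close>

lemma binom_lt_antimono:
  assumes "0 \<le> p" "p \<le> q" "q \<le> 1"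
  shows "binom_lt M r q \<le> binom_lt M r p"
proof (induction M arbitrary: r)
  case 0
  show ?case
  proof (cases r)
    case 0
    then show ?thesis by (simp add: binom_lt_def)
  next
    case (Suc r')
    have "(\<Sum>k<Suc r'. real (0 choose k) * x ^ k * (1 - x) ^ (0 - k)) = 1" for x :: real
      by (induction r') auto
    then show ?thesis by (simp add: binom_lt_def Suc)
  qed
next
  case (Suc M)
  show ?case
  proof (cases r)
    case 0
    then show ?thesis by (simp add: binom_lt_def)
  next
    case (Suc r')
    have "binom_lt (Suc M) (Suc r') q = binom_lt M (Suc r') q - q * (binom_lt M (Suc r') q - binom_lt M r' q)"
      by (simp add: binom_lt_Suc algebra_simps)
    also have "\<dots> \<le> binom_lt M (Suc r') q - p * (binom_lt M (Suc r') q - binom_lt M r' q)"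
      using assms binom_lt_mono_r[of q r' "Suc r'" M] by (intro diff_left_mono mult_right_mono) auto
    also have "\<dots> = p * binom_lt M r' q + (1 - p) * binom_lt M (Suc r') q"
      by (simp add: algebra_simps)
    also have "\<dots> \<le> p * binom_lt M r' p + (1 - p) * binom_lt M (Suc r') p"
      using assms by (intro add_mono mult_left_mono Suc.IH) auto
    finally show ?thesis by (simp add: Suc binom_lt_Suc)
  qed
qed

lemma has_integral_power_Beta:
  "((\<lambda>p::real. p ^ k * (1 - p) ^ l) has_integral fact k * fact l / fact (k + l + 1)) {0..1}"
proof -
  have "Beta (real k + 1) (real l + 1) = fact k * fact l / fact (k + l + 1)"
    using Gamma_fact[of k, where 'a = real] Gamma_fact[of l, where 'a = real]
      Gamma_fact[of "k + l + 1", where 'a = real]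
    by (simp add: Beta_def add_ac)
  then have *: "((\<lambda>t. t powr real k * (1 - t) powr real l) has_integral
      fact k * fact l / fact (k + l + 1)) {0..1::real}"
    using has_integral_Beta_real[of "real k + 1" "real l + 1"] by simp
  \<comment> \<open>The two kinds of power disagree at the endpoints, since
    \<open>0 powr 0 = 0\<close> but \<open>0 ^ 0 = 1\<close>.\<close>
  show ?thesis
    by (rule has_integral_spike_finite[of "{0, 1}", OF _ _ *]) (auto simp: powr_realpow)
qed

text \<open>For \<open>p\<close> uniform on the unit interval the number of successes is uniform on
  0, ..., M: each of the \<open>r\<close> terms integrates to 1 / (M + 1), whatever \<open>k\<close>
  is.\<close>

lemma has_integral_binom_lt:
  assumes "r \<le> Suc M"
  shows "(binom_lt M r has_integral real r / (real M + 1)) {0..1}"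
proof -
  have "real (M choose k) * (fact k * fact (M - k) / fact (M + 1)) = 1 / (real M + 1)"
    if "k < r" for k
    using that assms binomial_fact[of k M, where 'a = real] by (simp add: fact_reduce[of "M + 1"])
  moreover have "((\<lambda>p. real (M choose k) * (p ^ k * (1 - p) ^ (M - k))) has_integral
      real (M choose k) * (fact k * fact (M - k) / fact (M + 1))) {0..1}" if "k < r" for k
    using has_integral_power_Beta[of k "M - k"] that assms by (intro has_integral_mult_right) simp
  ultimately have "((\<lambda>p. real (M choose k) * (p ^ k * (1 - p) ^ (M - k))) has_integral
      1 / (real M + 1)) {0..1}" if "k < r" for k using that by simp
  then have "((\<lambda>p. \<Sum>k<r. real (M choose k) * (p ^ k * (1 - p) ^ (M - k))) has_integral
      (\<Sum>k<r. 1 / (real M + 1))) {0..1}"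
    by (intro has_integral_sum) auto
  then show ?thesis by (simp add: binom_lt_def[abs_def] mult.assoc)
qed

text \<open>First-moment counterpart of the preceding integral, used for distances instead of
  lengths. The extra factor \<open>p\<close> raises the Beta integral of the \<open>k\<close>-th
  term to (k + 1) / ((M + 1)(M + 2)).\<close>

lemma has_integral_id_binom_lt:
  assumes "r \<le> Suc M"
  shows "((\<lambda>p. p * binom_lt M r p) has_integral
    real r * (real r + 1) / (2 * (real M + 1) * (real M + 2))) {0..1}"
proof -
  have "real (M choose k) * (fact (k + 1) * fact (M - k) / fact (M + 2))
      = (real k + 1) / ((real M + 1) * (real M + 2))"
    if "k < r" for k
  proof -
    have "fact (M + 2) = (real M + 1) * (real M + 2) * fact M"
      and "fact (k + 1) = (real k + 1) * fact k"
      by (simp_all add: algebra_simps)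
    then show ?thesis
      using that assms binomial_fact[of k M, where 'a = real] by simp
  qed
  moreover have "((\<lambda>p. real (M choose k) * (p ^ (k + 1) * (1 - p) ^ (M - k))) has_integral
      real (M choose k) * (fact (k + 1) * fact (M - k) / fact (M + 2))) {0..1}" if "k < r" for k
    using has_integral_power_Beta[of "k + 1" "M - k"] that assms by (intro has_integral_mult_right) simp
  ultimately have "((\<lambda>p. real (M choose k) * (p ^ (k + 1) * (1 - p) ^ (M - k))) has_integral
      (real k + 1) / ((real M + 1) * (real M + 2))) {0..1}" if "k < r" for k using that by simp
  then have "((\<lambda>p. \<Sum>k<r. real (M choose k) * (p ^ (k + 1) * (1 - p) ^ (M - k))) has_integral
      (\<Sum>k<r. (real k + 1) / ((real M + 1) * (real M + 2)))) {0..1}"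
    by (intro has_integral_sum) auto
  moreover have "(\<Sum>k<r. (real k + 1) / ((real M + 1) * (real M + 2)))
      = real r * (real r + 1) / (2 * (real M + 1) * (real M + 2))"
  proof -
    have "(\<Sum>k<r. real k + 1) = real r * (real r + 1) / 2"
      by (induction r) (auto simp: field_simps)
    then show ?thesis
      unfolding sum_divide_distrib[symmetric] by (simp only: divide_divide_eq_left mult.assoc)
  qed
  ultimately show ?thesis by (simp add: binom_lt_def[abs_def] sum_distrib_left mult_ac)
qed

text \<open>The count is determined by the set of indices that satisfy \<open>Q\<close>, and this
  set has only finitely many possible values.\<close>

lemma measurable_card_finite:
  assumes V: "finite V" and Q: "\<And>v. v \<in> V \<Longrightarrow> {x\<in>space M. Q v x} \<in> sets M"
  shows "(\<lambda>x. card {v\<in>V. Q v x}) \<in> measurable M (count_space UNIV)"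
proof -
  have "(\<lambda>x. card {v\<in>V. Q v x}) -` {n} \<inter> space M =
      (\<Union>S\<in>{S. S \<subseteq> V \<and> card S = n}. {x\<in>space M. \<forall>v\<in>V. Q v x \<longleftrightarrow> v \<in> S})" for n
  proof (intro equalityI subsetI)
    fix x assume "x \<in> (\<lambda>x. card {v\<in>V. Q v x}) -` {n} \<inter> space M"
    then show "x \<in> (\<Union>S\<in>{S. S \<subseteq> V \<and> card S = n}. {x\<in>space M. \<forall>v\<in>V. Q v x \<longleftrightarrow> v \<in> S})"
      by (auto intro!: exI[of _ "{v\<in>V. Q v x}"])
  next
    fix x assume "x \<in> (\<Union>S\<in>{S. S \<subseteq> V \<and> card S = n}. {x\<in>space M. \<forall>v\<in>V. Q v x \<longleftrightarrow> v \<in> S})"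
    then obtain S where "S \<subseteq> V" "card S = n" "x \<in> space M" "\<forall>v\<in>V. Q v x \<longleftrightarrow> v \<in> S" by auto
    moreover from this have "{v\<in>V. Q v x} = S" by auto
    ultimately show "x \<in> (\<lambda>x. card {v\<in>V. Q v x}) -` {n} \<inter> space M" by auto
  qed
  moreover have "{x\<in>space M. \<forall>v\<in>V. Q v x \<longleftrightarrow> v \<in> S} \<in> sets M" for S
  proof (rule sets.sets_Collect_finite_All[OF _ V])
    fix v assume "v \<in> V"
    from Q[OF this] show "{x\<in>space M. Q v x \<longleftrightarrow> v \<in> S} \<in> sets M"
      by (cases "v \<in> S") (auto intro: sets.sets_Collect_neg)
  qed
  ultimately show ?thesis
    using V by (subst measurable_count_space_eq2_countable)
      (auto intro!: sets.finite_UN finite_subset[of _ "Pow V"])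
qed

text \<open>In a small sample the half width is large compared with \<open>M\<close>, so values of
  \<open>r\<close> beyond \<open>Suc M\<close> do occur; the identity then becomes an
  inequality.\<close>

lemma nn_integral_binom_lt:
  "(\<integral>\<^sup>+p\<in>{0..1}. ennreal (binom_lt M r p) \<partial>lborel) \<le> ennreal (real r / (real M + 1))"
proof (cases "r \<le> Suc M")
  case True
  have "(\<integral>\<^sup>+p\<in>{0..1}. ennreal (binom_lt M r p) \<partial>lborel) = ennreal (real r / (real M + 1))"
    by (rule nn_integral_has_integral_lebesgue'[OF _ has_integral_binom_lt[OF True]])
       (simp add: binom_lt_nonneg)
  then show ?thesis by simp
next
  case False
  \<comment> \<open>The terms with \<open>k > M\<close> vanish, so the left-hand side no longer
    changes from \<open>Suc M\<close> on while the right-hand side keeps growing.\<close>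
  have eq: "binom_lt M r = binom_lt M (Suc M)"
  proof
    fix p show "binom_lt M r p = binom_lt M (Suc M) p"
      unfolding binom_lt_def using False by (intro sum.mono_neutral_right) auto
  qed
  have "(\<integral>\<^sup>+p\<in>{0..1}. ennreal (binom_lt M r p) \<partial>lborel) = ennreal (real (Suc M) / (real M + 1))"
    unfolding eq
    by (rule nn_integral_has_integral_lebesgue'[OF _ has_integral_binom_lt[OF order_refl]])
       (simp add: binom_lt_nonneg)
  also have "\<dots> \<le> ennreal (real r / (real M + 1))"
    using False by (intro ennreal_leI divide_right_mono) auto
  finally show ?thesis .
qed

lemma nn_integral_id_binom_lt:
  "(\<integral>\<^sup>+p\<in>{0..1}. ennreal (p * binom_lt M r p) \<partial>lborel)
     \<le> ennreal (real r * (real r + 1) / (2 * (real M + 1) * (real M + 2)))"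
proof (cases "r \<le> Suc M")
  case True
  have "(\<integral>\<^sup>+p\<in>{0..1}. ennreal (p * binom_lt M r p) \<partial>lborel)
      = ennreal (real r * (real r + 1) / (2 * (real M + 1) * (real M + 2)))"
    by (rule nn_integral_has_integral_lebesgue'[OF _ has_integral_id_binom_lt[OF True]])
       (simp add: binom_lt_nonneg)
  then show ?thesis by simp
next
  case False
  have eq: "binom_lt M r = binom_lt M (Suc M)"
  proof
    fix p show "binom_lt M r p = binom_lt M (Suc M) p"
      unfolding binom_lt_def using False by (intro sum.mono_neutral_right) auto
  qed
  have "(\<integral>\<^sup>+p\<in>{0..1}. ennreal (p * binom_lt M r p) \<partial>lborel)
     = ennreal (real (Suc M) * (real (Suc M) + 1) / (2 * (real M + 1) * (real M + 2)))"
    unfolding eq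
    by (rule nn_integral_has_integral_lebesgue'[OF _ has_integral_id_binom_lt[OF order_refl]])
       (simp add: binom_lt_nonneg)
  also have "\<dots> \<le> ennreal (real r * (real r + 1) / (2 * (real M + 1) * (real M + 2)))"
    using False by (intro ennreal_leI divide_right_mono mult_mono) auto
  finally show ?thesis .
qed

section \<open>Lebesgue measure on the interval and affine changes of variable\<close>

lemma space_leb_on [simp]: "space (leb_on a b) = {a..b}"
  by (simp add: leb_on_def space_restrict_space)

lemma nn_integral_leb_on: "(\<integral>\<^sup>+x. f x \<partial>leb_on a b) = (\<integral>\<^sup>+x\<in>{a..b}. f x \<partial>lborel)"
  by (simp add: leb_on_def nn_integral_restrict_space)

lemma sigma_finite_leb_on: "sigma_finite_measure (leb_on a b)"
  unfolding leb_on_def by (rule sigma_finite_measure_restrict_space) (auto intro: lborel.sigma_finite_measure_axioms)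

lemma borel_measurable_leb_on: "f \<in> borel_measurable borel \<Longrightarrow> f \<in> borel_measurable (leb_on a b)"
  unfolding leb_on_def by (intro measurable_restrict_space1) simp

lemma id_measurable_leb_on [measurable]: "(\<lambda>x. x) \<in> measurable (leb_on a b) borel"
  by (rule borel_measurable_leb_on) simp

lemma emeasure_leb_on: "A \<in> sets (leb_on a b) \<Longrightarrow> emeasure (leb_on a b) A = emeasure lborel A"
  unfolding leb_on_def by (subst emeasure_restrict_space) (auto simp: sets_restrict_space)

text \<open>The substitution p = c |y - x| is affine on either side of \<open>x\<close> and maps it
  into the unit interval because \<open>c * (b - a) \<le> 1\<close>. Enlarging the image to the
  whole unit interval makes the bound independent of \<open>x\<close>.\<close>

lemma nn_integral_scaled_distance:
  fixes F :: "real \<Rightarrow> ennreal"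
  assumes c: "0 < c" "c * (b - a) \<le> 1" and x: "x \<in> {a..b}" and F[measurable]: "F \<in> borel_measurable borel"
  shows "(\<integral>\<^sup>+y. F (c * \<bar>y - x\<bar>) * indicator {x..} y \<partial>leb_on a b)
           \<le> ennreal (1 / c) * (\<integral>\<^sup>+p\<in>{0..1}. F p \<partial>lborel)" (is ?right)
    and "(\<integral>\<^sup>+y. F (c * \<bar>y - x\<bar>) * indicator {..x} y \<partial>leb_on a b)
           \<le> ennreal (1 / c) * (\<integral>\<^sup>+p\<in>{0..1}. F p \<partial>lborel)" (is ?left)
proof -
  have mono: "c * z \<le> 1" if "z \<le> b - a" for z
  proof -
    have "c * z \<le> c * (b - a)" using that c by (intro mult_left_mono) auto
    from order_trans[OF this c(2)] show ?thesis .
  qed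
  \<comment> \<open>A slope of either sign is allowed, so that one substitution serves both sides of
    \<open>x\<close>.\<close>
  have aff: "(\<integral>\<^sup>+y. F (t + d * y) * indicator {0..1} (t + d * y) \<partial>lborel)
      = ennreal (1 / c) * (\<integral>\<^sup>+p\<in>{0..1}. F p \<partial>lborel)" if d: "\<bar>d\<bar> = c" for t d
  proof -
    have dn: "d \<noteq> 0" using c d by auto
    have "(\<integral>\<^sup>+p\<in>{0..1}. F p \<partial>lborel)
        = ennreal c * (\<integral>\<^sup>+y. F (t + d * y) * indicator {0..1} (t + d * y) \<partial>lborel)"
      using d by (subst nn_integral_real_affine[OF _ dn, of _ t]) auto
    moreover have "ennreal (1 / c) * ennreal c = 1" using c by (simp flip: ennreal_mult)
    ultimately show ?thesis by (simp add: mult.assoc[symmetric])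
  qed
  show ?right
  proof -
    have "(\<integral>\<^sup>+y. F (c * \<bar>y - x\<bar>) * indicator {x..} y \<partial>leb_on a b)
        \<le> (\<integral>\<^sup>+y. F (- c * x + c * y) * indicator {0..1} (- c * x + c * y) \<partial>lborel)"
      unfolding nn_integral_leb_on
    proof (rule nn_integral_mono)
      fix y
      have "y \<in> {a..b} \<and> y \<in> {x..} \<Longrightarrow> c * (y - x) \<in> {0..1}"
        using mono[of "y - x"] x c by auto
      then show "F (c * \<bar>y - x\<bar>) * indicator {x..} y * indicator {a..b} y
          \<le> F (- c * x + c * y) * indicator {0..1} (- c * x + c * y)"
        by (auto simp: indicator_def algebra_simps split: if_splits)
    qed
    then show ?thesis using aff[of c "- c * x"] c by simp
  qed
  show ?left
  proof -
    have "(\<integral>\<^sup>+y. F (c * \<bar>y - x\<bar>) * indicator {..x} y \<partial>leb_on a b)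
        \<le> (\<integral>\<^sup>+y. F (c * x + (- c) * y) * indicator {0..1} (c * x + (- c) * y) \<partial>lborel)"
      unfolding nn_integral_leb_on
    proof (rule nn_integral_mono)
      fix y
      have "y \<in> {a..b} \<and> y \<in> {..x} \<Longrightarrow> c * (x - y) \<in> {0..1}"
        using mono[of "x - y"] x c by auto
      then show "F (c * \<bar>y - x\<bar>) * indicator {..x} y * indicator {a..b} y
          \<le> F (c * x + (- c) * y) * indicator {0..1} (c * x + (- c) * y)"
        by (auto simp: indicator_def algebra_simps split: if_splits)
    qed
    then show ?thesis using aff[of "- c" "c * x"] c by simp
  qed
qed

section \<open>Counting independent visit times\<close>

text \<open>The estimates see the density through its lower bound \<open>c\<close>, later
  \<open>g_min\<close>. The index type is abstract because counting ignores how the visits are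
  grouped into subjects.\<close>

locale visit_times = prob_space P for P :: "'w measure" +
  fixes a b c :: real and g :: "real \<Rightarrow> real" and V :: "'v set" and T :: "'v \<Rightarrow> 'w \<Rightarrow> real"
  assumes ab: "a < b" and finV: "finite V" and neV: "V \<noteq> {}"
    and indepT: "indep_vars (\<lambda>_. leb_on a b) T V"
    and distT: "\<And>v. v \<in> V \<Longrightarrow> distributed P (leb_on a b) (T v) (\<lambda>t. ennreal (g t))"
    and c_pos: "0 < c" and c_le_g: "\<And>t. t \<in> {a..b} \<Longrightarrow> c \<le> g t"
begin

abbreviation "lam \<equiv> leb_on a b"

lemma T_meas [measurable]: "v \<in> V \<Longrightarrow> T v \<in> measurable P lam"
  using distT by (rule distributed_measurable)

lemma T_in: "v \<in> V \<Longrightarrow> \<omega> \<in> space P \<Longrightarrow> T v \<omega> \<in> {a..b}"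
  using measurable_space[OF T_meas] by simp

lemma g_meas [measurable]: "(\<lambda>t. ennreal (g t)) \<in> borel_measurable lam"
  using neV distT by (auto dest: distributed_borel_measurable)

lemma emeasure_T:
  assumes "v \<in> V" "A \<in> sets lam"
  shows "emeasure P {\<omega>\<in>space P. T v \<omega> \<in> A} = (\<integral>\<^sup>+t\<in>A. ennreal (g t) \<partial>lam)"
proof -
  have "emeasure P {\<omega>\<in>space P. T v \<omega> \<in> A} = emeasure (distr P lam (T v)) A"
    using assms by (subst emeasure_distr) (auto intro!: arg_cong2[where f=emeasure])
  also have "\<dots> = (\<integral>\<^sup>+t\<in>A. ennreal (g t) \<partial>lam)"
    using assms by (simp add: distributed_distr_eq_density[OF distT] emeasure_density)
  finally show ?thesis .
qed

lemma emeasure_T_ge: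
  assumes "v \<in> V" "A \<in> sets lam"
  shows "ennreal c * emeasure lborel A \<le> emeasure P {\<omega>\<in>space P. T v \<omega> \<in> A}"
proof -
  have "ennreal c * emeasure lborel A = (\<integral>\<^sup>+t\<in>A. ennreal c \<partial>lam)"
    using assms by (simp add: nn_integral_cmult_indicator emeasure_leb_on)
  also have "\<dots> \<le> (\<integral>\<^sup>+t\<in>A. ennreal (g t) \<partial>lam)"
    by (intro nn_integral_mono) (auto intro!: mult_right_mono ennreal_leI c_le_g)
  finally show ?thesis using assms by (simp add: emeasure_T)
qed

text \<open>The density has total mass 1. Hence \<open>c * \<bar>y - x\<bar>\<close> is a legitimate
  success probability for any two points of the interval.\<close>

lemma c_length_le_1: "c * (b - a) \<le> 1"
proof -
  obtain v where v: "v \<in> V" using neV by auto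
  have "ennreal (c * (b - a)) = ennreal c * emeasure lborel {a..b}"
    using ab c_pos by (simp add: ennreal_mult)
  also have "\<dots> \<le> emeasure P {\<omega>\<in>space P. T v \<omega> \<in> {a..b}}"
    using v by (intro emeasure_T_ge) (auto simp: leb_on_def sets_restrict_space)
  also have "\<dots> \<le> 1" by (rule emeasure_le_1)
  finally show ?thesis by (simp add: ennreal_le_iff[of 1, simplified])
qed

text \<open>The visit times have a density, so they avoid Lebesgue null sets. This carries
  statements about almost every time over to the random times.\<close>

lemma AE_T:
  assumes "AE t in lam. Q t" "v \<in> V"
  shows "AE \<omega> in P. Q (T v \<omega>)"
proof -
  have "AE t in density lam (\<lambda>t. ennreal (g t)). Q t"
    using assms(1) by (subst AE_density) auto
  then have "AE t in distr P lam (T v). Q t"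
    unfolding distributed_distr_eq_density[OF distT[OF assms(2)]] .
  then show ?thesis using T_meas[OF assms(2)] by (rule AE_distrD[rotated])
qed

text \<open>Split the event by the exact set \<open>S\<close> of visits that fall into
  \<open>A\<close>. Independence evaluates each piece, and the binomial coefficient counts the sets
  of size \<open>k\<close>.\<close>

lemma prob_count_lt:
  assumes A: "A \<in> sets lam" and q: "\<And>v. v \<in> V \<Longrightarrow> prob {\<omega>\<in>space P. T v \<omega> \<in> A} = q"
  shows "prob {\<omega>\<in>space P. card {v\<in>V. T v \<omega> \<in> A} < r} = binom_lt (card V) r q"
proof -
  define B where "B S v = (if v \<in> S then A else space lam - A)" for S :: "'v set" and v
  define E where "E S = (\<Inter>v\<in>V. T v -` B S v \<inter> space P)" for S
  define F where "F k = {S. S \<subseteq> V \<and> card S = k}" for k :: nat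
  have B: "B S v \<in> sets lam" for S v using A sets.compl_sets[OF A] by (simp add: B_def)
  have finF: "finite (F k)" for k
    unfolding F_def by (rule finite_subset[of _ "Pow V"]) (use finV in auto)
  have Es: "E S \<in> sets P" for S
    unfolding E_def using finV neV B by (intro sets.finite_INT) (auto intro: measurable_sets)
  have inE: "\<omega> \<in> E S \<longleftrightarrow> \<omega> \<in> space P \<and> {v\<in>V. T v \<omega> \<in> A} = S" if "S \<subseteq> V" for S \<omega>
    using that T_in neV by (auto simp: E_def B_def split: if_splits)
  have pE: "prob (E S) = q ^ k * (1 - q) ^ (card V - k)" if "S \<in> F k" for S k
  proof -
    have S: "S \<subseteq> V" "card S = k" using that by (auto simp: F_def)
    have "prob (E S) = (\<Prod>v\<in>V. prob (T v -` B S v \<inter> space P))"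
      unfolding E_def using neV finV B by (intro indep_varsD_finite[OF indepT]) auto
    also have "\<dots> = (\<Prod>v\<in>V. if v \<in> S then q else 1 - q)"
    proof (rule prod.cong[OF refl])
      fix v assume v: "v \<in> V"
      have e: "T v -` A \<inter> space P = {\<omega>\<in>space P. T v \<omega> \<in> A}" by auto
      have m: "{\<omega>\<in>space P. T v \<omega> \<in> A} \<in> events"
        using measurable_sets[OF T_meas[OF v] A] unfolding e .
      have "T v -` (space lam - A) \<inter> space P = space P - {\<omega>\<in>space P. T v \<omega> \<in> A}"
        using T_in[OF v] by auto
      then show "prob (T v -` B S v \<inter> space P) = (if v \<in> S then q else 1 - q)"
        using q[OF v] e prob_compl[OF m] by (auto simp: B_def)
    qed
    also have "\<dots> = q ^ card S * (1 - q) ^ card (V - S)"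
    proof -
      have "V \<inter> {v. v \<in> S} = S" "V \<inter> - {v. v \<in> S} = V - S" using S by auto
      then show ?thesis using finV by (simp add: prod.If_cases)
    qed
    finally show ?thesis using S finV by (simp add: card_Diff_subset finite_subset)
  qed
  have "{\<omega>\<in>space P. card {v\<in>V. T v \<omega> \<in> A} < r} = (\<Union>S\<in>(\<Union>k<r. F k). E S)"
  proof (intro equalityI subsetI)
    fix \<omega> assume w: "\<omega> \<in> {\<omega>\<in>space P. card {v\<in>V. T v \<omega> \<in> A} < r}"
    then have "\<omega> \<in> E {v\<in>V. T v \<omega> \<in> A}" by (subst inE) auto
    with w show "\<omega> \<in> (\<Union>S\<in>(\<Union>k<r. F k). E S)"
      by (intro UN_I[of "{v\<in>V. T v \<omega> \<in> A}"] UN_I[of "card {v\<in>V. T v \<omega> \<in> A}"]) (auto simp: F_def)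
  next
    fix \<omega> assume "\<omega> \<in> (\<Union>S\<in>(\<Union>k<r. F k). E S)"
    then obtain S where "S \<subseteq> V" "card S < r" "\<omega> \<in> E S" by (auto simp: F_def)
    then show "\<omega> \<in> {\<omega>\<in>space P. card {v\<in>V. T v \<omega> \<in> A} < r}" using inE by auto
  qed
  also have "prob \<dots> = (\<Sum>S\<in>(\<Union>k<r. F k). prob (E S))"
  proof (rule finite_measure_finite_Union)
    show "disjoint_family_on E (\<Union>k<r. F k)"
      unfolding disjoint_family_on_def using inE by (fastforce simp: F_def)
  qed (use finF Es in auto)
  also have "\<dots> = (\<Sum>k<r. \<Sum>S\<in>F k. prob (E S))"
    using finF by (intro sum.UNION_disjoint) (auto simp: F_def)
  also have "\<dots> = (\<Sum>k<r. real (card V choose k) * q ^ k * (1 - q) ^ (card V - k))"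
    using n_subsets[OF finV] by (simp add: pE F_def mult.assoc)
  finally show ?thesis by (simp add: binom_lt_def)
qed

text \<open>The true success probability is some \<open>q\<close> of which only a lower bound is
  known; since the binomial tail decreases in it, the lower bound may be inserted.\<close>

lemma emeasure_count_lt_le:
  assumes A: "A \<in> sets lam" and p: "0 \<le> p" "ennreal p \<le> ennreal c * emeasure lborel A"
  shows "emeasure P {\<omega>\<in>space P. card {v\<in>V. T v \<omega> \<in> A} < r} \<le> ennreal (binom_lt (card V) r p)"
proof -
  obtain w where w: "w \<in> V" using neV by auto
  define q where "q = prob {\<omega>\<in>space P. T w \<omega> \<in> A}"
  have q: "prob {\<omega>\<in>space P. T v \<omega> \<in> A} = q" if "v \<in> V" for v
    using emeasure_T[OF that A] emeasure_T[OF w A] by (simp add: q_def measure_def)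
  have "ennreal p \<le> ennreal q"
    using order_trans[OF p(2) emeasure_T_ge[OF w A]] by (simp add: q_def emeasure_eq_measure)
  then have "p \<le> q" by (simp add: ennreal_le_iff q_def)
  moreover have "q \<le> 1" by (simp add: q_def)
  ultimately show ?thesis
    using p prob_count_lt[OF A q] binom_lt_antimono[of p q]
    by (simp add: emeasure_eq_measure ennreal_leI)
qed

text \<open>The interval is half-open so that the count is an increment of the counting function,
  and symmetric in its ends so that both sides of \<open>x\<close> are treated at once.\<close>

definition between :: "'w \<Rightarrow> real \<Rightarrow> real \<Rightarrow> nat" where
  "between \<omega> x y = card {v\<in>V. min x y < T v \<omega> \<and> T v \<omega> \<le> max x y}"

lemma between_measurable [measurable]:
  "(\<lambda>(\<omega>, x, y). between \<omega> x y) \<in> measurable (P \<Otimes>\<^sub>M (lam \<Otimes>\<^sub>M lam)) (count_space UNIV)"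
  unfolding between_def case_prod_beta
proof (intro measurable_card_finite finV)
  fix v assume [measurable]: "v \<in> V"
  have [measurable]: "T v \<in> borel_measurable P"
    using measurable_compose[OF T_meas[OF \<open>v \<in> V\<close>] id_measurable_leb_on] .
  show "{z \<in> space (P \<Otimes>\<^sub>M (lam \<Otimes>\<^sub>M lam)). min (fst (snd z)) (snd (snd z)) < T v (fst z) \<and>
      T v (fst z) \<le> max (fst (snd z)) (snd (snd z))} \<in> sets (P \<Otimes>\<^sub>M (lam \<Otimes>\<^sub>M lam))"
    by measurable
qed

section \<open>Expected lengths of sets described by counts\<close>

lemma emeasure_between_le:
  assumes "x \<in> {a..b}" "y \<in> {a..b}"
  shows "emeasure P {\<omega>\<in>space P. between \<omega> x y < r} \<le> ennreal (binom_lt (card V) r (c * \<bar>y - x\<bar>))"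
proof -
  have sub: "{min x y<..max x y} \<subseteq> {a..b}" using assms by auto
  have "ennreal (c * \<bar>y - x\<bar>) = ennreal c * emeasure lborel {min x y<..max x y}"
    using c_pos by (auto simp: ennreal_mult min_def max_def)
  then have "emeasure P {\<omega>\<in>space P. card {v\<in>V. T v \<omega> \<in> {min x y<..max x y}} < r}
      \<le> ennreal (binom_lt (card V) r (c * \<bar>y - x\<bar>))"
    using c_pos sub
    by (intro emeasure_count_lt_le) (auto simp: leb_on_def sets_restrict_space intro!: image_eqI[where x="{min x y<..max x y}"])
  then show ?thesis by (simp add: between_def)
qed

lemma emeasure_outside_le:
  assumes "x \<in> {a..b}"
  shows "emeasure P {\<omega>\<in>space P. card {v\<in>V. T v \<omega> \<le> x} < r} \<le> ennreal (binom_lt (card V) r (c * \<bar>a - x\<bar>))"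
    and "emeasure P {\<omega>\<in>space P. card {v\<in>V. x < T v \<omega>} < r} \<le> ennreal (binom_lt (card V) r (c * \<bar>b - x\<bar>))"
proof -
  have "ennreal (c * \<bar>a - x\<bar>) = ennreal c * emeasure lborel {a..x}"
    using c_pos assms by (auto simp: ennreal_mult)
  then have "emeasure P {\<omega>\<in>space P. card {v\<in>V. T v \<omega> \<in> {a..x}} < r}
      \<le> ennreal (binom_lt (card V) r (c * \<bar>a - x\<bar>))"
    using c_pos assms
    by (intro emeasure_count_lt_le) (auto simp: leb_on_def sets_restrict_space intro!: image_eqI[where x="{a..x}"])
  moreover have "{\<omega>\<in>space P. card {v\<in>V. T v \<omega> \<in> {a..x}} < r} = {\<omega>\<in>space P. card {v\<in>V. T v \<omega> \<le> x} < r}"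
    using T_in by (auto cong: conj_cong)
  ultimately show "emeasure P {\<omega>\<in>space P. card {v\<in>V. T v \<omega> \<le> x} < r}
      \<le> ennreal (binom_lt (card V) r (c * \<bar>a - x\<bar>))" by simp
  have "ennreal (c * \<bar>b - x\<bar>) = ennreal c * emeasure lborel {x<..b}"
    using c_pos assms by (auto simp: ennreal_mult)
  then have "emeasure P {\<omega>\<in>space P. card {v\<in>V. T v \<omega> \<in> {x<..b}} < r}
      \<le> ennreal (binom_lt (card V) r (c * \<bar>b - x\<bar>))"
    using c_pos assms
    by (intro emeasure_count_lt_le) (auto simp: leb_on_def sets_restrict_space intro!: image_eqI[where x="{x<..b}"])
  moreover have "{\<omega>\<in>space P. card {v\<in>V. T v \<omega> \<in> {x<..b}} < r} = {\<omega>\<in>space P. card {v\<in>V. x < T v \<omega>} < r}"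
    using T_in by (auto cong: conj_cong)
  ultimately show "emeasure P {\<omega>\<in>space P. card {v\<in>V. x < T v \<omega>} < r}
      \<le> ennreal (binom_lt (card V) r (c * \<bar>b - x\<bar>))" by simp
qed

text \<open>After Tonelli the inner integral is the probability of a small count, at most a binomial
  tail at c |y - x|, to which the substitution p = c |y - x| applies. The weight \<open>k\<close>
  will be 1 for lengths and p / c for distances.\<close>

lemma nn_integral_between_le:
  fixes k :: "real \<Rightarrow> real"
  assumes x: "x \<in> {a..b}" and k[measurable]: "k \<in> borel_measurable borel" and k0: "\<And>p. 0 \<le> p \<Longrightarrow> 0 \<le> k p"
    and A: "A = {x..} \<or> A = {..x}"
  shows "(\<integral>\<^sup>+\<omega>. \<integral>\<^sup>+y. ennreal (k (c * \<bar>y - x\<bar>)) * indicator {y\<in>A. between \<omega> x y < r} y \<partial>lam \<partial>P)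
      \<le> ennreal (1 / c) * (\<integral>\<^sup>+p\<in>{0..1}. ennreal (k p * binom_lt (card V) r p) \<partial>lborel)"
proof -
  interpret L: sigma_finite_measure lam by (rule sigma_finite_leb_on)
  interpret PL: pair_sigma_finite P lam ..
  have [measurable]: "A \<in> sets borel" using A by auto
  have [measurable]: "(\<lambda>z. between (fst z) x (snd z)) \<in> measurable (P \<Otimes>\<^sub>M lam) (count_space UNIV)"
    using measurable_compose[OF _ between_measurable, of "\<lambda>z. (fst z, x, snd z)" "P \<Otimes>\<^sub>M lam"] x by simp
  have e: "ennreal (k (c * \<bar>y - x\<bar>)) * indicator {y\<in>A. between \<omega> x y < r} y
      = ennreal (k (c * \<bar>y - x\<bar>)) * indicator A y * (if between \<omega> x y < r then 1 else 0)" for \<omega> y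
    by (auto simp: indicator_def)
  have "(\<integral>\<^sup>+\<omega>. \<integral>\<^sup>+y. ennreal (k (c * \<bar>y - x\<bar>)) * indicator {y\<in>A. between \<omega> x y < r} y \<partial>lam \<partial>P)
      = (\<integral>\<^sup>+y. \<integral>\<^sup>+\<omega>. ennreal (k (c * \<bar>y - x\<bar>)) * indicator A y * (if between \<omega> x y < r then 1 else 0) \<partial>P \<partial>lam)"
    unfolding e by (intro PL.Fubini'[symmetric]) measurable
  also have "\<dots> = (\<integral>\<^sup>+y. ennreal (k (c * \<bar>y - x\<bar>)) * indicator A y *
      emeasure P {\<omega>\<in>space P. between \<omega> x y < r} \<partial>lam)"
  proof (rule nn_integral_cong)
    fix y assume y: "y \<in> space lam"
    have [measurable]: "{\<omega>\<in>space P. between \<omega> x y < r} \<in> events"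
    proof -
      have "(\<lambda>\<omega>. between \<omega> x y) \<in> measurable P (count_space UNIV)"
        using measurable_compose[OF _ between_measurable, of "\<lambda>z. (z, x, y)" P] x y by simp
      then show ?thesis by measurable
    qed
    have "(\<integral>\<^sup>+\<omega>. ennreal (k (c * \<bar>y - x\<bar>)) * indicator A y * (if between \<omega> x y < r then 1 else 0) \<partial>P)
        = (\<integral>\<^sup>+\<omega>. ennreal (k (c * \<bar>y - x\<bar>)) * indicator A y * indicator {\<omega>\<in>space P. between \<omega> x y < r} \<omega> \<partial>P)"
      by (intro nn_integral_cong) (auto simp: indicator_def)
    then show "(\<integral>\<^sup>+\<omega>. ennreal (k (c * \<bar>y - x\<bar>)) * indicator A y * (if between \<omega> x y < r then 1 else 0) \<partial>P)
        = ennreal (k (c * \<bar>y - x\<bar>)) * indicator A y * emeasure P {\<omega>\<in>space P. between \<omega> x y < r}"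
      by (simp add: nn_integral_cmult_indicator)
  qed
  also have "\<dots> \<le> (\<integral>\<^sup>+y. ennreal (k (c * \<bar>y - x\<bar>) * binom_lt (card V) r (c * \<bar>y - x\<bar>)) * indicator A y \<partial>lam)"
  proof (rule nn_integral_mono)
    fix y assume "y \<in> space lam"
    then have "emeasure P {\<omega>\<in>space P. between \<omega> x y < r} \<le> ennreal (binom_lt (card V) r (c * \<bar>y - x\<bar>))"
      using emeasure_between_le[OF x] by simp
    then have "ennreal (k (c * \<bar>y - x\<bar>)) * emeasure P {\<omega>\<in>space P. between \<omega> x y < r}
       \<le> ennreal (k (c * \<bar>y - x\<bar>) * binom_lt (card V) r (c * \<bar>y - x\<bar>))"
      using k0[of "c * \<bar>y - x\<bar>"] c_pos by (simp add: ennreal_mult' mult_left_mono)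
    then show "ennreal (k (c * \<bar>y - x\<bar>)) * indicator A y * emeasure P {\<omega>\<in>space P. between \<omega> x y < r}
      \<le> ennreal (k (c * \<bar>y - x\<bar>) * binom_lt (card V) r (c * \<bar>y - x\<bar>)) * indicator A y"
      by (auto simp: indicator_def)
  qed
  also have "\<dots> \<le> ennreal (1 / c) * (\<integral>\<^sup>+p\<in>{0..1}. ennreal (k p * binom_lt (card V) r p) \<partial>lborel)"
  proof -
    have m: "(\<lambda>p. ennreal (k p * binom_lt (card V) r p)) \<in> borel_measurable borel"
      unfolding binom_lt_def by measurable
    show ?thesis
      using A nn_integral_scaled_distance[OF c_pos c_length_le_1 x m] by blast
  qed
  finally show ?thesis .
qed

lemma nn_integral_spacing_le:
  assumes "x \<in> {a..b}" "A = {x..} \<or> A = {..x}"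
  shows "(\<integral>\<^sup>+\<omega>. \<integral>\<^sup>+y. indicator {y\<in>A. between \<omega> x y < r} y \<partial>lam \<partial>P)
      \<le> ennreal (real r / ((real (card V) + 1) * c))"
proof -
  have "(\<integral>\<^sup>+\<omega>. \<integral>\<^sup>+y. indicator {y\<in>A. between \<omega> x y < r} y \<partial>lam \<partial>P)
      \<le> ennreal (1 / c) * (\<integral>\<^sup>+p\<in>{0..1}. ennreal (1 * binom_lt (card V) r p) \<partial>lborel)"
    using nn_integral_between_le[OF assms(1) _ _ assms(2), of "\<lambda>_. 1"] by simp
  also have "\<dots> \<le> ennreal (1 / c) * ennreal (real r / (real (card V) + 1))"
    using nn_integral_binom_lt[of "card V" r] by (simp add: mult_left_mono)
  also have "\<dots> = ennreal (real r / ((real (card V) + 1) * c))"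
    using c_pos by (subst ennreal_mult'[symmetric]) (auto simp: mult_ac)
  finally show ?thesis .
qed

lemma nn_integral_distance_le:
  assumes x: "x \<in> {a..b}"
  shows "(\<integral>\<^sup>+\<omega>. \<integral>\<^sup>+y. ennreal \<bar>y - x\<bar> * indicator {y. between \<omega> x y < r} y \<partial>lam \<partial>P)
      \<le> ennreal (real r * (real r + 1) / ((real (card V) + 1) * (real (card V) + 2) * c\<^sup>2))"
proof -
  \<comment> \<open>Of the two factors 1 / c, one comes from writing |y - x| as p / c and one from
    the substitution. Adding the two sides of \<open>x\<close> cancels the 2 in this
    denominator.\<close>
  let ?B = "real r * (real r + 1) / (2 * (real (card V) + 1) * (real (card V) + 2))"
  have half: "(\<integral>\<^sup>+\<omega>. \<integral>\<^sup>+y. ennreal \<bar>y - x\<bar> * indicator {y\<in>A. between \<omega> x y < r} y \<partial>lam \<partial>P)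
      \<le> ennreal (?B / c\<^sup>2)" if A: "A = {x..} \<or> A = {..x}" for A
  proof -
    have "(\<integral>\<^sup>+\<omega>. \<integral>\<^sup>+y. ennreal \<bar>y - x\<bar> * indicator {y\<in>A. between \<omega> x y < r} y \<partial>lam \<partial>P)
      = (\<integral>\<^sup>+\<omega>. \<integral>\<^sup>+y. ennreal ((c * \<bar>y - x\<bar>) / c) * indicator {y\<in>A. between \<omega> x y < r} y \<partial>lam \<partial>P)"
      using c_pos by simp
    also have "\<dots> \<le> ennreal (1 / c) * (\<integral>\<^sup>+p\<in>{0..1}. ennreal (p / c * binom_lt (card V) r p) \<partial>lborel)"
      using c_pos by (intro nn_integral_between_le[OF x _ _ A, of "\<lambda>p. p / c"]) auto
    also have "(\<integral>\<^sup>+p\<in>{0..1}. ennreal (p / c * binom_lt (card V) r p) \<partial>lborel)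
        = ennreal (1 / c) * (\<integral>\<^sup>+p\<in>{0..1}. ennreal (p * binom_lt (card V) r p) \<partial>lborel)"
    proof (subst nn_integral_cmult[symmetric])
      show "(\<integral>\<^sup>+p\<in>{0..1}. ennreal (p / c * binom_lt (card V) r p) \<partial>lborel) =
        (\<integral>\<^sup>+p. ennreal (1 / c) * (ennreal (p * binom_lt (card V) r p) * indicator {0..1} p) \<partial>lborel)"
        using c_pos by (intro nn_integral_cong)
          (auto simp: indicator_def binom_lt_nonneg simp flip: ennreal_mult)
    qed (auto simp: binom_lt_def)
    also have "ennreal (1 / c) * (ennreal (1 / c) * (\<integral>\<^sup>+p\<in>{0..1}. ennreal (p * binom_lt (card V) r p) \<partial>lborel))
        \<le> ennreal (1 / c) * (ennreal (1 / c) * ennreal ?B)"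
      by (intro mult_left_mono nn_integral_id_binom_lt) auto
    also have "\<dots> = ennreal (?B / c\<^sup>2)"
      using c_pos by (simp add: power2_eq_square mult_ac flip: ennreal_mult')
    finally show ?thesis .
  qed
  interpret L: sigma_finite_measure lam by (rule sigma_finite_leb_on)
  have [measurable]: "(\<lambda>z. between (fst z) x (snd z)) \<in> measurable (P \<Otimes>\<^sub>M lam) (count_space UNIV)"
    using measurable_compose[OF _ between_measurable, of "\<lambda>z. (fst z, x, snd z)" "P \<Otimes>\<^sub>M lam"] x by simp
  have m1: "(\<lambda>(\<omega>, y). ennreal \<bar>y - x\<bar> * indicator {y\<in>A. between \<omega> x y < r} y) \<in> borel_measurable (P \<Otimes>\<^sub>M lam)"
    if [measurable]: "A \<in> sets borel" for A
  proof -
    have "(\<lambda>(\<omega>, y). ennreal \<bar>y - x\<bar> * indicator {y\<in>A. between \<omega> x y < r} y)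
      = (\<lambda>z. ennreal \<bar>snd z - x\<bar> * indicator A (snd z) * (if between (fst z) x (snd z) < r then 1 else 0))"
      by (auto simp: indicator_def fun_eq_iff)
    then show ?thesis by simp
  qed
  have m2: "(\<lambda>y. ennreal \<bar>y - x\<bar> * indicator {y\<in>A. between \<omega> x y < r} y) \<in> borel_measurable lam"
    if "A \<in> sets borel" "\<omega> \<in> space P" for A \<omega>
    using measurable_compose[OF measurable_Pair1'[OF that(2)] m1[OF that(1)]] by simp
  have m3: "(\<lambda>\<omega>. \<integral>\<^sup>+y. ennreal \<bar>y - x\<bar> * indicator {y\<in>A. between \<omega> x y < r} y \<partial>lam) \<in> borel_measurable P"
    if "A \<in> sets borel" for A
    by (rule L.borel_measurable_nn_integral) (rule m1[OF that])
  have "(\<integral>\<^sup>+\<omega>. \<integral>\<^sup>+y. ennreal \<bar>y - x\<bar> * indicator {y. between \<omega> x y < r} y \<partial>lam \<partial>P)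
    \<le> (\<integral>\<^sup>+\<omega>. (\<integral>\<^sup>+y. ennreal \<bar>y - x\<bar> * indicator {y\<in>{x..}. between \<omega> x y < r} y \<partial>lam) +
         (\<integral>\<^sup>+y. ennreal \<bar>y - x\<bar> * indicator {y\<in>{..x}. between \<omega> x y < r} y \<partial>lam) \<partial>P)"
  proof (rule nn_integral_mono)
    fix \<omega> assume w: "\<omega> \<in> space P"
    show "(\<integral>\<^sup>+y. ennreal \<bar>y - x\<bar> * indicator {y. between \<omega> x y < r} y \<partial>lam)
      \<le> (\<integral>\<^sup>+y. ennreal \<bar>y - x\<bar> * indicator {y\<in>{x..}. between \<omega> x y < r} y \<partial>lam) +
         (\<integral>\<^sup>+y. ennreal \<bar>y - x\<bar> * indicator {y\<in>{..x}. between \<omega> x y < r} y \<partial>lam)"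
      using m2[OF _ w, of "{x..}"] m2[OF _ w, of "{..x}"]
      by (subst nn_integral_add[symmetric]) (auto intro!: nn_integral_mono simp: indicator_def)
  qed
  also have "\<dots> = (\<integral>\<^sup>+\<omega>. \<integral>\<^sup>+y. ennreal \<bar>y - x\<bar> * indicator {y\<in>{x..}. between \<omega> x y < r} y \<partial>lam \<partial>P) +
      (\<integral>\<^sup>+\<omega>. \<integral>\<^sup>+y. ennreal \<bar>y - x\<bar> * indicator {y\<in>{..x}. between \<omega> x y < r} y \<partial>lam \<partial>P)"
    by (intro nn_integral_add m3) auto
  also have "\<dots> \<le> ennreal (?B / c\<^sup>2) + ennreal (?B / c\<^sup>2)"
    by (intro add_mono half) auto
  also have "\<dots> = ennreal (?B / c\<^sup>2 + ?B / c\<^sup>2)"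
    by (intro ennreal_plus[symmetric]) auto
  also have "?B / c\<^sup>2 + ?B / c\<^sup>2 = real r * (real r + 1) / ((real (card V) + 1) * (real (card V) + 2) * c\<^sup>2)"
    using c_pos by (simp add: divide_simps)
  finally show ?thesis .
qed

lemma nn_integral_boundary_le:
  shows "(\<integral>\<^sup>+x. emeasure P {\<omega>\<in>space P. card {v\<in>V. T v \<omega> \<le> x} < r} \<partial>lam)
      \<le> ennreal (real r / ((real (card V) + 1) * c))" (is ?left)
    and "(\<integral>\<^sup>+x. emeasure P {\<omega>\<in>space P. card {v\<in>V. x < T v \<omega>} < r} \<partial>lam)
      \<le> ennreal (real r / ((real (card V) + 1) * c))" (is ?right)
proof -
  have B: "ennreal (1 / c) * (\<integral>\<^sup>+p\<in>{0..1}. ennreal (binom_lt (card V) r p) \<partial>lborel)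
      \<le> ennreal (real r / ((real (card V) + 1) * c))"
  proof -
    have "ennreal (1 / c) * (\<integral>\<^sup>+p\<in>{0..1}. ennreal (binom_lt (card V) r p) \<partial>lborel)
        \<le> ennreal (1 / c) * ennreal (real r / (real (card V) + 1))"
      using nn_integral_binom_lt[of "card V" r] by (simp add: mult_left_mono)
    also have "\<dots> = ennreal (real r / ((real (card V) + 1) * c))"
      using c_pos by (subst ennreal_mult'[symmetric]) (auto simp: mult_ac)
    finally show ?thesis .
  qed
  have m: "(\<lambda>p. ennreal (binom_lt (card V) r p)) \<in> borel_measurable borel"
    by (simp add: binom_lt_def)
  have "(\<integral>\<^sup>+x. emeasure P {\<omega>\<in>space P. card {v\<in>V. T v \<omega> \<le> x} < r} \<partial>lam)
      \<le> (\<integral>\<^sup>+x. ennreal (binom_lt (card V) r (c * \<bar>x - a\<bar>)) * indicator {a..} x \<partial>lam)"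
    using emeasure_outside_le(1) by (intro nn_integral_mono) (auto simp: abs_minus_commute)
  also have "\<dots> \<le> ennreal (1 / c) * (\<integral>\<^sup>+p\<in>{0..1}. ennreal (binom_lt (card V) r p) \<partial>lborel)"
    using ab by (intro nn_integral_scaled_distance(1)[OF c_pos c_length_le_1 _ m]) auto
  finally show ?left using B by (rule order_trans)
  have "(\<integral>\<^sup>+x. emeasure P {\<omega>\<in>space P. card {v\<in>V. x < T v \<omega>} < r} \<partial>lam)
      \<le> (\<integral>\<^sup>+x. ennreal (binom_lt (card V) r (c * \<bar>x - b\<bar>)) * indicator {..b} x \<partial>lam)"
    using emeasure_outside_le(2) by (intro nn_integral_mono) (auto simp: abs_minus_commute)
  also have "\<dots> \<le> ennreal (1 / c) * (\<integral>\<^sup>+p\<in>{0..1}. ennreal (binom_lt (card V) r p) \<partial>lborel)"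
    using ab by (intro nn_integral_scaled_distance(2)[OF c_pos c_length_le_1 _ m]) auto
  finally show ?right using B by (rule order_trans)
qed

end

section \<open>Ranks and windows\<close>

lemma finite_visit_set [simp]: "finite (visit_set n m)"
  by (simp add: visit_set_def)

lemma card_visit_set: "card (visit_set n m) = total_visits n m"
  by (simp add: visit_set_def total_visits_def)

lemma set_ranked_visits: "set (ranked_visits n m t) = visit_set n m"
  by (fastforce simp: ranked_visits_def visit_set_def)

lemma distinct_ranked_visits: "distinct (ranked_visits n m t)"
proof -
  have "distinct (concat (map (\<lambda>i. map (Pair i) [1..<m i + 1]) xs))" if "distinct xs" for xs :: "nat list"
    using that by (induction xs) (auto simp: distinct_map inj_on_def)
  then show ?thesis by (simp add: ranked_visits_def)
qed

lemma length_ranked_visits: "length (ranked_visits n m t) = total_visits n m"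
  using distinct_card[OF distinct_ranked_visits, of n m t] by (simp add: set_ranked_visits card_visit_set)

lemma ranked_visits_bij: "bij_betw (\<lambda>l. ranked_visits n m t ! (l - 1)) {1..total_visits n m} (visit_set n m)"
proof -
  have 1: "bij_betw (\<lambda>l. l - 1) {1..total_visits n m} {..<total_visits n m}"
    by (rule bij_betw_byWitness[where f' = Suc]) auto
  have 2: "bij_betw ((!) (ranked_visits n m t)) {..<total_visits n m} (visit_set n m)"
    using distinct_ranked_visits by (rule bij_betw_nth) (simp_all add: length_ranked_visits set_ranked_visits)
  from bij_betw_trans[OF 1 2] show ?thesis by (simp add: o_def)
qed

lemma ranked_visits_in:
  "l \<in> {1..total_visits n m} \<Longrightarrow> ranked_visits n m t ! (l - 1) \<in> visit_set n m"
  using bij_betwE[OF ranked_visits_bij] by blast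

lemma order_stat_eq: "order_stat n m t l = (\<lambda>(i, j). t i j) (ranked_visits n m t ! (l - 1))"
  by (simp add: order_stat_def)

lemma order_stat_mono:
  assumes "1 \<le> l" "l \<le> l'" "l' \<le> total_visits n m"
  shows "order_stat n m t l \<le> order_stat n m t l'"
proof -
  have "sorted (map (\<lambda>(i, j). t i j) (ranked_visits n m t))"
    by (simp add: ranked_visits_def)
  from sorted_nth_mono[OF this, of "l - 1" "l' - 1"] assms show ?thesis
    by (simp add: length_ranked_visits order_stat_eq)
qed

text \<open>The duality between ranks and counts through which windows are described by the counting
  function. It survives ties, since the argument uses only that the order statistics are
  nondecreasing along the ranks.\<close>

lemma order_stat_le_iff:
  assumes "1 \<le> l" "l \<le> total_visits n m"
  shows "order_stat n m t l \<le> y \<longleftrightarrow> l \<le> card {v\<in>visit_set n m. (\<lambda>(i, j). t i j) v \<le> y}"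
proof -
  let ?V = "visit_set n m" and ?f = "\<lambda>(i, j). t i j" and ?M = "total_visits n m"
  let ?r = "\<lambda>l. ranked_visits n m t ! (l - 1)"
  have inj: "inj_on ?r {1..?M}" and im: "?r ` {1..?M} = ?V"
    using ranked_visits_bij[of n m t] by (auto simp: bij_betw_def)
  have card: "card (?r ` A) = card A" if "A \<subseteq> {1..?M}" for A
    using inj_on_subset[OF inj that] by (rule card_image)
  show ?thesis
  proof
    assume y: "order_stat n m t l \<le> y"
    have "?f (?r k) \<le> y" if "k \<in> {1..l}" for k
    proof -
      have "order_stat n m t k \<le> order_stat n m t l"
        using that assms by (intro order_stat_mono) auto
      with y show ?thesis unfolding order_stat_eq by (rule order_trans[rotated])
    qed
    then have "?r ` {1..l} \<subseteq> {v\<in>?V. ?f v \<le> y}"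
    proof (intro image_subsetI CollectI conjI)
      fix k assume "k \<in> {1..l}"
      with assms show "?r k \<in> ?V" by (intro ranked_visits_in) auto
    qed
    then have "card (?r ` {1..l}) \<le> card {v\<in>?V. ?f v \<le> y}" by (intro card_mono) auto
    then show "l \<le> card {v\<in>?V. ?f v \<le> y}" using assms card[of "{1..l}"] by simp
  next
    assume l: "l \<le> card {v\<in>?V. ?f v \<le> y}"
    show "order_stat n m t l \<le> y"
    proof (rule ccontr)
      assume n: "\<not> order_stat n m t l \<le> y"
      have "{v\<in>?V. ?f v \<le> y} \<subseteq> ?r ` {1..<l}"
      proof
        fix v assume v: "v \<in> {v\<in>?V. ?f v \<le> y}"
        then have "v \<in> ?r ` {1..?M}" unfolding im by simp
        then obtain k where k: "k \<in> {1..?M}" "v = ?r k" by blast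
        have "k < l"
        proof (rule ccontr)
          assume "\<not> k < l"
          then have "order_stat n m t l \<le> order_stat n m t k"
            using k assms by (intro order_stat_mono) auto
          with v k n show False by (simp add: order_stat_eq)
        qed
        with k show "v \<in> ?r ` {1..<l}" by auto
      qed
      then have "card {v\<in>?V. ?f v \<le> y} \<le> card (?r ` {1..<l})" by (intro card_mono) auto
      also have "\<dots> = card {1..<l}" using assms by (intro card) auto
      also have "\<dots> < l" using assms by simp
      finally show False using l by simp
    qed
  qed
qed

lemma reflected_inside:
  assumes "1 \<le> l" "l \<le> M"
  shows "reflected M s (int l) = s l"
  using assms by (subst reflected.simps) (auto simp: not_le le_Suc_eq)

lemma reflected_left:
  assumes "1 < M" "l \<le> 0"
  shows "reflected M s l = 2 * s 1 - reflected M s (2 - l)"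
  using assms by (subst reflected.simps) simp

lemma reflected_right:
  assumes "1 < M" "int M < l"
  shows "reflected M s l = 2 * s M - reflected M s (2 * int M - l)"
  using assms by (subst reflected.simps) simp

text \<open>If \<open>l - h\<close> or \<open>l + h\<close> leaves the range of ranks, the
  corresponding inequality between counts is trivial, so the reflected values never have to be
  evaluated. The point must avoid the visits because the window contains its right end while the
  second inequality is strict.\<close>

lemma spacing_window_imp:
  fixes n :: nat and m :: "nat \<Rightarrow> nat" and t :: "nat \<Rightarrow> nat \<Rightarrow> real"
  defines "N \<equiv> \<lambda>x. card {v\<in>visit_set n m. (\<lambda>(i, j). t i j) v \<le> x}"
  defines "h \<equiv> half_width (total_visits n m)"
  assumes l: "1 \<le> l" "l \<le> total_visits n m"
    and x: "x \<in> spacing_window n m t l" "\<And>v. v \<in> visit_set n m \<Longrightarrow> (\<lambda>(i, j). t i j) v \<noteq> x"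
  shows "l \<le> N x + h" "N x < l + h"
proof -
  let ?M = "total_visits n m"
  let ?s = "reflected ?M (order_stat n m t)"
  have h: "1 \<le> h" unfolding h_def by (rule half_width_ge_1)
  have w: "?s (int l - int h) \<le> x" "x \<le> ?s (int l + int h)"
    using x(1) by (auto simp: spacing_window_def Let_def h_def)
  show "l \<le> N x + h"
  proof (cases "h < l")
    case True
    then have "?s (int l - int h) = order_stat n m t (l - h)"
      using l by (subst reflected_inside[symmetric]) (auto simp: of_nat_diff)
    then show ?thesis
      using w order_stat_le_iff[of "l - h" n m t x] l True by (simp add: N_def)
  qed simp
  show "N x < l + h"
  proof (cases "l + h \<le> ?M")
    case True
    then have "x \<le> order_stat n m t (l + h)"
      using w reflected_inside[of "l + h" ?M "order_stat n m t"] l by simp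
    moreover have "order_stat n m t (l + h) \<noteq> x"
      using x(2)[OF ranked_visits_in[of "l + h" n m t]] True l by (simp add: order_stat_eq)
    ultimately show ?thesis
      using order_stat_le_iff[of "l + h" n m t x] l True by (simp add: N_def)
  next
    case False
    have "N x \<le> ?M"
      unfolding N_def card_visit_set[symmetric] by (intro card_mono) auto
    with False show ?thesis by simp
  qed
qed

text \<open>A window that reaches past the first rank returns into the range after a single
  reflection, and the mirrored value lies at or below the first order statistic, hence below
  \<open>x\<close>; the right end is symmetric.\<close>

lemma spacing_windowI:
  fixes n :: nat and m :: "nat \<Rightarrow> nat" and t :: "nat \<Rightarrow> nat \<Rightarrow> real"
  defines "N \<equiv> \<lambda>x. card {v\<in>visit_set n m. (\<lambda>(i, j). t i j) v \<le> x}"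
  defines "h \<equiv> half_width (total_visits n m)"
  assumes x: "h \<le> N x" "N x + h \<le> total_visits n m" and l: "l \<le> N x + h" "N x < l + h"
  shows "x \<in> spacing_window n m t l"
proof -
  let ?M = "total_visits n m"
  let ?o = "order_stat n m t"
  let ?s = "reflected ?M ?o"
  have h: "1 \<le> h" unfolding h_def by (rule half_width_ge_1)
  have le: "?o k \<le> x \<longleftrightarrow> k \<le> N x" if "1 \<le> k" "k \<le> ?M" for k
    using order_stat_le_iff[OF that] by (simp add: N_def)
  have "?s (int l - int h) \<le> x"
  proof (cases "h < l")
    case True
    then have "?s (int l - int h) = ?o (l - h)"
      using l x by (subst reflected_inside[symmetric]) (auto simp: of_nat_diff)
    then show ?thesis using le[of "l - h"] l x True by simp
  next
    case False
    have e: "2 - (int l - int h) = int (2 + h - l)" using False by simp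
    have "?s (int l - int h) = 2 * ?o 1 - ?s (int (2 + h - l))"
      using reflected_left[of ?M "int l - int h" ?o] False h x unfolding e by simp
    \<comment> \<open>The mirrored rank is at most \<open>h + 1\<close>, and the two hypotheses on
      \<open>x\<close> give \<open>2 * h \<le> M\<close>.\<close>
    also have "?s (int (2 + h - l)) = ?o (2 + h - l)"
      using False h x l by (intro reflected_inside) auto
    also have "2 * ?o 1 - ?o (2 + h - l) \<le> ?o 1"
      using order_stat_mono[of 1 "2 + h - l" n m t] False h x l by simp
    also have "?o 1 \<le> x" using le[of 1] h x by simp
    finally show ?thesis .
  qed
  moreover have "x \<le> ?s (int l + int h)"
  proof (cases "l + h \<le> ?M")
    case True
    have "?s (int (l + h)) = ?o (l + h)" using True h by (intro reflected_inside) auto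
    then show ?thesis using le[of "l + h"] l True h by simp
  next
    case False
    have e: "2 * int ?M - (int l + int h) = int (2 * ?M - (l + h))" using l x by simp
    have "?o ?M \<le> 2 * ?o ?M - ?o (2 * ?M - (l + h))"
      using order_stat_mono[of "2 * ?M - (l + h)" ?M n m t] False h x l by simp
    also have "?o (2 * ?M - (l + h)) = ?s (int (2 * ?M - (l + h)))"
      using False h x l by (intro reflected_inside[symmetric]) auto
    also have "2 * ?o ?M - ?s (int (2 * ?M - (l + h))) = ?s (int l + int h)"
      using reflected_right[of ?M "int l + int h" ?o] False h x unfolding e by simp
    finally have "?o ?M \<le> ?s (int l + int h)" .
    moreover have "x \<le> ?o ?M" using le[of ?M] h x by simp
    ultimately show ?thesis by simp
  qed
  ultimately show ?thesis by (simp add: spacing_window_def Let_def h_def)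
qed

section \<open>Measurability of ranks, order statistics and reflected values\<close>

lemma measurable_ranked_visits:
  fixes T :: "nat \<Rightarrow> nat \<Rightarrow> 'w \<Rightarrow> real"
  assumes "\<And>i j. (i, j) \<in> visit_set n m \<Longrightarrow> T i j \<in> borel_measurable M"
  shows "(\<lambda>\<omega>. ranked_visits n m (\<lambda>i j. T i j \<omega>)) \<in> measurable M (count_space UNIV)"
proof -
  define f where "f \<omega> v = (\<lambda>(i, j). T i j \<omega>) v" for \<omega> v
  \<comment> \<open>Insertion sort branches only on comparisons of two visit times. The lists it
    passes through range over a countable set, so each step is measurable for the discrete
    sigma-algebra.\<close>
  have ins: "(\<lambda>\<omega>. insort_key (f \<omega>) v L) \<in> measurable M (count_space UNIV)"
    if "v \<in> visit_set n m" "set L \<subseteq> visit_set n m" for v L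
    using that(2)
  proof (induction L)
    case (Cons w L)
    have f: "(\<lambda>\<omega>. f \<omega> v) \<in> borel_measurable M" "(\<lambda>\<omega>. f \<omega> w) \<in> borel_measurable M"
      using assms that Cons by (auto simp: f_def split: prod.splits)
    have w: "(\<lambda>\<omega>. w # insort_key (f \<omega>) v L) \<in> measurable M (count_space UNIV)"
      by (rule measurable_compose[OF Cons.IH measurable_count_space]) (use Cons.prems in auto)
    show ?case
      unfolding insort_key.simps
      by (rule measurable_If[OF _ w]) (simp_all add: borel_measurable_le f)
  qed simp
  have "(\<lambda>\<omega>. sort_key (f \<omega>) xs) \<in> measurable M (count_space UNIV)" if "set xs \<subseteq> visit_set n m" for xs
    using that
  proof (induction xs)
    case (Cons v xs)
    have "(\<lambda>\<omega>. insort_key (f \<omega>) v (sort_key (f \<omega>) xs)) \<in> measurable M (count_space UNIV)"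
    proof (rule measurable_compose_countable'[where I = "{L. set L \<subseteq> visit_set n m}"
          and f = "\<lambda>L \<omega>. insort_key (f \<omega>) v L" and g = "\<lambda>\<omega>. sort_key (f \<omega>) xs"])
      show "(\<lambda>\<omega>. sort_key (f \<omega>) xs) \<in> measurable M (count_space {L. set L \<subseteq> visit_set n m})"
        by (rule measurable_count_space_extend[of _ UNIV]) (use Cons in auto)
      show "countable {L. set L \<subseteq> visit_set n m}"
        by (rule countableI_type)
      fix L assume "L \<in> {L. set L \<subseteq> visit_set n m}"
      then show "(\<lambda>\<omega>. insort_key (f \<omega>) v L) \<in> measurable M (count_space UNIV)"
        using Cons by (intro ins) auto
    qed
    then show ?case by simp
  qed simp
  moreover have "set (concat (map (\<lambda>i. map (Pair i) [1..<m i + 1]) [1..<n + 1])) \<subseteq> visit_set n m"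
    by (auto simp: visit_set_def)
  ultimately show ?thesis unfolding ranked_visits_def f_def by blast
qed

lemma measurable_order_stat:
  fixes T :: "nat \<Rightarrow> nat \<Rightarrow> 'w \<Rightarrow> real"
  assumes T: "\<And>i j. (i, j) \<in> visit_set n m \<Longrightarrow> T i j \<in> borel_measurable M"
    and l: "l \<in> {1..total_visits n m}"
  shows "(\<lambda>\<omega>. order_stat n m (\<lambda>i j. T i j \<omega>) l) \<in> borel_measurable M"
proof -
  \<comment> \<open>Indices that are not visits receive the value 0, because the composition below
    asks for measurability at every index.\<close>
  define T' where "T' v \<omega> = (if v \<in> visit_set n m then (\<lambda>(i, j). T i j \<omega>) v else 0)" for v \<omega>
  have "T' v \<in> borel_measurable M" for v
    using T by (cases v; cases "v \<in> visit_set n m") (auto simp: T'_def[abs_def])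
  then have "(\<lambda>\<omega>. T' (ranked_visits n m (\<lambda>i j. T i j \<omega>) ! (l - 1)) \<omega>) \<in> borel_measurable M"
    by (rule measurable_compose_countable)
      (rule measurable_compose[OF measurable_ranked_visits[OF T] measurable_count_space])
  moreover have "T' (ranked_visits n m (\<lambda>i j. T i j \<omega>) ! (l - 1)) \<omega> = order_stat n m (\<lambda>i j. T i j \<omega>) l" for \<omega>
    using ranked_visits_in[OF l] by (simp add: T'_def order_stat_eq)
  ultimately show ?thesis by simp
qed

lemma measurable_reflected:
  assumes s: "\<And>l. l \<in> {1..M} \<Longrightarrow> (\<lambda>\<omega>. s \<omega> l) \<in> borel_measurable N" and M: "1 \<le> M"
  shows "(\<lambda>\<omega>. reflected M (s \<omega>) l) \<in> borel_measurable N"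
\<comment> \<open>The induction follows the termination measure of \<open>reflected\<close>, the
  distance of \<open>l\<close> from the middle of the range.\<close>
proof (induction "nat \<bar>2 * l - (int M + 1)\<bar>" arbitrary: l rule: less_induct)
  case less
  consider "M = 1" | "1 < M" "l \<le> 0" | "1 < M" "l > int M" | "1 < M" "0 < l" "l \<le> int M"
    using M by linarith
  then show ?case
  proof cases
    case 1
    then have "reflected M (s \<omega>) l = s \<omega> 1" for \<omega> by (subst reflected.simps) simp
    then show ?thesis using s[of 1] M by simp
  next
    case 2
    then have "(\<lambda>\<omega>. reflected M (s \<omega>) (2 - l)) \<in> borel_measurable N" by (intro less) auto
    then show ?thesis using 2 s[of 1] by (simp add: reflected_left)
  next
    case 3
    then have "(\<lambda>\<omega>. reflected M (s \<omega>) (2 * int M - l)) \<in> borel_measurable N" by (intro less) auto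
    then show ?thesis using 3 s[of M] by (simp add: reflected_right)
  next
    case 4
    then have "nat l \<in> {1..M}" by auto
    moreover from 4 have "reflected M (s \<omega>) l = s \<omega> (nat l)" for \<omega>
      using reflected_inside[of "nat l" M] by simp
    ultimately show ?thesis using s by simp
  qed
qed

section \<open>Expected squared weights\<close>

locale ranked_times = visit_times P a b c g "visit_set n m" "\<lambda>(i, j). T i j"
  for P :: "'w measure" and a b c g n m and T :: "nat \<Rightarrow> nat \<Rightarrow> 'w \<Rightarrow> real"
begin

abbreviation "M \<equiv> total_visits n m"
abbreviation "h \<equiv> half_width M"

definition times :: "'w \<Rightarrow> nat \<Rightarrow> nat \<Rightarrow> real" where
  "times \<omega> i j = T i j \<omega>"

definition N :: "'w \<Rightarrow> real \<Rightarrow> nat" where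
  "N \<omega> x = card {v\<in>visit_set n m. (\<lambda>(i, j). times \<omega> i j) v \<le> x}"

text \<open>The set that replaces the window of rank \<open>l\<close>. Both conditions are stated
  with sums because differences of natural numbers would truncate at 0.\<close>

definition near :: "'w \<Rightarrow> nat \<Rightarrow> real set" where
  "near \<omega> l = {y\<in>{a..b}. l \<le> N \<omega> y + h \<and> N \<omega> y < l + h}"

lemma h_ge_1: "1 \<le> h" by (rule half_width_ge_1)

lemma M_eq: "card (visit_set n m) = M" by (rule card_visit_set)

lemma times_eq: "(\<lambda>(i, j). times \<omega> i j) v = (\<lambda>(i, j). T i j) v \<omega>"
  by (cases v) (simp add: times_def)

lemma times_in: "v \<in> visit_set n m \<Longrightarrow> \<omega> \<in> space P \<Longrightarrow> (\<lambda>(i, j). times \<omega> i j) v \<in> {a..b}"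
  unfolding times_eq by (rule T_in)

lemma N_le_M: "N \<omega> x \<le> M"
  unfolding N_def M_eq[symmetric] by (intro card_mono) auto

lemma N_mono: "x \<le> y \<Longrightarrow> N \<omega> x \<le> N \<omega> y"
  unfolding N_def by (intro card_mono) auto

lemma between_eq: "x \<le> y \<Longrightarrow> between \<omega> x y = N \<omega> y - N \<omega> x"
proof -
  assume xy: "x \<le> y"
  have "{v\<in>visit_set n m. min x y < (\<lambda>(i, j). T i j) v \<omega> \<and> (\<lambda>(i, j). T i j) v \<omega> \<le> max x y}
      = {v\<in>visit_set n m. (\<lambda>(i, j). times \<omega> i j) v \<le> y} - {v\<in>visit_set n m. (\<lambda>(i, j). times \<omega> i j) v \<le> x}"
    unfolding times_eq using xy by auto
  then show ?thesis
    unfolding between_def N_def using xy by (simp add: card_Diff_subset Collect_mono_iff)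
qed

lemma between_commute: "between \<omega> x y = between \<omega> y x"
  by (simp add: between_def min.commute max.commute)

lemma AE_no_visit: "AE x in lam. \<forall>v\<in>visit_set n m. (\<lambda>(i, j). times \<omega> i j) v \<noteq> x"
proof -
  have "AE x in lborel. \<forall>v\<in>visit_set n m. (\<lambda>(i, j). times \<omega> i j) v \<noteq> x"
    by (intro AE_finite_allI finite_visit_set) (rule AE_I[where N = "{(\<lambda>(i, j). times \<omega> i j) v}" for v], auto)
  then show ?thesis
    unfolding leb_on_def by (subst AE_restrict_space_iff) auto
qed

lemma window_subset_near:
  assumes "x \<in> {a..b}" "\<forall>v\<in>visit_set n m. (\<lambda>(i, j). times \<omega> i j) v \<noteq> x" "l \<in> {1..M}"
    "x \<in> spacing_window n m (times \<omega>) l"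
  shows "x \<in> near \<omega> l"
  using spacing_window_imp[of l n m x "times \<omega>"] assms by (auto simp: near_def N_def)

lemma near_subset_window:
  assumes "x \<in> near \<omega> l" "h \<le> N \<omega> x" "N \<omega> x + h \<le> M"
  shows "x \<in> spacing_window n m (times \<omega>) l"
  using assms by (intro spacing_windowI) (auto simp: near_def N_def)

lemma N_measurable [measurable]: "N \<omega> \<in> measurable lam (count_space UNIV)"
  unfolding N_def
proof (intro measurable_card_finite finite_visit_set)
  fix v
  show "{x \<in> space lam. (\<lambda>(i, j). times \<omega> i j) v \<le> x} \<in> sets lam" by measurable
qed

lemma near_sets [measurable]: "near \<omega> l \<in> sets lam"
proof -
  have "{y \<in> space lam. l \<le> N \<omega> y + h \<and> N \<omega> y < l + h} \<in> sets lam" by measurable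
  then show ?thesis by (simp add: near_def)
qed

lemma window_sets [measurable]: "spacing_window n m t l \<in> sets borel"
  by (simp add: spacing_window_def Let_def)

text \<open>Cauchy-Schwarz separates the basis function from the length of the window. Keeping the
  indicator in both factors localizes the square of the basis function, so that the sum over the
  ranks becomes, at each point, a sum of lengths of the windows around it.\<close>

lemma weight_sq_le:
  assumes \<phi>: "\<phi> k \<in> borel_measurable lam" and l: "l \<in> {1..M}"
  shows "ennreal ((spacing_weight a b \<phi> n m (times \<omega>) k l)\<^sup>2)
    \<le> ennreal (1 / (2 * real h)\<^sup>2) *
      ((\<integral>\<^sup>+x. ennreal ((\<phi> k x)\<^sup>2) * indicator (near \<omega> l) x \<partial>lam) * (\<integral>\<^sup>+x. indicator (near \<omega> l) x \<partial>lam))"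
proof -
  note [measurable] = \<phi>
  let ?W = "spacing_window n m (times \<omega>) l"
  let ?I = "LINT x|lam. \<phi> k x * indicator ?W x"
  have "ennreal \<bar>?I\<bar> \<le> (\<integral>\<^sup>+x. ennreal \<bar>\<phi> k x * indicator ?W x\<bar> \<partial>lam)"
  proof (cases "integrable lam (\<lambda>x. \<phi> k x * indicator ?W x)")
    case True
    from integral_norm_bound_ennreal[OF this] show ?thesis by simp
  next
    case False
    \<comment> \<open>The Bochner integral of a function that is not integrable is 0.\<close>
    then show ?thesis by (simp add: not_integrable_integral_eq)
  qed
  also have "\<dots> \<le> (\<integral>\<^sup>+x. (ennreal \<bar>\<phi> k x\<bar> * indicator (near \<omega> l) x) * indicator (near \<omega> l) x \<partial>lam)"
  proof (rule nn_integral_mono_AE)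
    show "AE x in lam. ennreal \<bar>\<phi> k x * indicator ?W x\<bar> \<le> (ennreal \<bar>\<phi> k x\<bar> * indicator (near \<omega> l) x) * indicator (near \<omega> l) x"
      using AE_no_visit[of \<omega>] AE_space
    proof eventually_elim
      case (elim x)
      then show ?case using window_subset_near[of x \<omega> l] l by (auto simp: indicator_def)
    qed
  qed
  finally have "(ennreal \<bar>?I\<bar>)\<^sup>2 \<le> (\<integral>\<^sup>+x. (ennreal \<bar>\<phi> k x\<bar> * indicator (near \<omega> l) x) * indicator (near \<omega> l) x \<partial>lam)\<^sup>2"
    by (intro power_mono) auto
  also have "\<dots> \<le> (\<integral>\<^sup>+x. (ennreal \<bar>\<phi> k x\<bar> * indicator (near \<omega> l) x)\<^sup>2 \<partial>lam) * (\<integral>\<^sup>+x. (indicator (near \<omega> l) x)\<^sup>2 \<partial>lam)"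
    by (rule Cauchy_Schwarz_nn_integral) auto
  also have "(\<lambda>x. (ennreal \<bar>\<phi> k x\<bar> * indicator (near \<omega> l) x)\<^sup>2) = (\<lambda>x. ennreal ((\<phi> k x)\<^sup>2) * indicator (near \<omega> l) x)"
    by (auto simp: fun_eq_iff indicator_def ennreal_power)
  also have "(\<lambda>x. (indicator (near \<omega> l) x :: ennreal)\<^sup>2) = indicator (near \<omega> l)"
    by (auto simp: fun_eq_iff indicator_def)
  finally have "ennreal (?I\<^sup>2) \<le> (\<integral>\<^sup>+x. ennreal ((\<phi> k x)\<^sup>2) * indicator (near \<omega> l) x \<partial>lam) *
      (\<integral>\<^sup>+x. indicator (near \<omega> l) x \<partial>lam)"
    by (simp add: ennreal_power)
  then have "ennreal (1 / (2 * real h)\<^sup>2) * ennreal (?I\<^sup>2) \<le> ennreal (1 / (2 * real h)\<^sup>2) *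
      ((\<integral>\<^sup>+x. ennreal ((\<phi> k x)\<^sup>2) * indicator (near \<omega> l) x \<partial>lam) * (\<integral>\<^sup>+x. indicator (near \<omega> l) x \<partial>lam))"
    by (rule mult_left_mono) simp
  moreover have "(spacing_weight a b \<phi> n m (times \<omega>) k l)\<^sup>2 = 1 / (2 * real h)\<^sup>2 * ?I\<^sup>2"
    by (simp add: spacing_weight_def power_mult_distrib power_divide)
  moreover have "ennreal (1 / (2 * real h)\<^sup>2 * ?I\<^sup>2) = ennreal (1 / (2 * real h)\<^sup>2) * ennreal (?I\<^sup>2)"
    by (rule ennreal_mult') simp
  ultimately show ?thesis by metis
qed

text \<open>The distance from \<open>x\<close> to the \<open>r\<close>-th visit after it, cut off at
  \<open>b\<close>. The product of two conditionals is the shape for which joint measurability is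
  proved below.\<close>

definition rgap :: "'w \<Rightarrow> real \<Rightarrow> nat \<Rightarrow> ennreal" where
  "rgap \<omega> x r = (\<integral>\<^sup>+y. (if x \<le> y then 1 else 0) * (if between \<omega> x y < r then 1 else 0) \<partial>lam)"

definition lgap :: "'w \<Rightarrow> real \<Rightarrow> nat \<Rightarrow> ennreal" where
  "lgap \<omega> x r = (\<integral>\<^sup>+y. (if y \<le> x then 1 else 0) * (if between \<omega> x y < r then 1 else 0) \<partial>lam)"

definition reach :: "'w \<Rightarrow> real \<Rightarrow> ennreal" where
  "reach \<omega> x = (\<Sum>r=1..2 * h. rgap \<omega> x r + lgap \<omega> x (2 * h + 1 - r))"

lemma nn_integral_gap_le:
  assumes x: "x \<in> {a..b}"
  shows "(\<integral>\<^sup>+\<omega>. rgap \<omega> x r \<partial>P) \<le> ennreal (real r / ((real M + 1) * c))"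
    and "(\<integral>\<^sup>+\<omega>. lgap \<omega> x r \<partial>P) \<le> ennreal (real r / ((real M + 1) * c))"
proof -
  have "rgap \<omega> x r = (\<integral>\<^sup>+y. indicator {y\<in>{x..}. between \<omega> x y < r} y \<partial>lam)" for \<omega>
    unfolding rgap_def by (intro nn_integral_cong) (simp add: indicator_def)
  then show "(\<integral>\<^sup>+\<omega>. rgap \<omega> x r \<partial>P) \<le> ennreal (real r / ((real M + 1) * c))"
    using nn_integral_spacing_le[OF x, of "{x..}" r] by (simp add: M_eq)
  have "lgap \<omega> x r = (\<integral>\<^sup>+y. indicator {y\<in>{..x}. between \<omega> x y < r} y \<partial>lam)" for \<omega>
    unfolding lgap_def by (intro nn_integral_cong) (simp add: indicator_def)
  then show "(\<integral>\<^sup>+\<omega>. lgap \<omega> x r \<partial>P) \<le> ennreal (real r / ((real M + 1) * c))"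
    using nn_integral_spacing_le[OF x, of "{..x}" r] by (simp add: M_eq)
qed

lemma between_measurable_x:
  assumes "\<omega> \<in> space P" "x \<in> {a..b}"
  shows "(\<lambda>y. between \<omega> x y) \<in> measurable lam (count_space UNIV)"
proof -
  have "(\<lambda>y. (\<omega>, x, y)) \<in> measurable lam (P \<Otimes>\<^sub>M (lam \<Otimes>\<^sub>M lam))"
    using assms by (intro measurable_Pair measurable_const measurable_ident) (simp_all add: space_pair_measure)
  from measurable_compose[OF this between_measurable] show ?thesis by simp
qed

text \<open>The offset r = l + h - N x numbers the windows around \<open>x\<close> injectively by 1,
  ..., 2h. Offsets whose rank falls outside the sample can only enlarge the sum.\<close>

lemma sum_near_le_reach:
  assumes w: "\<omega> \<in> space P" and x: "x \<in> {a..b}"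
  shows "(\<Sum>l=1..M. indicator (near \<omega> l) x * (\<integral>\<^sup>+y. indicator (near \<omega> l) y \<partial>lam)) \<le> reach \<omega> x"
proof -
  note [measurable] = between_measurable_x[OF w x]
  define G where "G r = rgap \<omega> x r + lgap \<omega> x (2 * h + 1 - r)" for r
  define A where "A = {l\<in>{1..M}. x \<in> near \<omega> l}"
  have near_le: "(\<integral>\<^sup>+y. indicator (near \<omega> l) y \<partial>lam) \<le> G (l + h - N \<omega> x)" if "l \<in> A" for l
  proof -
    have l: "l \<le> N \<omega> x + h" "N \<omega> x < l + h" using that by (auto simp: A_def near_def)
    have "(\<integral>\<^sup>+y. indicator (near \<omega> l) y \<partial>lam) \<le>
        (\<integral>\<^sup>+y. (if x \<le> y then 1 else 0) * (if between \<omega> x y < l + h - N \<omega> x then 1 else 0) +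
          (if y \<le> x then 1 else 0) * (if between \<omega> x y < 2 * h + 1 - (l + h - N \<omega> x) then 1 else 0) \<partial>lam)"
    proof (rule nn_integral_mono)
      fix y
      have "between \<omega> x y < l + h - N \<omega> x" if "y \<in> near \<omega> l" "x \<le> y"
        using that l N_mono[of x y \<omega>] by (auto simp: between_eq near_def)
      \<comment> \<open>To the left, l \<le> N y + h yields N x - N y \<le> 2h - r, which explains
        the extra 1 in the strict inequality.\<close>
      moreover have "between \<omega> x y < 2 * h + 1 - (l + h - N \<omega> x)" if "y \<in> near \<omega> l" "y \<le> x"
        using that l N_mono[of y x \<omega>] by (auto simp: between_eq near_def between_commute[of _ x])
      ultimately show "indicator (near \<omega> l) y \<le>
          (if x \<le> y then 1 else 0) * (if between \<omega> x y < l + h - N \<omega> x then 1 else (0::ennreal)) +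
          (if y \<le> x then 1 else 0) * (if between \<omega> x y < 2 * h + 1 - (l + h - N \<omega> x) then 1 else 0)"
        using linear[of x y] by (auto simp: indicator_def)
    qed
    also have "\<dots> = G (l + h - N \<omega> x)"
      unfolding G_def rgap_def lgap_def by (intro nn_integral_add) auto
    finally show ?thesis .
  qed
  have "(\<Sum>l=1..M. indicator (near \<omega> l) x * (\<integral>\<^sup>+y. indicator (near \<omega> l) y \<partial>lam))
      = (\<Sum>l\<in>A. \<integral>\<^sup>+y. indicator (near \<omega> l) y \<partial>lam)"
    unfolding A_def by (intro sum.mono_neutral_cong_right) (auto simp: indicator_def)
  also have "\<dots> \<le> (\<Sum>l\<in>A. G (l + h - N \<omega> x))"
    by (intro sum_mono near_le)
  also have "\<dots> = (\<Sum>r\<in>(\<lambda>l. l + h - N \<omega> x) ` A. G r)"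
  proof (rule sum.reindex_cong[symmetric, where l = "\<lambda>l. l + h - N \<omega> x"])
    show "inj_on (\<lambda>l. l + h - N \<omega> x) A"
      by (auto simp: inj_on_def A_def near_def)
  qed auto
  also have "\<dots> \<le> (\<Sum>r=1..2 * h. G r)"
    by (intro sum_mono2) (auto simp: A_def near_def)
  finally show ?thesis by (simp add: reach_def G_def)
qed

lemma between_measurable3:
  "(\<lambda>z. between (fst (fst z)) (snd (fst z)) (snd z)) \<in> measurable ((P \<Otimes>\<^sub>M lam) \<Otimes>\<^sub>M lam) (count_space UNIV)"
  using measurable_compose[OF _ between_measurable,
      of "\<lambda>z. (fst (fst z), snd (fst z), snd z)" "(P \<Otimes>\<^sub>M lam) \<Otimes>\<^sub>M lam"]
  by simp

lemma borel_measurable_if_leb_on: "(\<lambda>z. f z) \<in> measurable K lam \<Longrightarrow> f \<in> borel_measurable K"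
  by (rule measurable_compose[OF _ id_measurable_leb_on])

lemma measurable_nn_integral_between:
  fixes k :: "real \<Rightarrow> real \<Rightarrow> ennreal"
  assumes k: "(\<lambda>(x, y). k x y) \<in> borel_measurable (lam \<Otimes>\<^sub>M lam)"
  shows "(\<lambda>(\<omega>, x). \<integral>\<^sup>+y. k x y * (if between \<omega> x y < r then 1 else 0) \<partial>lam) \<in> borel_measurable (P \<Otimes>\<^sub>M lam)"
proof -
  interpret L: sigma_finite_measure lam by (rule sigma_finite_leb_on)
  note [measurable] = between_measurable3
  have [measurable]: "(\<lambda>z. k (snd (fst z)) (snd z)) \<in> borel_measurable ((P \<Otimes>\<^sub>M lam) \<Otimes>\<^sub>M lam)"
    using measurable_compose[OF _ k, of "\<lambda>z. (snd (fst z), snd z)" "(P \<Otimes>\<^sub>M lam) \<Otimes>\<^sub>M lam"] by simp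
  have "(\<lambda>(p, y). k (snd p) y * (if between (fst p) (snd p) y < r then 1 else 0))
      \<in> borel_measurable ((P \<Otimes>\<^sub>M lam) \<Otimes>\<^sub>M lam)"
    by (simp add: case_prod_beta)
  from L.borel_measurable_nn_integral[OF this] show ?thesis by (simp add: case_prod_beta)
qed

lemma gap_measurable:
  shows "(\<lambda>(\<omega>, x). rgap \<omega> x r) \<in> borel_measurable (P \<Otimes>\<^sub>M lam)"
    and "(\<lambda>(\<omega>, x). lgap \<omega> x r) \<in> borel_measurable (P \<Otimes>\<^sub>M lam)"
proof -
  have [measurable]: "(\<lambda>p. fst p) \<in> borel_measurable (lam \<Otimes>\<^sub>M lam)" "(\<lambda>p. snd p) \<in> borel_measurable (lam \<Otimes>\<^sub>M lam)"
    by (auto intro: borel_measurable_if_leb_on)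
  show "(\<lambda>(\<omega>, x). rgap \<omega> x r) \<in> borel_measurable (P \<Otimes>\<^sub>M lam)"
    unfolding rgap_def by (intro measurable_nn_integral_between) (simp add: case_prod_beta)
  show "(\<lambda>(\<omega>, x). lgap \<omega> x r) \<in> borel_measurable (P \<Otimes>\<^sub>M lam)"
    unfolding lgap_def by (intro measurable_nn_integral_between) (simp add: case_prod_beta)
qed

lemma reach_measurable: "(\<lambda>(\<omega>, x). reach \<omega> x) \<in> borel_measurable (P \<Otimes>\<^sub>M lam)"
  using gap_measurable unfolding reach_def case_prod_beta
  by (intro borel_measurable_sum borel_measurable_add) simp_all

lemma nn_integral_reach_le:
  assumes x: "x \<in> {a..b}"
  shows "(\<integral>\<^sup>+\<omega>. reach \<omega> x \<partial>P) \<le> ennreal (2 * real h * (2 * real h + 1) / ((real M + 1) * c))"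
proof -
  have m: "(\<lambda>\<omega>. rgap \<omega> x r) \<in> borel_measurable P" "(\<lambda>\<omega>. lgap \<omega> x r) \<in> borel_measurable P" for r
    using measurable_compose[OF _ gap_measurable(1), of "\<lambda>\<omega>. (\<omega>, x)" P]
      measurable_compose[OF _ gap_measurable(2), of "\<lambda>\<omega>. (\<omega>, x)" P] x by simp_all
  have "(\<integral>\<^sup>+\<omega>. reach \<omega> x \<partial>P) = (\<Sum>r=1..2 * h. (\<integral>\<^sup>+\<omega>. rgap \<omega> x r \<partial>P) + (\<integral>\<^sup>+\<omega>. lgap \<omega> x (2 * h + 1 - r) \<partial>P))"
    unfolding reach_def
    by (subst nn_integral_sum) (auto intro!: sum.cong nn_integral_add borel_measurable_add m)
  also have "\<dots> \<le> (\<Sum>r=1..2 * h. ennreal (real r / ((real M + 1) * c)) + ennreal (real (2 * h + 1 - r) / ((real M + 1) * c)))"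
    by (intro sum_mono add_mono nn_integral_gap_le x)
  also have "\<dots> = (\<Sum>r=1..2 * h. ennreal ((2 * real h + 1) / ((real M + 1) * c)))"
  proof (rule sum.cong[OF refl])
    fix r assume "r \<in> {1..2 * h}"
    then have "real r + real (2 * h + 1 - r) = 2 * real h + 1" by (simp add: of_nat_diff)
    then show "ennreal (real r / ((real M + 1) * c)) + ennreal (real (2 * h + 1 - r) / ((real M + 1) * c))
        = ennreal ((2 * real h + 1) / ((real M + 1) * c))"
      using c_pos by (simp flip: ennreal_plus add_divide_distrib)
  qed
  also have "\<dots> = ennreal (2 * real h * (2 * real h + 1) / ((real M + 1) * c))"
    using c_pos by (simp add: ennreal_of_nat_eq_real_of_nat flip: ennreal_mult')
  finally show ?thesis .
qed

text \<open>The bound for the expected reach is uniform in \<open>x\<close>, so after exchanging the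
  integrals the squared basis function contributes only its norm. Then 1 / (2h)^2 times 2h (2h + 1)
  / ((M + 1) c) is \<open>S_sp M / c\<close>.\<close>

lemma expected_weights_le:
  assumes \<phi>: "\<phi> k \<in> borel_measurable lam" "(\<integral>\<^sup>+x. ennreal ((\<phi> k x)\<^sup>2) \<partial>lam) \<le> 1"
  shows "(\<integral>\<^sup>+\<omega>. (\<Sum>l=1..M. ennreal ((spacing_weight a b \<phi> n m (times \<omega>) k l)\<^sup>2)) \<partial>P) \<le> ennreal (S_sp M / c)"
proof -
  interpret L: sigma_finite_measure lam by (rule sigma_finite_leb_on)
  interpret PL: pair_sigma_finite P lam ..
  note [measurable] = \<phi>(1) reach_measurable
  let ?q = "ennreal (1 / (2 * real h)\<^sup>2)" and ?R = "2 * real h * (2 * real h + 1) / ((real M + 1) * c)"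
  have "(\<integral>\<^sup>+\<omega>. (\<Sum>l=1..M. ennreal ((spacing_weight a b \<phi> n m (times \<omega>) k l)\<^sup>2)) \<partial>P)
      \<le> (\<integral>\<^sup>+\<omega>. (\<integral>\<^sup>+x. ?q * (ennreal ((\<phi> k x)\<^sup>2) * reach \<omega> x) \<partial>lam) \<partial>P)"
  proof (rule nn_integral_mono)
    fix \<omega> assume w: "\<omega> \<in> space P"
    define e where "e l = (\<integral>\<^sup>+x. indicator (near \<omega> l) x \<partial>lam)" for l
    have "(\<Sum>l=1..M. ennreal ((spacing_weight a b \<phi> n m (times \<omega>) k l)\<^sup>2))
        \<le> (\<Sum>l=1..M. ?q * ((\<integral>\<^sup>+x. ennreal ((\<phi> k x)\<^sup>2) * indicator (near \<omega> l) x \<partial>lam) * e l))"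
      unfolding e_def using \<phi> by (intro sum_mono weight_sq_le) auto
    also have "\<dots> = (\<Sum>l=1..M. \<integral>\<^sup>+x. ?q * (ennreal ((\<phi> k x)\<^sup>2) * (indicator (near \<omega> l) x * e l)) \<partial>lam)"
    proof (rule sum.cong[OF refl])
      fix l
      have "(\<integral>\<^sup>+x. ?q * (ennreal ((\<phi> k x)\<^sup>2) * (indicator (near \<omega> l) x * e l)) \<partial>lam)
          = ?q * (\<integral>\<^sup>+x. ennreal ((\<phi> k x)\<^sup>2) * indicator (near \<omega> l) x * e l \<partial>lam)"
        by (subst nn_integral_cmult) (simp_all add: mult.assoc)
      also have "\<dots> = ?q * ((\<integral>\<^sup>+x. ennreal ((\<phi> k x)\<^sup>2) * indicator (near \<omega> l) x \<partial>lam) * e l)"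
        by (subst nn_integral_multc) simp_all
      finally show "?q * ((\<integral>\<^sup>+x. ennreal ((\<phi> k x)\<^sup>2) * indicator (near \<omega> l) x \<partial>lam) * e l) =
          (\<integral>\<^sup>+x. ?q * (ennreal ((\<phi> k x)\<^sup>2) * (indicator (near \<omega> l) x * e l)) \<partial>lam)" by simp
    qed
    also have "\<dots> = (\<integral>\<^sup>+x. (\<Sum>l=1..M. ?q * (ennreal ((\<phi> k x)\<^sup>2) * (indicator (near \<omega> l) x * e l))) \<partial>lam)"
      by (intro nn_integral_sum[symmetric]) auto
    also have "\<dots> = (\<integral>\<^sup>+x. ?q * (ennreal ((\<phi> k x)\<^sup>2) * (\<Sum>l=1..M. indicator (near \<omega> l) x * e l)) \<partial>lam)"
      by (simp only: sum_distrib_left)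
    also have "\<dots> \<le> (\<integral>\<^sup>+x. ?q * (ennreal ((\<phi> k x)\<^sup>2) * reach \<omega> x) \<partial>lam)"
      using sum_near_le_reach[OF w] unfolding e_def
      by (intro nn_integral_mono mult_left_mono) auto
    finally show "(\<Sum>l=1..M. ennreal ((spacing_weight a b \<phi> n m (times \<omega>) k l)\<^sup>2))
        \<le> (\<integral>\<^sup>+x. ?q * (ennreal ((\<phi> k x)\<^sup>2) * reach \<omega> x) \<partial>lam)" .
  qed
  also have "\<dots> = (\<integral>\<^sup>+x. (\<integral>\<^sup>+\<omega>. ?q * (ennreal ((\<phi> k x)\<^sup>2) * reach \<omega> x) \<partial>P) \<partial>lam)"
    by (intro PL.Fubini'[symmetric]) simp
  also have "\<dots> \<le> (\<integral>\<^sup>+x. ?q * (ennreal ((\<phi> k x)\<^sup>2) * ennreal ?R) \<partial>lam)"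
  proof (rule nn_integral_mono)
    fix x assume x: "x \<in> space lam"
    have [measurable]: "(\<lambda>\<omega>. reach \<omega> x) \<in> borel_measurable P"
      using measurable_compose[OF _ reach_measurable, of "\<lambda>\<omega>. (\<omega>, x)" P] x by simp
    have "(\<integral>\<^sup>+\<omega>. ?q * (ennreal ((\<phi> k x)\<^sup>2) * reach \<omega> x) \<partial>P) = ?q * (ennreal ((\<phi> k x)\<^sup>2) * (\<integral>\<^sup>+\<omega>. reach \<omega> x \<partial>P))"
      by (simp add: nn_integral_cmult)
    also have "\<dots> \<le> ?q * (ennreal ((\<phi> k x)\<^sup>2) * ennreal ?R)"
      using x by (intro mult_left_mono nn_integral_reach_le) auto
    finally show "(\<integral>\<^sup>+\<omega>. ?q * (ennreal ((\<phi> k x)\<^sup>2) * reach \<omega> x) \<partial>P) \<le> ?q * (ennreal ((\<phi> k x)\<^sup>2) * ennreal ?R)" .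
  qed
  also have "\<dots> = ?q * ((\<integral>\<^sup>+x. ennreal ((\<phi> k x)\<^sup>2) \<partial>lam) * ennreal ?R)"
    by (simp add: nn_integral_cmult nn_integral_multc)
  also have "\<dots> \<le> ?q * (1 * ennreal ?R)"
    using \<phi>(2) by (intro mult_left_mono mult_right_mono) auto
  also have "\<dots> = ennreal (1 / (2 * real h)\<^sup>2 * ?R)"
    using c_pos by (simp only: mult_1_left, subst ennreal_mult') auto
  also have "1 / (2 * real h)\<^sup>2 * ?R = S_sp M / c"
  proof -
    have "real h \<noteq> 0" using h_ge_1 by simp
    then show ?thesis using c_pos unfolding S_sp_def power2_eq_square
      by (simp add: divide_simps)
  qed
  finally show ?thesis .
qed

end

section \<open>Bias of the moving average\<close>

context ranked_times
begin

text \<open>The estimator for noise-free values of \<open>f\<close>, before projection: its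
  coefficient at a basis function is the sum of these values times the spacing weights.\<close>

definition smoothed :: "(real \<Rightarrow> real) \<Rightarrow> 'w \<Rightarrow> real \<Rightarrow> real" where
  "smoothed f \<omega> x = (\<Sum>l=1..M. f (order_stat n m (times \<omega>) l) *
      indicator (spacing_window n m (times \<omega>) l) x) / (2 * real h)"

text \<open>Twice this quantity bounds the squared distance from \<open>x\<close> to every order
  statistic whose \<open>near\<close> set contains \<open>x\<close>, uniformly in the rank, and its
  expectation is accessible by counting.\<close>

definition spread :: "'w \<Rightarrow> real \<Rightarrow> ennreal" where
  "spread \<omega> x = (\<integral>\<^sup>+y. ennreal \<bar>y - x\<bar> * (if between \<omega> x y < h then 1 else 0) \<partial>lam)"

definition inner :: "'w \<Rightarrow> real \<Rightarrow> bool" where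
  "inner \<omega> x \<longleftrightarrow> h \<le> N \<omega> x \<and> N \<omega> x + h \<le> M"

lemma order_stat_in:
  assumes "l \<in> {1..M}" "\<omega> \<in> space P"
  shows "order_stat n m (times \<omega>) l \<in> {a..b}"
  unfolding order_stat_eq using times_in[OF ranked_visits_in[OF assms(1)] assms(2)] .

lemma order_stat_le_iff_N:
  assumes "l \<in> {1..M}"
  shows "order_stat n m (times \<omega>) l \<le> x \<longleftrightarrow> l \<le> N \<omega> x"
  using order_stat_le_iff[of l n m "times \<omega>" x] assms by (simp add: N_def)

lemma nn_integral_abs_diff:
  assumes "u \<le> v" "x \<in> {u, v}"
  shows "(\<integral>\<^sup>+y\<in>{u..v}. ennreal \<bar>y - x\<bar> \<partial>lborel) = ennreal ((v - u)\<^sup>2 / 2)"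
proof -
  have "((\<lambda>y. \<bar>y - x\<bar>) has_integral (v - u)\<^sup>2 / 2) {u..v}"
  proof (cases "x = u")
    case True
    have "((\<lambda>y. y - u) has_integral (v - u)\<^sup>2 / 2 - (u - u)\<^sup>2 / 2) {u..v}"
      using assms(1)
      by (intro fundamental_theorem_of_calculus)
        (auto intro!: derivative_eq_intros simp: has_real_derivative_iff_has_vector_derivative[symmetric])
    then have "((\<lambda>y. y - u) has_integral (v - u)\<^sup>2 / 2) {u..v}" by simp
    then show ?thesis by (rule has_integral_eq[rotated]) (simp add: True)
  next
    case False
    then have x: "x = v" using assms by auto
    have "((\<lambda>y. v - y) has_integral - ((v - v)\<^sup>2 / 2) - - ((v - u)\<^sup>2 / 2)) {u..v}"
      using assms(1)
      by (intro fundamental_theorem_of_calculus)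
        (auto intro!: derivative_eq_intros simp: has_real_derivative_iff_has_vector_derivative[symmetric] field_simps)
    then have "((\<lambda>y. v - y) has_integral (v - u)\<^sup>2 / 2) {u..v}" by simp
    then show ?thesis by (rule has_integral_eq[rotated]) (simp add: x)
  qed
  then show ?thesis by (intro nn_integral_has_integral_lebesgue') auto
qed

text \<open>Between \<open>x\<close> and the order statistic there is no point that has
  \<open>h\<close> or more visits between itself and \<open>x\<close>. Hence the whole segment
  contributes to \<open>spread\<close>, and the integral of |y - x| over it is half its squared
  length.\<close>

lemma dist_order_stat_sq_le:
  assumes w: "\<omega> \<in> space P" and x: "x \<in> near \<omega> l" and l: "l \<in> {1..M}"
  shows "ennreal ((order_stat n m (times \<omega>) l - x)\<^sup>2) \<le> 2 * spread \<omega> x"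
proof -
  let ?t = "order_stat n m (times \<omega>) l"
  have tin: "?t \<in> {a..b}" by (rule order_stat_in[OF l w])
  have xin: "x \<in> {a..b}" and lx: "l \<le> N \<omega> x + h" "N \<omega> x < l + h" using x by (auto simp: near_def)
  define u v where "u = min x ?t" and "v = max x ?t"
  have uv: "u \<le> v" "x \<in> {u, v}" "(v - u)\<^sup>2 = (?t - x)\<^sup>2" "{u..v} \<subseteq> {a..b}"
    using tin xin by (auto simp: u_def v_def min_def max_def power2_commute)
  \<comment> \<open>At an order statistic to the right of \<open>x\<close> the count itself may
    reach \<open>h\<close>, so this one point is left out.\<close>
  have "AE y in lborel. y \<noteq> ?t" by (rule AE_lborel_singleton)
  then have "AE y in lborel. ennreal \<bar>y - x\<bar> * indicator {u..v} y
      \<le> ennreal \<bar>y - x\<bar> * (if between \<omega> x y < h then 1 else 0) * indicator {a..b} y"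
  proof eventually_elim
    case (elim y)
    have "between \<omega> x y < h" if y: "y \<in> {u..v}"
    proof (cases "?t \<le> x")
      case True
      then have "?t \<le> y" "y \<le> x" using y by (auto simp: u_def v_def)
      then have "l \<le> N \<omega> y" using order_stat_le_iff_N[OF l] by simp
      with \<open>y \<le> x\<close> lx show ?thesis by (simp add: between_commute[of _ x] between_eq)
    next
      case False
      then have "y < ?t" "x \<le> y" using y elim by (auto simp: u_def v_def)
      then have "N \<omega> y < l" using order_stat_le_iff_N[OF l, of \<omega> y] by simp
      with \<open>x \<le> y\<close> lx N_mono[OF \<open>x \<le> y\<close>, of \<omega>] show ?thesis by (simp add: between_eq)
    qed
    moreover have "y \<in> {u..v} \<Longrightarrow> y \<in> {a..b}" using uv by blast
    ultimately show ?case by (auto simp: indicator_def)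
  qed
  then have "(\<integral>\<^sup>+y\<in>{u..v}. ennreal \<bar>y - x\<bar> \<partial>lborel) \<le> spread \<omega> x"
    unfolding spread_def nn_integral_leb_on by (rule nn_integral_mono_AE)
  then have "2 * ennreal ((?t - x)\<^sup>2 / 2) \<le> 2 * spread \<omega> x"
    unfolding nn_integral_abs_diff[OF uv(1,2)] uv(3) by (rule mult_left_mono) simp
  moreover have "2 * ennreal ((?t - x)\<^sup>2 / 2) = ennreal ((?t - x)\<^sup>2)"
    by (simp flip: ennreal_numeral ennreal_mult')
  ultimately show ?thesis by simp
qed

definition active :: "'w \<Rightarrow> real \<Rightarrow> nat set" where
  "active \<omega> x = {l\<in>{1..M}. x \<in> spacing_window n m (times \<omega>) l}"

lemma finite_active [simp]: "finite (active \<omega> x)" by (simp add: active_def)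

lemma smoothed_active: "smoothed f \<omega> x = (\<Sum>l\<in>active \<omega> x. f (order_stat n m (times \<omega>) l)) / (2 * real h)"
  unfolding smoothed_def active_def
  by (intro arg_cong2[where f = "(/)"] sum.mono_neutral_cong_right) (auto simp: indicator_def)

lemma active_near:
  assumes "x \<in> {a..b}" "\<forall>v\<in>visit_set n m. (\<lambda>(i, j). times \<omega> i j) v \<noteq> x" "l \<in> active \<omega> x"
  shows "x \<in> near \<omega> l" "l \<in> {1..M}"
  using window_subset_near[OF assms(1,2)] assms(3) by (auto simp: active_def)

lemma card_active_le:
  assumes "x \<in> {a..b}" "\<forall>v\<in>visit_set n m. (\<lambda>(i, j). times \<omega> i j) v \<noteq> x"
  shows "card (active \<omega> x) \<le> 2 * h"
proof -
  \<comment> \<open>If \<open>N \<omega> x + 1 < h\<close>, the lower end truncates to 0 and the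
    interval still has at most \<open>2 * h\<close> elements.\<close>
  have "active \<omega> x \<subseteq> {N \<omega> x + 1 - h..N \<omega> x + h}"
  proof
    fix l assume "l \<in> active \<omega> x"
    from active_near(1)[OF assms this] show "l \<in> {N \<omega> x + 1 - h..N \<omega> x + h}"
      by (auto simp: near_def)
  qed
  then have "card (active \<omega> x) \<le> card {N \<omega> x + 1 - h..N \<omega> x + h}" by (intro card_mono) auto
  then show ?thesis by simp
qed

lemma card_active_inner:
  assumes "x \<in> {a..b}" "\<forall>v\<in>visit_set n m. (\<lambda>(i, j). times \<omega> i j) v \<noteq> x" "inner \<omega> x"
  shows "card (active \<omega> x) = 2 * h"
proof -
  have "active \<omega> x = {N \<omega> x + 1 - h..N \<omega> x + h}"
  proof (intro equalityI subsetI)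
    fix l assume "l \<in> active \<omega> x"
    from active_near(1)[OF assms(1,2) this] show "l \<in> {N \<omega> x + 1 - h..N \<omega> x + h}"
      by (auto simp: near_def)
  next
    fix l assume l: "l \<in> {N \<omega> x + 1 - h..N \<omega> x + h}"
    have "x \<in> near \<omega> l" using l assms by (auto simp: near_def)
    then show "l \<in> active \<omega> x"
      using near_subset_window[of x \<omega> l] assms l by (auto simp: active_def inner_def)
  qed
  then show ?thesis using assms by (simp add: inner_def)
qed

text \<open>With exactly 2h active windows the weights sum to 1, so the error is an average of
  deviations f(T) - f(x) and at most the largest of them. Distances are controlled only in second
  moment, while the Hoelder condition asks for the power 2 \<alpha> \<le> 2; the bound d^(2
  \<alpha>) \<le> \<delta>^(2 \<alpha>) (1 + (d / \<delta>)^2) bridges the gap with a free scale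
  \<delta>.\<close>

lemma smoothed_inner:
  assumes w: "\<omega> \<in> space P" and x: "x \<in> {a..b}" "\<forall>v\<in>visit_set n m. (\<lambda>(i, j). times \<omega> i j) v \<noteq> x" "inner \<omega> x"
    and f: "\<And>t. t \<in> {a..b} \<Longrightarrow> \<bar>f t - f x\<bar> \<le> L * \<bar>t - x\<bar> powr \<alpha>" and L: "0 \<le> L"
    and \<alpha>: "0 < \<alpha>" "\<alpha> \<le> 1" and \<delta>: "0 < \<delta>"
  shows "ennreal ((smoothed f \<omega> x - f x)\<^sup>2) \<le> ennreal (L\<^sup>2 * \<delta> powr (2 * \<alpha>)) * (1 + ennreal (2 / \<delta>\<^sup>2) * spread \<omega> x)"
proof -
  let ?o = "order_stat n m (times \<omega>)"
  let ?A = "active \<omega> x"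
  define z where "z l = f (?o l) - f x" for l
  have h: "0 < real h" using h_ge_1 by simp
  have cA: "card ?A = 2 * h" by (rule card_active_inner[OF x])
  then have ne: "?A \<noteq> {}" using h_ge_1 by force
  obtain k where k: "k \<in> ?A" "\<And>l. l \<in> ?A \<Longrightarrow> \<bar>z l\<bar> \<le> \<bar>z k\<bar>"
  proof -
    have "Max ((\<lambda>l. \<bar>z l\<bar>) ` ?A) \<in> (\<lambda>l. \<bar>z l\<bar>) ` ?A" using ne by (intro Max_in) auto
    then obtain k where "k \<in> ?A" "Max ((\<lambda>l. \<bar>z l\<bar>) ` ?A) = \<bar>z k\<bar>" by auto
    with that show thesis by (metis Max_ge finite_active finite_imageI imageI)
  qed
  have "smoothed f \<omega> x - f x = (\<Sum>l\<in>?A. z l) / (2 * real h)"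
    using h cA by (simp add: smoothed_active z_def sum_subtractf diff_divide_distrib)
  also have "\<bar>\<dots>\<bar> \<le> (\<Sum>l\<in>?A. \<bar>z k\<bar>) / (2 * real h)"
  proof -
    have "\<bar>\<Sum>l\<in>?A. z l\<bar> \<le> (\<Sum>l\<in>?A. \<bar>z k\<bar>)" by (rule order_trans[OF sum_abs sum_mono]) (rule k(2))
    then show ?thesis using h by (simp add: divide_right_mono del: sum_constant)
  qed
  also have "\<dots> = \<bar>z k\<bar>" using h cA by simp
  finally have 1: "(smoothed f \<omega> x - f x)\<^sup>2 \<le> (z k)\<^sup>2" by (rule abs_le_square_iff[THEN iffD1])
  define d where "d = \<bar>?o k - x\<bar>"
  have kM: "k \<in> {1..M}" and kn: "x \<in> near \<omega> k" using active_near[OF x(1,2) k(1)] by auto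
  have "\<bar>z k\<bar> \<le> L * d powr \<alpha>"
    unfolding z_def d_def by (intro f order_stat_in[OF kM w])
  then have "(z k)\<^sup>2 \<le> (L * d powr \<alpha>)\<^sup>2" using L by (intro abs_le_square_iff[THEN iffD1]) auto
  also have "\<dots> = L\<^sup>2 * d powr (2 * \<alpha>)"
    by (simp add: power_mult_distrib power2_eq_square flip: powr_add)
  also have "d powr (2 * \<alpha>) = \<delta> powr (2 * \<alpha>) * (d / \<delta>) powr (2 * \<alpha>)"
    using \<delta> by (simp add: d_def powr_divide)
  also have "(d / \<delta>) powr (2 * \<alpha>) \<le> 1 + (d / \<delta>)\<^sup>2"
  proof (cases "d / \<delta> \<le> 1")
    case True
    have "(d / \<delta>) powr (2 * \<alpha>) \<le> 1 powr (2 * \<alpha>)"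
      using True \<delta> \<alpha> by (intro powr_mono2) (auto simp: d_def)
    then show ?thesis by (simp add: add_increasing2)
  next
    case False
    have "(d / \<delta>) powr (2 * \<alpha>) \<le> (d / \<delta>) powr 2"
      using False \<alpha> by (intro powr_mono) auto
    then show ?thesis using False by (simp add: powr_numeral)
  qed
  finally have 2: "(z k)\<^sup>2 \<le> L\<^sup>2 * \<delta> powr (2 * \<alpha>) * (1 + (d / \<delta>)\<^sup>2)"
    by (simp add: mult_left_mono mult.assoc)
  have "ennreal ((smoothed f \<omega> x - f x)\<^sup>2) \<le> ennreal (L\<^sup>2 * \<delta> powr (2 * \<alpha>) * (1 + (d / \<delta>)\<^sup>2))"
    using 1 2 by (intro ennreal_leI) linarith
  also have "\<dots> = ennreal (L\<^sup>2 * \<delta> powr (2 * \<alpha>)) * (1 + ennreal (1 / \<delta>\<^sup>2) * ennreal ((?o k - x)\<^sup>2))"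
    by (simp add: ennreal_mult' power_divide d_def flip: ennreal_mult' ennreal_1 ennreal_plus)
  also have "\<dots> \<le> ennreal (L\<^sup>2 * \<delta> powr (2 * \<alpha>)) * (1 + ennreal (1 / \<delta>\<^sup>2) * (2 * spread \<omega> x))"
    by (intro mult_left_mono add_left_mono dist_order_stat_sq_le w kM kn) auto
  also have "ennreal (1 / \<delta>\<^sup>2) * (2 * spread \<omega> x) = ennreal (2 / \<delta>\<^sup>2) * spread \<omega> x"
  proof -
    have "ennreal (2 / \<delta>\<^sup>2) = ennreal (1 / \<delta>\<^sup>2) * 2"
      by (simp flip: ennreal_numeral ennreal_mult'')
    then show ?thesis by (simp add: mult.assoc)
  qed
  finally show ?thesis .
qed

text \<open>For use near the ends of the interval, where the weights need not sum to 1: the two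
  terms of the difference are simply estimated separately.\<close>

lemma smoothed_sq_le:
  assumes x: "x \<in> {a..b}" "\<forall>v\<in>visit_set n m. (\<lambda>(i, j). times \<omega> i j) v \<noteq> x"
  shows "(smoothed f \<omega> x - f x)\<^sup>2 \<le> (\<Sum>l\<in>active \<omega> x. (f (order_stat n m (times \<omega>) l))\<^sup>2 / real h) + 2 * (f x)\<^sup>2"
proof -
  let ?A = "active \<omega> x" and ?z = "\<lambda>l. f (order_stat n m (times \<omega>) l)"
  have h: "0 < real h" using h_ge_1 by simp
  have "(\<Sum>l\<in>?A. ?z l)\<^sup>2 \<le> real (card ?A) * (\<Sum>l\<in>?A. (?z l)\<^sup>2)"
    using sum_squared_le_sum_of_squares[of ?z ?A] by (simp add: mult.commute)
  also have "\<dots> \<le> (2 * real h) * (\<Sum>l\<in>?A. (?z l)\<^sup>2)"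
    using card_active_le[OF x] by (intro mult_right_mono sum_nonneg) auto
  finally have "2 * (\<Sum>l\<in>?A. ?z l)\<^sup>2 / (2 * real h)\<^sup>2 \<le> 2 * ((2 * real h) * (\<Sum>l\<in>?A. (?z l)\<^sup>2)) / (2 * real h)\<^sup>2"
    using h by (intro divide_right_mono mult_left_mono) auto
  also have "\<dots> = (\<Sum>l\<in>?A. (?z l)\<^sup>2) / real h"
    using h by (simp add: power2_eq_square)
  finally have "2 * (smoothed f \<omega> x)\<^sup>2 \<le> (\<Sum>l\<in>?A. (?z l)\<^sup>2) / real h"
    by (simp add: smoothed_active power_divide)
  moreover have "(smoothed f \<omega> x - f x)\<^sup>2 \<le> 2 * (smoothed f \<omega> x)\<^sup>2 + 2 * (f x)\<^sup>2"
    using sum_squares_bound[of "smoothed f \<omega> x" "- f x"] by (simp add: power2_diff)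
  ultimately show ?thesis by (simp add: sum_divide_distrib)
qed

lemma spread_measurable: "(\<lambda>(\<omega>, x). spread \<omega> x) \<in> borel_measurable (P \<Otimes>\<^sub>M lam)"
proof -
  have [measurable]: "(\<lambda>p. fst p) \<in> borel_measurable (lam \<Otimes>\<^sub>M lam)" "(\<lambda>p. snd p) \<in> borel_measurable (lam \<Otimes>\<^sub>M lam)"
    by (auto intro: borel_measurable_if_leb_on)
  show ?thesis
    unfolding spread_def by (intro measurable_nn_integral_between) (simp add: case_prod_beta)
qed

lemma nn_integral_spread_le:
  assumes x: "x \<in> {a..b}"
  shows "(\<integral>\<^sup>+\<omega>. spread \<omega> x \<partial>P) \<le> ennreal (real h * (real h + 1) / ((real M + 1) * (real M + 2) * c\<^sup>2))"
proof -
  have "spread \<omega> x = (\<integral>\<^sup>+y. ennreal \<bar>y - x\<bar> * indicator {y. between \<omega> x y < h} y \<partial>lam)" for \<omega>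
    unfolding spread_def by (intro nn_integral_cong) (simp add: indicator_def)
  then show ?thesis using nn_integral_distance_le[OF x, of h] by (simp add: M_eq)
qed

lemma N_joint_measurable: "(\<lambda>(\<omega>, x). N \<omega> x) \<in> measurable (P \<Otimes>\<^sub>M lam) (count_space UNIV)"
proof -
  have [measurable]: "(\<lambda>p. snd p) \<in> borel_measurable (P \<Otimes>\<^sub>M lam)" by (rule borel_measurable_if_leb_on) simp
  have "(\<lambda>p. card {v\<in>visit_set n m. (\<lambda>(i, j). T i j) v (fst p) \<le> snd p}) \<in> measurable (P \<Otimes>\<^sub>M lam) (count_space UNIV)"
  proof (intro measurable_card_finite finite_visit_set)
    fix v assume v: "v \<in> visit_set n m"
    note [measurable] = borel_measurable_if_leb_on[OF T_meas[OF v]]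
    show "{p \<in> space (P \<Otimes>\<^sub>M lam). (\<lambda>(i, j). T i j) v (fst p) \<le> snd p} \<in> sets (P \<Otimes>\<^sub>M lam)"
      by measurable
  qed
  then show ?thesis unfolding N_def times_eq by (simp add: split_beta')
qed

lemma pointwise_bias_le:
  fixes \<nu> :: "'u measure" and \<mu> :: "'u \<Rightarrow> real \<Rightarrow> real"
  assumes \<mu>: "\<And>t. t \<in> {a..b} \<Longrightarrow> (\<lambda>u. \<mu> u t) \<in> borel_measurable \<nu>"
    and S: "\<And>t. t \<in> {a..b} \<Longrightarrow> (\<integral>\<^sup>+u. ennreal ((\<mu> u t)\<^sup>2) \<partial>\<nu>) \<le> ennreal S" and S0: "0 \<le> S"
    and L: "L \<in> borel_measurable \<nu>" "\<And>u. 0 \<le> L u" "(\<integral>\<^sup>+u. ennreal ((L u)\<^sup>2) \<partial>\<nu>) \<le> ennreal L2" "0 \<le> L2"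
    and hold: "\<And>u t t'. t \<in> {a..b} \<Longrightarrow> t' \<in> {a..b} \<Longrightarrow> \<bar>\<mu> u t - \<mu> u t'\<bar> \<le> L u * \<bar>t - t'\<bar> powr \<alpha>"
    and \<alpha>: "0 < \<alpha>" "\<alpha> \<le> 1" and \<delta>: "0 < \<delta>"
    and w: "\<omega> \<in> space P" and x: "x \<in> {a..b}" "\<forall>v\<in>visit_set n m. (\<lambda>(i, j). times \<omega> i j) v \<noteq> x"
  shows "(\<integral>\<^sup>+u. ennreal ((smoothed (\<mu> u) \<omega> x - \<mu> u x)\<^sup>2) \<partial>\<nu>)
    \<le> ennreal (L2 * \<delta> powr (2 * \<alpha>)) * (1 + ennreal (2 / \<delta>\<^sup>2) * spread \<omega> x) +
      ennreal (4 * S) * ((if N \<omega> x < h then 1 else 0) + (if M < N \<omega> x + h then 1 else 0))"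
proof (cases "inner \<omega> x")
  case True
  let ?K = "ennreal (\<delta> powr (2 * \<alpha>)) * (1 + ennreal (2 / \<delta>\<^sup>2) * spread \<omega> x)"
  have "(\<integral>\<^sup>+u. ennreal ((smoothed (\<mu> u) \<omega> x - \<mu> u x)\<^sup>2) \<partial>\<nu>) \<le> (\<integral>\<^sup>+u. ennreal ((L u)\<^sup>2) * ?K \<partial>\<nu>)"
  proof (rule nn_integral_mono)
    fix u
    have "ennreal ((smoothed (\<mu> u) \<omega> x - \<mu> u x)\<^sup>2)
        \<le> ennreal ((L u)\<^sup>2 * \<delta> powr (2 * \<alpha>)) * (1 + ennreal (2 / \<delta>\<^sup>2) * spread \<omega> x)"
      using hold x(1) L(2) by (intro smoothed_inner[OF w x True _ _ \<alpha> \<delta>]) auto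
    then show "ennreal ((smoothed (\<mu> u) \<omega> x - \<mu> u x)\<^sup>2) \<le> ennreal ((L u)\<^sup>2) * ?K"
      by (simp add: ennreal_mult mult.assoc)
  qed
  also have "\<dots> = (\<integral>\<^sup>+u. ennreal ((L u)\<^sup>2) \<partial>\<nu>) * ?K"
    using L(1) by (intro nn_integral_multc) simp
  also have "\<dots> \<le> ennreal L2 * ?K" by (intro mult_right_mono L) simp
  also have "\<dots> = ennreal (L2 * \<delta> powr (2 * \<alpha>)) * (1 + ennreal (2 / \<delta>\<^sup>2) * spread \<omega> x)"
    using L(4) by (simp add: ennreal_mult mult.assoc)
  finally show ?thesis by (rule order_trans) simp
next
  case False
  let ?o = "order_stat n m (times \<omega>)" and ?A = "active \<omega> x"
  have h: "0 < real h" using h_ge_1 by simp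
  have o: "?o l \<in> {a..b}" if "l \<in> ?A" for l
    using active_near(2)[OF x that] w by (intro order_stat_in)
  have "(\<integral>\<^sup>+u. ennreal ((smoothed (\<mu> u) \<omega> x - \<mu> u x)\<^sup>2) \<partial>\<nu>)
      \<le> (\<integral>\<^sup>+u. (\<Sum>l\<in>?A. ennreal ((\<mu> u (?o l))\<^sup>2) * ennreal (1 / real h)) + ennreal ((\<mu> u x)\<^sup>2) * 2 \<partial>\<nu>)"
  proof (rule nn_integral_mono)
    fix u
    have "ennreal ((smoothed (\<mu> u) \<omega> x - \<mu> u x)\<^sup>2) \<le> ennreal ((\<Sum>l\<in>?A. (\<mu> u (?o l))\<^sup>2 * (1 / real h)) + (\<mu> u x)\<^sup>2 * 2)"
      using smoothed_sq_le[OF x, of "\<mu> u"] by (intro ennreal_leI) simp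
    also have "\<dots> = (\<Sum>l\<in>?A. ennreal ((\<mu> u (?o l))\<^sup>2) * ennreal (1 / real h)) + ennreal ((\<mu> u x)\<^sup>2) * 2"
    proof -
      have "ennreal (\<Sum>l\<in>?A. (\<mu> u (?o l))\<^sup>2 * (1 / real h)) = (\<Sum>l\<in>?A. ennreal ((\<mu> u (?o l))\<^sup>2 * (1 / real h)))"
        by (rule sum_ennreal[symmetric]) simp
      moreover have "ennreal ((\<mu> u x)\<^sup>2 * 2) = ennreal ((\<mu> u x)\<^sup>2) * 2"
        by (subst ennreal_mult) simp_all
      ultimately show ?thesis
        by (subst ennreal_plus) (simp_all add: ennreal_mult sum_nonneg del: times_divide_eq_right)
    qed
    finally show "ennreal ((smoothed (\<mu> u) \<omega> x - \<mu> u x)\<^sup>2) \<le>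
        (\<Sum>l\<in>?A. ennreal ((\<mu> u (?o l))\<^sup>2) * ennreal (1 / real h)) + ennreal ((\<mu> u x)\<^sup>2) * 2" .
  qed
  also have "\<dots> = (\<Sum>l\<in>?A. (\<integral>\<^sup>+u. ennreal ((\<mu> u (?o l))\<^sup>2) \<partial>\<nu>) * ennreal (1 / real h)) +
      (\<integral>\<^sup>+u. ennreal ((\<mu> u x)\<^sup>2) \<partial>\<nu>) * 2"
  proof -
    have m: "(\<lambda>u. ennreal ((\<mu> u t)\<^sup>2)) \<in> borel_measurable \<nu>" if "t \<in> {a..b}" for t
      using \<mu>[OF that] by simp
    show ?thesis
      using m o x by (subst nn_integral_add) (auto simp: nn_integral_sum nn_integral_multc
          intro!: borel_measurable_sum borel_measurable_times)
  qed
  also have "\<dots> \<le> (\<Sum>l\<in>?A. ennreal S * ennreal (1 / real h)) + ennreal S * 2"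
    using o x by (intro add_mono sum_mono mult_right_mono S) auto
  also have "\<dots> = ennreal (real (card ?A) / real h * S + 2 * S)"
  proof -
    have "(\<Sum>l\<in>?A. ennreal S * ennreal (1 / real h)) = ennreal (\<Sum>l\<in>?A. S * (1 / real h))"
      using S0 by (subst sum_ennreal[symmetric]) (simp_all add: ennreal_mult del: times_divide_eq_right)
    moreover have "ennreal S * 2 = ennreal (2 * S)"
      using S0 by (subst mult.commute[of 2]) (simp add: ennreal_mult)
    ultimately show ?thesis using S0 by (simp flip: ennreal_plus)
  qed
  \<comment> \<open>At most 2h active windows give \<open>2 * S\<close>, and the value at
    \<open>x\<close> gives another \<open>2 * S\<close>.\<close>
  also have "\<dots> \<le> ennreal (4 * S)"
  proof (rule ennreal_leI)
    have "real (card ?A) / real h \<le> 2"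
      using card_active_le[OF x] h by (simp add: divide_le_eq)
    then show "real (card ?A) / real h * S + 2 * S \<le> 4 * S"
      using S0 mult_right_mono[of "real (card ?A) / real h" 2 S] by linarith
  qed
  also have "\<dots> \<le> ennreal (4 * S) * ((if N \<omega> x < h then 1 else 0) + (if M < N \<omega> x + h then 1 else 0))"
  proof -
    have "1 \<le> ((if N \<omega> x < h then 1 else 0) + (if M < N \<omega> x + h then 1 else 0) :: ennreal)"
      using False by (auto simp: inner_def not_le)
    from mult_left_mono[OF this, of "ennreal (4 * S)"] show ?thesis by simp
  qed
  finally show ?thesis by (rule order_trans) simp
qed

lemma nn_integral_outer_le:
  shows "(\<integral>\<^sup>+x. \<integral>\<^sup>+\<omega>. (if N \<omega> x < h then 1 else 0) \<partial>P \<partial>lam) \<le> ennreal (real h / ((real M + 1) * c))"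
    and "(\<integral>\<^sup>+x. \<integral>\<^sup>+\<omega>. (if M < N \<omega> x + h then 1 else 0) \<partial>P \<partial>lam) \<le> ennreal (real h / ((real M + 1) * c))"
proof -
  have N: "(\<lambda>\<omega>. N \<omega> x) \<in> measurable P (count_space UNIV)" if "x \<in> {a..b}" for x
    using measurable_compose[OF _ N_joint_measurable, of "\<lambda>\<omega>. (\<omega>, x)" P] that by simp
  have "(\<integral>\<^sup>+x. \<integral>\<^sup>+\<omega>. (if N \<omega> x < h then 1 else 0) \<partial>P \<partial>lam)
      = (\<integral>\<^sup>+x. emeasure P {\<omega>\<in>space P. card {v\<in>visit_set n m. (\<lambda>(i, j). T i j) v \<omega> \<le> x} < h} \<partial>lam)"
  proof (rule nn_integral_cong)
    fix x assume x: "x \<in> space lam"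
    then have [measurable]: "(\<lambda>\<omega>. N \<omega> x) \<in> measurable P (count_space UNIV)" by (intro N) simp
    have "(\<integral>\<^sup>+\<omega>. (if N \<omega> x < h then 1 else 0) \<partial>P) = (\<integral>\<^sup>+\<omega>. indicator {\<omega>\<in>space P. N \<omega> x < h} \<omega> \<partial>P)"
      by (intro nn_integral_cong) (simp add: indicator_def)
    also have "\<dots> = emeasure P {\<omega>\<in>space P. N \<omega> x < h}" by (rule nn_integral_indicator) measurable
    finally show "(\<integral>\<^sup>+\<omega>. (if N \<omega> x < h then 1 else 0) \<partial>P)
        = emeasure P {\<omega>\<in>space P. card {v\<in>visit_set n m. (\<lambda>(i, j). T i j) v \<omega> \<le> x} < h}"
      by (simp add: N_def times_eq)
  qed
  then show "(\<integral>\<^sup>+x. \<integral>\<^sup>+\<omega>. (if N \<omega> x < h then 1 else 0) \<partial>P \<partial>lam) \<le> ennreal (real h / ((real M + 1) * c))"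
    using nn_integral_boundary_le(1)[of h] by (simp add: M_eq)
  have cnt: "card {v\<in>visit_set n m. x < (\<lambda>(i, j). T i j) v \<omega>} = M - N \<omega> x" for x \<omega>
  proof -
    have "{v\<in>visit_set n m. x < (\<lambda>(i, j). T i j) v \<omega>} =
        visit_set n m - {v\<in>visit_set n m. (\<lambda>(i, j). T i j) v \<omega> \<le> x}" by auto
    then show ?thesis by (simp add: card_Diff_subset N_def times_eq M_eq)
  qed
  have "(\<integral>\<^sup>+x. \<integral>\<^sup>+\<omega>. (if M < N \<omega> x + h then 1 else 0) \<partial>P \<partial>lam)
      = (\<integral>\<^sup>+x. emeasure P {\<omega>\<in>space P. card {v\<in>visit_set n m. x < (\<lambda>(i, j). T i j) v \<omega>} < h} \<partial>lam)"
  proof (rule nn_integral_cong)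
    fix x assume x: "x \<in> space lam"
    then have [measurable]: "(\<lambda>\<omega>. N \<omega> x) \<in> measurable P (count_space UNIV)" by (intro N) simp
    have "(\<integral>\<^sup>+\<omega>. (if M < N \<omega> x + h then 1 else 0) \<partial>P) = (\<integral>\<^sup>+\<omega>. indicator {\<omega>\<in>space P. M < N \<omega> x + h} \<omega> \<partial>P)"
      by (intro nn_integral_cong) (simp add: indicator_def)
    also have "\<dots> = emeasure P {\<omega>\<in>space P. M < N \<omega> x + h}" by (rule nn_integral_indicator) measurable
    also have "{\<omega>\<in>space P. M < N \<omega> x + h} = {\<omega>\<in>space P. card {v\<in>visit_set n m. x < (\<lambda>(i, j). T i j) v \<omega>} < h}"
      unfolding cnt using N_le_M[of _ x] h_ge_1 by (auto simp: less_diff_conv2)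
    finally show "(\<integral>\<^sup>+\<omega>. (if M < N \<omega> x + h then 1 else 0) \<partial>P)
        = emeasure P {\<omega>\<in>space P. card {v\<in>visit_set n m. x < (\<lambda>(i, j). T i j) v \<omega>} < h}" .
  qed
  then show "(\<integral>\<^sup>+x. \<integral>\<^sup>+\<omega>. (if M < N \<omega> x + h then 1 else 0) \<partial>P \<partial>lam) \<le> ennreal (real h / ((real M + 1) * c))"
    using nn_integral_boundary_le(2)[of h] by (simp add: M_eq)
qed

lemma expected_bias_le:
  fixes \<nu> :: "'u measure" and \<mu> :: "'u \<Rightarrow> real \<Rightarrow> real"
  assumes \<mu>: "\<And>t. t \<in> {a..b} \<Longrightarrow> (\<lambda>u. \<mu> u t) \<in> borel_measurable \<nu>"
    and S: "\<And>t. t \<in> {a..b} \<Longrightarrow> (\<integral>\<^sup>+u. ennreal ((\<mu> u t)\<^sup>2) \<partial>\<nu>) \<le> ennreal S" and S0: "0 \<le> S"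
    and L: "L \<in> borel_measurable \<nu>" "\<And>u. 0 \<le> L u" "(\<integral>\<^sup>+u. ennreal ((L u)\<^sup>2) \<partial>\<nu>) \<le> ennreal L2" "0 \<le> L2"
    and hold: "\<And>u t t'. t \<in> {a..b} \<Longrightarrow> t' \<in> {a..b} \<Longrightarrow> \<bar>\<mu> u t - \<mu> u t'\<bar> \<le> L u * \<bar>t - t'\<bar> powr \<alpha>"
    and \<alpha>: "0 < \<alpha>" "\<alpha> \<le> 1"
  shows "(\<integral>\<^sup>+\<omega>. \<integral>\<^sup>+x. \<integral>\<^sup>+u. ennreal ((smoothed (\<mu> u) \<omega> x - \<mu> u x)\<^sup>2) \<partial>\<nu> \<partial>lam \<partial>P)
    \<le> ennreal (2 * L2 / c powr (2 * \<alpha> + 1) * (2 * real h / (real M + 1)) powr (2 * \<alpha>) + 8 * S / c * (real h / (real M + 1)))"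
proof -
  interpret Lm: sigma_finite_measure lam by (rule sigma_finite_leb_on)
  interpret PL: pair_sigma_finite P lam ..
  note [measurable] = spread_measurable N_joint_measurable
  have h: "1 \<le> real h" using h_ge_1 by simp
  \<comment> \<open>The scale is matched to the expected spread: the product of 2 / \<delta>^2 with
    its bound is (M + 1)(h + 1) / ((M + 2) 2h) \<le> 1, so the bracket has expectation at most 2,
    and \<delta>^(2 \<alpha>) carries the power of 2h / (M + 1) of the remainder.\<close>
  define \<delta> where "\<delta> = 2 * real h / ((real M + 1) * c)"
  have \<delta>: "0 < \<delta>" using h c_pos by (simp add: \<delta>_def)
  let ?A = "ennreal (L2 * \<delta> powr (2 * \<alpha>))" and ?D = "ennreal (2 / \<delta>\<^sup>2)"
  let ?Q = "\<lambda>\<omega> x. (if N \<omega> x < h then 1 else 0) + (if M < N \<omega> x + h then 1 else 0) :: ennreal"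
  have "(\<integral>\<^sup>+\<omega>. \<integral>\<^sup>+x. \<integral>\<^sup>+u. ennreal ((smoothed (\<mu> u) \<omega> x - \<mu> u x)\<^sup>2) \<partial>\<nu> \<partial>lam \<partial>P)
      \<le> (\<integral>\<^sup>+\<omega>. \<integral>\<^sup>+x. ?A * (1 + ?D * spread \<omega> x) + ennreal (4 * S) * ?Q \<omega> x \<partial>lam \<partial>P)"
  proof (rule nn_integral_mono, rule nn_integral_mono_AE)
    fix \<omega> assume w: "\<omega> \<in> space P"
    show "AE x in lam. (\<integral>\<^sup>+u. ennreal ((smoothed (\<mu> u) \<omega> x - \<mu> u x)\<^sup>2) \<partial>\<nu>)
        \<le> ?A * (1 + ?D * spread \<omega> x) + ennreal (4 * S) * ?Q \<omega> x"
      using AE_no_visit[of \<omega>] AE_space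
    proof eventually_elim
      case (elim x)
      then have x: "x \<in> {a..b}" by simp
      show ?case by (rule pointwise_bias_le[OF \<mu> S S0 L hold \<alpha> \<delta> w x elim(1)]) auto
    qed
  qed
  also have "\<dots> = (\<integral>\<^sup>+x. \<integral>\<^sup>+\<omega>. ?A * (1 + ?D * spread \<omega> x) + ennreal (4 * S) * ?Q \<omega> x \<partial>P \<partial>lam)"
    by (intro PL.Fubini'[symmetric]) simp
  also have "\<dots> \<le> (\<integral>\<^sup>+x. ?A * 2 + ennreal (4 * S) * (\<integral>\<^sup>+\<omega>. ?Q \<omega> x \<partial>P) \<partial>lam)"
  proof (rule nn_integral_mono)
    fix x assume x: "x \<in> space lam"
    have [measurable]: "(\<lambda>\<omega>. spread \<omega> x) \<in> borel_measurable P" "(\<lambda>\<omega>. N \<omega> x) \<in> measurable P (count_space UNIV)"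
      using measurable_compose[OF _ spread_measurable, of "\<lambda>\<omega>. (\<omega>, x)" P]
        measurable_compose[OF _ N_joint_measurable, of "\<lambda>\<omega>. (\<omega>, x)" P] x by simp_all
    have "(\<integral>\<^sup>+\<omega>. ?A * (1 + ?D * spread \<omega> x) + ennreal (4 * S) * ?Q \<omega> x \<partial>P)
        = ?A * (1 + ?D * (\<integral>\<^sup>+\<omega>. spread \<omega> x \<partial>P)) + ennreal (4 * S) * (\<integral>\<^sup>+\<omega>. ?Q \<omega> x \<partial>P)"
      by (simp add: nn_integral_add nn_integral_cmult emeasure_space_1)
    also have "\<dots> \<le> ?A * 2 + ennreal (4 * S) * (\<integral>\<^sup>+\<omega>. ?Q \<omega> x \<partial>P)"
    proof (intro add_right_mono mult_left_mono)
      have "?D * (\<integral>\<^sup>+\<omega>. spread \<omega> x \<partial>P) \<le> ?D * ennreal (real h * (real h + 1) / ((real M + 1) * (real M + 2) * c\<^sup>2))"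
        using x by (intro mult_left_mono nn_integral_spread_le) auto
      also have "\<dots> = ennreal (2 / \<delta>\<^sup>2 * (real h * (real h + 1) / ((real M + 1) * (real M + 2) * c\<^sup>2)))"
        by (rule ennreal_mult'[symmetric]) simp
      also have "\<dots> \<le> ennreal 1"
      proof (rule ennreal_leI)
        have "2 / \<delta>\<^sup>2 * (real h * (real h + 1) / ((real M + 1) * (real M + 2) * c\<^sup>2))
            = ((real M + 1) / (real M + 2)) * ((real h + 1) / (2 * real h))"
          using h c_pos unfolding \<delta>_def by (simp add: divide_simps power2_eq_square)
        also have "\<dots> \<le> 1 * 1"
          using h by (intro mult_mono) auto
        finally show "2 / \<delta>\<^sup>2 * (real h * (real h + 1) / ((real M + 1) * (real M + 2) * c\<^sup>2)) \<le> 1" by simp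
      qed
      finally have "1 + ?D * (\<integral>\<^sup>+\<omega>. spread \<omega> x \<partial>P) \<le> 1 + 1" by (intro add_left_mono) simp
      then show "1 + ?D * (\<integral>\<^sup>+\<omega>. spread \<omega> x \<partial>P) \<le> 2" by simp
    qed simp
    finally show "(\<integral>\<^sup>+\<omega>. ?A * (1 + ?D * spread \<omega> x) + ennreal (4 * S) * ?Q \<omega> x \<partial>P)
        \<le> ?A * 2 + ennreal (4 * S) * (\<integral>\<^sup>+\<omega>. ?Q \<omega> x \<partial>P)" .
  qed
  also have "\<dots> = ?A * 2 * ennreal (b - a) + ennreal (4 * S) * (\<integral>\<^sup>+x. \<integral>\<^sup>+\<omega>. ?Q \<omega> x \<partial>P \<partial>lam)"
  proof -
    have m: "(\<lambda>x. \<integral>\<^sup>+\<omega>. ?Q \<omega> x \<partial>P) \<in> borel_measurable lam"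
      by (rule borel_measurable_nn_integral[of "\<lambda>x \<omega>. ?Q \<omega> x"])
        (use measurable_compose[OF measurable_pair_swap' N_joint_measurable] in \<open>simp add: case_prod_beta\<close>)
    have "emeasure lam {a..b} = ennreal (b - a)"
      using ab by (subst emeasure_leb_on) (auto simp: leb_on_def sets_restrict_space)
    then show ?thesis using m by (simp add: nn_integral_add nn_integral_cmult)
  qed
  also have "\<dots> \<le> ?A * 2 * ennreal (1 / c) +
      ennreal (4 * S) * (ennreal (real h / ((real M + 1) * c)) + ennreal (real h / ((real M + 1) * c)))"
  proof (intro add_mono mult_left_mono)
    \<comment> \<open>Trading the length of the interval for 1 / c accounts for the extra 1 in the
      exponent of \<open>c powr (2 * \<alpha> + 1)\<close>.\<close>
    show "ennreal (b - a) \<le> ennreal (1 / c)"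
      using c_length_le_1 c_pos by (intro ennreal_leI) (simp add: pos_le_divide_eq mult.commute)
    have m: "(\<lambda>x. \<integral>\<^sup>+\<omega>. (if N \<omega> x < h then 1 else 0) \<partial>P) \<in> borel_measurable lam"
      "(\<lambda>x. \<integral>\<^sup>+\<omega>. (if M < N \<omega> x + h then 1 else 0) \<partial>P) \<in> borel_measurable lam"
      using measurable_compose[OF measurable_pair_swap' N_joint_measurable]
      by (auto intro!: borel_measurable_nn_integral simp: case_prod_beta)
    have "(\<integral>\<^sup>+x. \<integral>\<^sup>+\<omega>. ?Q \<omega> x \<partial>P \<partial>lam) =
        (\<integral>\<^sup>+x. (\<integral>\<^sup>+\<omega>. (if N \<omega> x < h then 1 else 0) \<partial>P) + (\<integral>\<^sup>+\<omega>. (if M < N \<omega> x + h then 1 else 0) \<partial>P) \<partial>lam)"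
    proof (rule nn_integral_cong)
      fix x assume x: "x \<in> space lam"
      have [measurable]: "(\<lambda>\<omega>. N \<omega> x) \<in> measurable P (count_space UNIV)"
        using measurable_compose[OF _ N_joint_measurable, of "\<lambda>\<omega>. (\<omega>, x)" P] x by simp
      show "(\<integral>\<^sup>+\<omega>. ?Q \<omega> x \<partial>P) = (\<integral>\<^sup>+\<omega>. (if N \<omega> x < h then 1 else 0) \<partial>P) + (\<integral>\<^sup>+\<omega>. (if M < N \<omega> x + h then 1 else 0) \<partial>P)"
        by (rule nn_integral_add) simp_all
    qed
    also have "\<dots> = (\<integral>\<^sup>+x. \<integral>\<^sup>+\<omega>. (if N \<omega> x < h then 1 else 0) \<partial>P \<partial>lam) + (\<integral>\<^sup>+x. \<integral>\<^sup>+\<omega>. (if M < N \<omega> x + h then 1 else 0) \<partial>P \<partial>lam)"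
      by (rule nn_integral_add[OF m])
    also have "\<dots> \<le> ennreal (real h / ((real M + 1) * c)) + ennreal (real h / ((real M + 1) * c))"
      by (intro add_mono nn_integral_outer_le)
    finally show "(\<integral>\<^sup>+x. \<integral>\<^sup>+\<omega>. ?Q \<omega> x \<partial>P \<partial>lam) \<le> \<dots>" .
  qed simp_all
  also have "\<dots> = ennreal (L2 * \<delta> powr (2 * \<alpha>) * 2 * (1 / c) + 4 * S * (real h / ((real M + 1) * c) + real h / ((real M + 1) * c)))"
  proof -
    have "ennreal (L2 * \<delta> powr (2 * \<alpha>) * 2 * (1 / c)) = ?A * 2 * ennreal (1 / c)"
      using L(4) c_pos by (simp add: ennreal_mult del: times_divide_eq_right)
    moreover have "ennreal (4 * S * (real h / ((real M + 1) * c) + real h / ((real M + 1) * c)))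
        = ennreal (4 * S) * (ennreal (real h / ((real M + 1) * c)) + ennreal (real h / ((real M + 1) * c)))"
      using S0 c_pos by (subst ennreal_mult, simp, simp, subst ennreal_plus) simp_all
    ultimately show ?thesis
      using L(4) S0 c_pos by (subst ennreal_plus) auto
  qed
  also have "L2 * \<delta> powr (2 * \<alpha>) * 2 * (1 / c) = 2 * L2 / c powr (2 * \<alpha> + 1) * (2 * real h / (real M + 1)) powr (2 * \<alpha>)"
  proof -
    have d: "\<delta> = (2 * real h / (real M + 1)) / c" by (simp add: \<delta>_def)
    have "\<delta> powr (2 * \<alpha>) = (2 * real h / (real M + 1)) powr (2 * \<alpha>) / c powr (2 * \<alpha>)"
      unfolding d by (rule powr_divide)
    then show ?thesis using c_pos by (simp add: powr_add field_simps)
  qed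
  also have "4 * S * (real h / ((real M + 1) * c) + real h / ((real M + 1) * c)) = 8 * S / c * (real h / (real M + 1))"
    using c_pos by (simp add: field_simps)
  finally show ?thesis .
qed

end

section \<open>Orthonormal expansions\<close>

lemma integrable_mult_square_integrable:
  fixes f g :: "'a \<Rightarrow> real"
  assumes "f \<in> borel_measurable N" "g \<in> borel_measurable N"
    "integrable N (\<lambda>x. (f x)\<^sup>2)" "integrable N (\<lambda>x. (g x)\<^sup>2)"
  shows "integrable N (\<lambda>x. f x * g x)"
proof (rule Bochner_Integration.integrable_bound)
  show "integrable N (\<lambda>x. (f x)\<^sup>2 + (g x)\<^sup>2)" using assms by simp
  show "AE x in N. norm (f x * g x) \<le> norm ((f x)\<^sup>2 + (g x)\<^sup>2)"
  proof (rule AE_I2)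
    fix x
    have "2 * \<bar>f x\<bar> * \<bar>g x\<bar> \<le> (f x)\<^sup>2 + (g x)\<^sup>2"
      using sum_squares_bound[of "\<bar>f x\<bar>" "\<bar>g x\<bar>"] by simp
    moreover have "0 \<le> \<bar>f x\<bar> * \<bar>g x\<bar>" by simp
    ultimately show "norm (f x * g x) \<le> norm ((f x)\<^sup>2 + (g x)\<^sup>2)"
      unfolding real_norm_def abs_mult by linarith
  qed
  show "(\<lambda>x. f x * g x) \<in> borel_measurable N" using assms by simp
qed

context
  fixes N :: "'a measure" and \<phi> :: "nat \<Rightarrow> 'a \<Rightarrow> real"
  assumes ob: "orthonormal_basis_L2 N \<phi>"
begin

lemma basis_measurable: "1 \<le> k \<Longrightarrow> \<phi> k \<in> borel_measurable N"
  and basis_sq_integrable: "1 \<le> k \<Longrightarrow> integrable N (\<lambda>x. (\<phi> k x)\<^sup>2)"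
  and basis_orthonormal: "1 \<le> j \<Longrightarrow> 1 \<le> k \<Longrightarrow> (LINT x|N. \<phi> j x * \<phi> k x) = (if j = k then 1 else 0)"
  using ob by (auto simp: orthonormal_basis_L2_def)

text \<open>Pythagoras for arbitrary coefficients \<open>d\<close>. The choice \<open>d = c\<close>
  leads to Bessel and Parseval, estimated coefficients to the decomposition of the risk.\<close>

lemma L2_expansion:
  fixes f :: "'a \<Rightarrow> real"
  assumes f: "f \<in> borel_measurable N" "integrable N (\<lambda>x. (f x)\<^sup>2)"
  defines "c \<equiv> \<lambda>k. LINT x|N. f x * \<phi> k x"
  shows "integrable N (\<lambda>x. ((\<Sum>k=1..K. d k * \<phi> k x) - f x)\<^sup>2)" (is ?int)
    and "(LINT x|N. ((\<Sum>k=1..K. d k * \<phi> k x) - f x)\<^sup>2)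
      = (\<Sum>k=1..K. (d k - c k)\<^sup>2) + ((LINT x|N. (f x)\<^sup>2) - (\<Sum>k=1..K. (c k)\<^sup>2))" (is ?eq)
proof -
  have fp: "integrable N (\<lambda>x. f x * \<phi> k x)" if "1 \<le> k" for k
    using that by (intro integrable_mult_square_integrable f basis_measurable basis_sq_integrable)
  have pp: "integrable N (\<lambda>x. \<phi> j x * \<phi> k x)" if "1 \<le> j" "1 \<le> k" for j k
    using that by (intro integrable_mult_square_integrable basis_measurable basis_sq_integrable)
  have e: "((\<Sum>k=1..K. d k * \<phi> k x) - f x)\<^sup>2 = (\<Sum>j=1..K. \<Sum>k=1..K. (d j * d k) * (\<phi> j x * \<phi> k x))
      - 2 * (\<Sum>k=1..K. d k * (f x * \<phi> k x)) + (f x)\<^sup>2" for x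
    unfolding power2_diff by (simp add: power2_eq_square sum_product sum_distrib_left sum_distrib_right mult_ac)
  have i1: "integrable N (\<lambda>x. \<Sum>j=1..K. \<Sum>k=1..K. (d j * d k) * (\<phi> j x * \<phi> k x))"
    by (intro Bochner_Integration.integrable_sum integrable_mult_right pp) auto
  have i2: "integrable N (\<lambda>x. 2 * (\<Sum>k=1..K. d k * (f x * \<phi> k x)))"
    by (intro integrable_mult_right Bochner_Integration.integrable_sum fp) auto
  show ?int unfolding e using i1 i2 f(2) by simp
  have "(LINT x|N. ((\<Sum>k=1..K. d k * \<phi> k x) - f x)\<^sup>2)
      = (LINT x|N. (\<Sum>j=1..K. \<Sum>k=1..K. (d j * d k) * (\<phi> j x * \<phi> k x)))
        - (LINT x|N. 2 * (\<Sum>k=1..K. d k * (f x * \<phi> k x))) + (LINT x|N. (f x)\<^sup>2)"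
    unfolding e using i1 i2 f(2) by simp
  also have "(LINT x|N. (\<Sum>j=1..K. \<Sum>k=1..K. (d j * d k) * (\<phi> j x * \<phi> k x)))
      = (\<Sum>j=1..K. \<Sum>k=1..K. (d j * d k) * (if j = k then 1 else 0))"
  proof -
    have "(LINT x|N. (\<Sum>j=1..K. \<Sum>k=1..K. (d j * d k) * (\<phi> j x * \<phi> k x)))
        = (\<Sum>j=1..K. LINT x|N. (\<Sum>k=1..K. (d j * d k) * (\<phi> j x * \<phi> k x)))"
      by (intro Bochner_Integration.integral_sum Bochner_Integration.integrable_sum integrable_mult_right pp) auto
    also have "\<dots> = (\<Sum>j=1..K. \<Sum>k=1..K. LINT x|N. (d j * d k) * (\<phi> j x * \<phi> k x))"
      by (intro sum.cong refl Bochner_Integration.integral_sum integrable_mult_right pp) auto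
    also have "\<dots> = (\<Sum>j=1..K. \<Sum>k=1..K. (d j * d k) * (if j = k then 1 else 0))"
      by (intro sum.cong refl) (simp only: integral_mult_right_zero basis_orthonormal atLeastAtMost_iff)
    finally show ?thesis .
  qed
  also have "\<dots> = (\<Sum>j=1..K. (d j)\<^sup>2)"
  proof (rule sum.cong[OF refl])
    fix j assume j: "j \<in> {1..K}"
    have "(\<Sum>k=1..K. (d j * d k) * (if j = k then 1 else 0)) = (\<Sum>k=1..K. if j = k then d j * d k else 0)"
      by (intro sum.cong) auto
    also have "\<dots> = (d j)\<^sup>2" using j by (subst sum.delta') (auto simp: power2_eq_square)
    finally show "(\<Sum>k=1..K. (d j * d k) * (if j = k then 1 else 0)) = (d j)\<^sup>2" .
  qed
  also have "(LINT x|N. 2 * (\<Sum>k=1..K. d k * (f x * \<phi> k x))) = 2 * (\<Sum>k=1..K. d k * c k)"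
  proof -
    have "(LINT x|N. (\<Sum>k=1..K. d k * (f x * \<phi> k x))) = (\<Sum>k=1..K. LINT x|N. d k * (f x * \<phi> k x))"
      by (intro Bochner_Integration.integral_sum integrable_mult_right fp) auto
    then show ?thesis by (simp add: c_def)
  qed
  also have "(\<Sum>j=1..K. (d j)\<^sup>2) - 2 * (\<Sum>k=1..K. d k * c k) + (LINT x|N. (f x)\<^sup>2)
      = (\<Sum>k=1..K. (d k - c k)\<^sup>2) + ((LINT x|N. (f x)\<^sup>2) - (\<Sum>k=1..K. (c k)\<^sup>2))"
    by (simp add: power2_diff sum.distrib sum_subtractf sum_distrib_left mult_ac)
  finally show ?eq .
qed

lemma bessel_inequality:
  assumes f: "f \<in> borel_measurable N" "integrable N (\<lambda>x. (f x)\<^sup>2)"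
  shows "(\<Sum>k=1..K. (LINT x|N. f x * \<phi> k x)\<^sup>2) \<le> (LINT x|N. (f x)\<^sup>2)"
proof -
  have "0 \<le> (LINT x|N. ((\<Sum>k=1..K. (LINT x|N. f x * \<phi> k x) * \<phi> k x) - f x)\<^sup>2)"
    by (rule integral_nonneg_AE) simp
  then show ?thesis unfolding L2_expansion(2)[OF f] by simp
qed

lemma parseval:
  assumes f: "f \<in> borel_measurable N" "integrable N (\<lambda>x. (f x)\<^sup>2)"
  shows "(\<lambda>k. (LINT x|N. f x * \<phi> (Suc k) x)\<^sup>2) sums (LINT x|N. (f x)\<^sup>2)"
proof -
  let ?c = "\<lambda>k. LINT x|N. f x * \<phi> k x"
  have "L2_norm_sq N (\<lambda>x. f x - (\<Sum>k=1..K. ?c k * \<phi> k x)) = (LINT x|N. (f x)\<^sup>2) - (\<Sum>k=1..K. (?c k)\<^sup>2)" for K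
    using L2_expansion(2)[OF f, where K = K and d = ?c] by (simp add: L2_norm_sq_def power2_commute)
  moreover have "(\<lambda>K. L2_norm_sq N (\<lambda>x. f x - (\<Sum>k=1..K. ?c k * \<phi> k x))) \<longlonglongrightarrow> 0"
    using ob f by (auto simp: orthonormal_basis_L2_def)
  ultimately have "(\<lambda>K. (LINT x|N. (f x)\<^sup>2) - (\<Sum>k=1..K. (?c k)\<^sup>2)) \<longlonglongrightarrow> 0" by simp
  from tendsto_diff[OF tendsto_const[of "LINT x|N. (f x)\<^sup>2"] this]
  have "(\<lambda>K. \<Sum>k=1..K. (?c k)\<^sup>2) \<longlonglongrightarrow> (LINT x|N. (f x)\<^sup>2)" by simp
  moreover have "(\<Sum>k=1..K. (?c k)\<^sup>2) = (\<Sum>k<K. (?c (Suc k))\<^sup>2)" for K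
    by (rule sum.reindex_bij_witness[of _ Suc "\<lambda>k. k - 1"]) auto
  ultimately show ?thesis by (simp add: sums_def)
qed

end

lemma parseval_tail:
  assumes ob: "orthonormal_basis_L2 N \<phi>" and f: "f \<in> borel_measurable N" "integrable N (\<lambda>x. (f x)\<^sup>2)"
  shows "ennreal ((LINT x|N. (f x)\<^sup>2) - (\<Sum>k=1..K. (LINT x|N. f x * \<phi> k x)\<^sup>2))
    = (\<Sum>k. ennreal ((LINT x|N. f x * \<phi> (Suc (k + K)) x)\<^sup>2))"
proof -
  let ?c = "\<lambda>k. (LINT x|N. f x * \<phi> k x)\<^sup>2"
  have "(\<Sum>k=1..K. ?c k) = (\<Sum>k<K. ?c (Suc k))"
    by (rule sum.reindex_bij_witness[of _ Suc "\<lambda>k. k - 1"]) auto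
  then have "(\<lambda>k. ?c (Suc (k + K))) sums ((LINT x|N. (f x)\<^sup>2) - (\<Sum>k=1..K. ?c k))"
    using sums_split_initial_segment[OF parseval[OF ob f], of K] by simp
  then show ?thesis
    by (simp add: suminf_ennreal2 sums_iff)
qed

section \<open>Sections of the mean function and the truncation tail\<close>

lemma AE_section_square_integrable:
  fixes \<nu> :: "'u measure" and \<mu> :: "'u \<Rightarrow> real \<Rightarrow> real"
  assumes nu: "sigma_finite_measure \<nu>"
    and mu: "(\<lambda>(u, t). \<mu> u t) \<in> borel_measurable (\<nu> \<Otimes>\<^sub>M leb_on a b)"
      "integrable (\<nu> \<Otimes>\<^sub>M leb_on a b) (\<lambda>(u, t). (\<mu> u t)\<^sup>2)"
  shows "AE u in \<nu>. \<mu> u \<in> borel_measurable (leb_on a b) \<and> integrable (leb_on a b) (\<lambda>t. (\<mu> u t)\<^sup>2)"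
proof -
  interpret \<nu>: sigma_finite_measure \<nu> by (rule nu)
  interpret L: sigma_finite_measure "leb_on a b" by (rule sigma_finite_leb_on)
  interpret NL: pair_sigma_finite \<nu> "leb_on a b" ..
  have "AE u in \<nu>. integrable (leb_on a b) (\<lambda>t. (\<mu> u t)\<^sup>2)"
    using NL.AE_integrable_fst[OF mu(2)] by simp
  then show ?thesis
    using AE_space
  proof eventually_elim
    case (elim u)
    then show ?case using measurable_compose[OF measurable_Pair1' mu(1), of u] by simp
  qed
qed

lemma basis_coeff_measurable:
  assumes mu: "(\<lambda>(u, t). \<mu> u t) \<in> borel_measurable (\<nu> \<Otimes>\<^sub>M leb_on a b)"
    and \<phi>: "\<phi> k \<in> borel_measurable (leb_on a b)"
  shows "basis_coeff a b \<phi> \<mu> k \<in> borel_measurable \<nu>"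
proof -
  interpret L: sigma_finite_measure "leb_on a b" by (rule sigma_finite_leb_on)
  have "(\<lambda>(u, t). \<mu> u t * \<phi> k t) \<in> borel_measurable (\<nu> \<Otimes>\<^sub>M leb_on a b)"
    using mu \<phi> by (simp add: case_prod_beta')
  from L.borel_measurable_lebesgue_integral[OF this] show ?thesis
    by (simp add: basis_coeff_def[abs_def])
qed

text \<open>Parseval is applied for almost every \<open>u\<close> and then integrated. Each omitted
  index k is at least \<open>Suc K0\<close> and so exceeds the real level \<open>K\<close>, whence 1
  \<le> K^(-2s) k^(2s) may be inserted in front of its term.\<close>

lemma truncation_tail:
  fixes \<nu> :: "'u measure" and \<mu> :: "'u \<Rightarrow> real \<Rightarrow> real"
  assumes nu: "sigma_finite_measure \<nu>" and ob: "orthonormal_basis_L2 (leb_on a b) \<phi>"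
    and mu: "(\<lambda>(u, t). \<mu> u t) \<in> borel_measurable (\<nu> \<Otimes>\<^sub>M leb_on a b)"
      "integrable (\<nu> \<Otimes>\<^sub>M leb_on a b) (\<lambda>(u, t). (\<mu> u t)\<^sup>2)"
    and s: "0 < s"
    and sm: "summable (\<lambda>k. real (Suc k) powr (2 * s) * L2_norm_sq \<nu> (basis_coeff a b \<phi> \<mu> (Suc k)))"
      "(\<Sum>k. real (Suc k) powr (2 * s) * L2_norm_sq \<nu> (basis_coeff a b \<phi> \<mu> (Suc k))) \<le> Cs"
    and K: "0 < K" "K < real (Suc K0)"
  shows "(\<integral>\<^sup>+u. ennreal ((LINT t|leb_on a b. (\<mu> u t)\<^sup>2) - (\<Sum>k=1..K0. (basis_coeff a b \<phi> \<mu> k u)\<^sup>2)) \<partial>\<nu>)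
      \<le> ennreal (Cs * K powr (- 2 * s))"
proof -
  let ?lam = "leb_on a b" and ?\<beta> = "basis_coeff a b \<phi> \<mu>"
  interpret \<nu>: sigma_finite_measure \<nu> by (rule nu)
  interpret L: sigma_finite_measure ?lam by (rule sigma_finite_leb_on)
  interpret NL: pair_sigma_finite \<nu> ?lam ..
  note good = AE_section_square_integrable[OF nu mu]
  have \<beta>_meas: "?\<beta> k \<in> borel_measurable \<nu>" if "1 \<le> k" for k
    using basis_coeff_measurable[where \<mu> = \<mu> and \<phi> = \<phi>] mu(1) basis_measurable[OF ob that] by blast
  \<comment> \<open>\<open>L2_norm_sq\<close> would take the default value 0 on a square that is not
    integrable. Bessel's inequality against the norm of the section rules this out.\<close>
  have \<beta>_int: "integrable \<nu> (\<lambda>u. (?\<beta> k u)\<^sup>2)" if k: "1 \<le> k" for k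
  proof (rule Bochner_Integration.integrable_bound)
    show "integrable \<nu> (\<lambda>u. LINT t|?lam. (\<mu> u t)\<^sup>2)"
      using NL.integrable_fst'[OF mu(2)] by simp
    show "(\<lambda>u. (?\<beta> k u)\<^sup>2) \<in> borel_measurable \<nu>" using \<beta>_meas[OF k] by simp
    show "AE u in \<nu>. norm ((?\<beta> k u)\<^sup>2) \<le> norm (LINT t|?lam. (\<mu> u t)\<^sup>2)"
      using good
    proof eventually_elim
      case (elim u)
      have "(?\<beta> k u)\<^sup>2 \<le> (\<Sum>j=1..k. (?\<beta> j u)\<^sup>2)"
        using k by (intro member_le_sum) auto
      also have "\<dots> \<le> (LINT t|?lam. (\<mu> u t)\<^sup>2)"
        using bessel_inequality[OF ob, of "\<mu> u" k] elim by (simp add: basis_coeff_def)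
      finally show ?case by simp
    qed
  qed
  have nn: "(\<integral>\<^sup>+u. ennreal ((?\<beta> k u)\<^sup>2) \<partial>\<nu>) = ennreal (L2_norm_sq \<nu> (?\<beta> k))" if "1 \<le> k" for k
    using \<beta>_int[OF that] by (subst nn_integral_eq_integral) (auto simp: L2_norm_sq_def)
  have n0: "0 \<le> L2_norm_sq \<nu> f" for f
    unfolding L2_norm_sq_def by (rule integral_nonneg_AE) simp
  have "(\<integral>\<^sup>+u. ennreal ((LINT t|?lam. (\<mu> u t)\<^sup>2) - (\<Sum>k=1..K0. (?\<beta> k u)\<^sup>2)) \<partial>\<nu>)
      = (\<integral>\<^sup>+u. (\<Sum>k. ennreal ((?\<beta> (Suc (k + K0)) u)\<^sup>2)) \<partial>\<nu>)"
  proof (rule nn_integral_cong_AE)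
    show "AE u in \<nu>. ennreal ((LINT t|?lam. (\<mu> u t)\<^sup>2) - (\<Sum>k=1..K0. (?\<beta> k u)\<^sup>2)) =
        (\<Sum>k. ennreal ((?\<beta> (Suc (k + K0)) u)\<^sup>2))"
      using good
    proof eventually_elim
      case (elim u)
      then show ?case unfolding basis_coeff_def by (intro parseval_tail[OF ob]) auto
    qed
  qed
  also have "\<dots> = (\<Sum>k. \<integral>\<^sup>+u. ennreal ((?\<beta> (Suc (k + K0)) u)\<^sup>2) \<partial>\<nu>)"
    using \<beta>_meas by (intro nn_integral_suminf) simp
  also have "\<dots> = (\<Sum>k. ennreal (L2_norm_sq \<nu> (?\<beta> (Suc (k + K0)))))"
    by (simp add: nn)
  also have "\<dots> \<le> (\<Sum>k. ennreal (K powr (- 2 * s) * (real (Suc (k + K0)) powr (2 * s) * L2_norm_sq \<nu> (?\<beta> (Suc (k + K0))))))"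
  proof (intro suminf_le ennreal_leI)
    fix k
    have "K powr (2 * s) \<le> real (Suc (k + K0)) powr (2 * s)"
      using K s by (intro powr_mono2) auto
    then have "1 \<le> K powr (- 2 * s) * real (Suc (k + K0)) powr (2 * s)"
      using K by (simp add: powr_minus field_simps)
    from mult_right_mono[OF this n0]
    show "L2_norm_sq \<nu> (?\<beta> (Suc (k + K0))) \<le> K powr (- 2 * s) * (real (Suc (k + K0)) powr (2 * s) * L2_norm_sq \<nu> (?\<beta> (Suc (k + K0))))"
      by (simp add: mult.assoc)
  qed auto
  also have "\<dots> = ennreal (\<Sum>k. K powr (- 2 * s) * (real (Suc (k + K0)) powr (2 * s) * L2_norm_sq \<nu> (?\<beta> (Suc (k + K0)))))"
    using summable_ignore_initial_segment[OF sm(1), of K0] n0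
    by (intro suminf_ennreal2 mult_nonneg_nonneg summable_mult) auto
  also have "\<dots> = ennreal (K powr (- 2 * s) * (\<Sum>k. real (Suc (k + K0)) powr (2 * s) * L2_norm_sq \<nu> (?\<beta> (Suc (k + K0)))))"
    using summable_ignore_initial_segment[OF sm(1), of K0] by (subst suminf_mult) auto
  also have "\<dots> \<le> ennreal (K powr (- 2 * s) * Cs)"
  proof (intro ennreal_leI mult_left_mono)
    have "(\<Sum>k. real (Suc (k + K0)) powr (2 * s) * L2_norm_sq \<nu> (?\<beta> (Suc (k + K0))))
        \<le> (\<Sum>k. real (Suc k) powr (2 * s) * L2_norm_sq \<nu> (?\<beta> (Suc k)))"
      unfolding suminf_minus_initial_segment[OF sm(1), of K0] using n0
      by (simp add: sum_nonneg)
    then show "(\<Sum>k. real (Suc (k + K0)) powr (2 * s) * L2_norm_sq \<nu> (?\<beta> (Suc (k + K0)))) \<le> Cs"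
      using sm(2) by linarith
  qed simp
  finally show "(\<integral>\<^sup>+u. ennreal ((LINT t|?lam. (\<mu> u t)\<^sup>2) - (\<Sum>k=1..K0. (?\<beta> k u)\<^sup>2)) \<partial>\<nu>)
      \<le> ennreal (Cs * K powr (- 2 * s))" by (simp add: mult.commute)
qed

section \<open>Conditioning on the visit times\<close>

context prob_space
begin

text \<open>Conditioning without conditional expectations. \<open>A\<close> and \<open>B\<close> are
  the same space with coarser sigma-algebras; their independence says that the diagonal map has a
  product law, so the second argument of \<open>f\<close> may be drawn independently of the
  first.\<close>

lemma nn_integral_diagonal_indep:
  assumes A: "space A = space M" "sets A \<subseteq> sets M" and B: "space B = space M" "sets B \<subseteq> sets M"
    and ind: "indep_set (sets A) (sets B)" and f: "f \<in> borel_measurable (A \<Otimes>\<^sub>M B)"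
  shows "(\<integral>\<^sup>+\<omega>. f (\<omega>, \<omega>) \<partial>M) = (\<integral>\<^sup>+\<omega>. \<integral>\<^sup>+\<omega>'. f (\<omega>, \<omega>') \<partial>M \<partial>M)"
proof -
  have idA: "(\<lambda>x. x) \<in> measurable M A" and idB: "(\<lambda>x. x) \<in> measurable M B"
    using A B by (auto simp: measurable_def sets.Int_space_eq2)
  have gen: "sigma_sets (space M) {(\<lambda>x. x) -` S \<inter> space M | S. S \<in> sets C} = sets C"
    if "space C = space M" for C
  proof -
    have "{(\<lambda>x. x) -` S \<inter> space M | S. S \<in> sets C} = sets C"
      using that sets.sets_into_space[of _ C] by (fastforce simp: Int_absorb2)
    then show ?thesis using sets.sigma_sets_eq[of C] that by simp
  qed
  have "indep_var A (\<lambda>x. x) B (\<lambda>x. x)"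
    unfolding indep_var_eq gen[OF A(1)] gen[OF B(1)] using idA idB ind by blast
  then have d: "distr M A (\<lambda>x. x) \<Otimes>\<^sub>M distr M B (\<lambda>x. x) = distr M (A \<Otimes>\<^sub>M B) (\<lambda>x. (x, x))"
    unfolding indep_var_distribution_eq by blast
  interpret DB: prob_space "distr M B (\<lambda>x. x)" by (rule prob_space_distr[OF idB])
  have f': "f \<in> borel_measurable (distr M A (\<lambda>x. x) \<Otimes>\<^sub>M distr M B (\<lambda>x. x))"
    using f by (simp cong: measurable_cong_sets)
  have "(\<integral>\<^sup>+\<omega>. f (\<omega>, \<omega>) \<partial>M) = (\<integral>\<^sup>+p. f p \<partial>distr M (A \<Otimes>\<^sub>M B) (\<lambda>x. (x, x)))"
    using f idA idB by (subst nn_integral_distr) auto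
  also have "\<dots> = (\<integral>\<^sup>+x. \<integral>\<^sup>+y. f (x, y) \<partial>distr M B (\<lambda>x. x) \<partial>distr M A (\<lambda>x. x))"
    unfolding d[symmetric] by (rule DB.nn_integral_fst[symmetric, OF f'])
  also have "\<dots> = (\<integral>\<^sup>+\<omega>. \<integral>\<^sup>+y. f (\<omega>, y) \<partial>distr M B (\<lambda>x. x) \<partial>M)"
    using DB.borel_measurable_nn_integral_fst[OF f'] idA by (subst nn_integral_distr) auto
  also have "\<dots> = (\<integral>\<^sup>+\<omega>. \<integral>\<^sup>+\<omega>'. f (\<omega>, \<omega>') \<partial>M \<partial>M)"
  proof (rule nn_integral_cong)
    fix \<omega> assume "\<omega> \<in> space M"
    then have "(\<lambda>y. f (\<omega>, y)) \<in> borel_measurable B"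
      using A f by (intro measurable_compose[OF measurable_Pair1' f]) auto
    then show "(\<integral>\<^sup>+y. f (\<omega>, y) \<partial>distr M B (\<lambda>x. x)) = (\<integral>\<^sup>+\<omega>'. f (\<omega>, \<omega>') \<partial>M)"
      using idB by (subst nn_integral_distr) auto
  qed
  finally show ?thesis .
qed

lemma indep_vars_pair:
  assumes "indep_vars (\<lambda>_. S) X I" "i \<in> I" "j \<in> I" "i \<noteq> j"
  shows "indep_var S (X i) S (X j)"
  unfolding indep_var_eq
proof (intro conjI indep_setI)
  let ?F = "\<lambda>i. sigma_sets (space M) {X i -` A \<inter> space M | A. A \<in> sets S}"
  have F: "indep_sets ?F I" using assms by (simp add: indep_vars_def)
  show "random_variable S (X i)" "random_variable S (X j)"
    using assms by (auto simp: indep_vars_def)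
  show "?F i \<subseteq> events" "?F j \<subseteq> events"
    using F assms by (auto simp: indep_sets_def)
  fix p q assume p: "p \<in> ?F i" "q \<in> ?F j"
  have "prob (\<Inter>k\<in>{i, j}. if k = i then p else q) = (\<Prod>k\<in>{i, j}. prob (if k = i then p else q))"
    using assms p by (intro indep_setsD[OF F]) auto
  then show "prob (p \<inter> q) = prob p * prob q" using assms(4) by (auto simp: Int_commute)
qed

lemma indep_var_product_zero:
  assumes "indep_var S U S' W" "f \<in> borel_measurable S" "f' \<in> borel_measurable S'"
    "integrable M (\<lambda>\<omega>. f (U \<omega>))" "integrable M (\<lambda>\<omega>. f' (W \<omega>))" "(LINT \<omega>|M. f (U \<omega>)) = 0"
  shows "(LINT \<omega>|M. f (U \<omega>) * f' (W \<omega>)) = (0::real)"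
proof -
  have "indep_var borel (\<lambda>\<omega>. f (U \<omega>)) borel (\<lambda>\<omega>. f' (W \<omega>))"
    using indep_var_compose[OF assms(1,2,3)] by (simp add: o_def)
  from indep_var_lebesgue_integral[OF this assms(4,5)] show ?thesis using assms(6) by simp
qed

text \<open>The shift \<open>d\<close> will be the bias, a constant once the visit times are fixed;
  its mixed terms vanish because the summands are centred.\<close>

lemma nn_integral_orthogonal_sum:
  fixes Z :: "'i \<Rightarrow> 'a \<Rightarrow> real"
  assumes I: "finite I" and m: "\<And>i. i \<in> I \<Longrightarrow> Z i \<in> borel_measurable M"
    and sq: "\<And>i. i \<in> I \<Longrightarrow> integrable M (\<lambda>\<omega>. (Z i \<omega>)\<^sup>2)"
    and zero: "\<And>i. i \<in> I \<Longrightarrow> (LINT \<omega>|M. Z i \<omega>) = 0"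
    and orth: "\<And>i j. i \<in> I \<Longrightarrow> j \<in> I \<Longrightarrow> i \<noteq> j \<Longrightarrow> (LINT \<omega>|M. Z i \<omega> * Z j \<omega>) = 0"
  shows "(\<integral>\<^sup>+\<omega>. ennreal ((d + (\<Sum>i\<in>I. Z i \<omega>))\<^sup>2) \<partial>M) = ennreal (d\<^sup>2) + (\<Sum>i\<in>I. \<integral>\<^sup>+\<omega>. ennreal ((Z i \<omega>)\<^sup>2) \<partial>M)"
proof -
  have prod: "integrable M (\<lambda>\<omega>. Z i \<omega> * Z j \<omega>)" if "i \<in> I" "j \<in> I" for i j
    using m sq that by (intro integrable_mult_square_integrable) auto
  have int: "integrable M (Z i)" if "i \<in> I" for i
    using square_integrable_imp_integrable[OF m[OF that] sq[OF that]] .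
  have eq: "(d + (\<Sum>i\<in>I. Z i \<omega>))\<^sup>2 = d\<^sup>2 + 2 * d * (\<Sum>i\<in>I. Z i \<omega>) + (\<Sum>i\<in>I. \<Sum>j\<in>I. Z i \<omega> * Z j \<omega>)" for \<omega>
    by (simp add: power2_sum sum_product power2_eq_square algebra_simps)
  have I2: "integrable M (\<lambda>\<omega>. (d + (\<Sum>i\<in>I. Z i \<omega>))\<^sup>2)"
    unfolding eq using int prod by simp
  have "(LINT \<omega>|M. (d + (\<Sum>i\<in>I. Z i \<omega>))\<^sup>2)
      = d\<^sup>2 + 2 * d * (\<Sum>i\<in>I. LINT \<omega>|M. Z i \<omega>) + (\<Sum>i\<in>I. \<Sum>j\<in>I. LINT \<omega>|M. Z i \<omega> * Z j \<omega>)"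
    unfolding eq using int prod by (simp add: prob_space)
  also have "(\<Sum>i\<in>I. \<Sum>j\<in>I. LINT \<omega>|M. Z i \<omega> * Z j \<omega>) = (\<Sum>i\<in>I. LINT \<omega>|M. (Z i \<omega>)\<^sup>2)"
  proof (rule sum.cong[OF refl])
    fix i assume i: "i \<in> I"
    have "(\<Sum>j\<in>I. LINT \<omega>|M. Z i \<omega> * Z j \<omega>) = (\<Sum>j\<in>{i}. LINT \<omega>|M. Z i \<omega> * Z j \<omega>)"
      using I i orth[OF i] by (intro sum.mono_neutral_right) auto
    then show "(\<Sum>j\<in>I. LINT \<omega>|M. Z i \<omega> * Z j \<omega>) = (LINT \<omega>|M. (Z i \<omega>)\<^sup>2)"
      by (simp add: power2_eq_square)
  qed
  finally have "(LINT \<omega>|M. (d + (\<Sum>i\<in>I. Z i \<omega>))\<^sup>2) = d\<^sup>2 + (\<Sum>i\<in>I. LINT \<omega>|M. (Z i \<omega>)\<^sup>2)"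
    using zero by simp
  then have "(\<integral>\<^sup>+\<omega>. ennreal ((d + (\<Sum>i\<in>I. Z i \<omega>))\<^sup>2) \<partial>M) = ennreal (d\<^sup>2 + (\<Sum>i\<in>I. LINT \<omega>|M. (Z i \<omega>)\<^sup>2))"
    using I2 by (subst nn_integral_eq_integral) auto
  also have "\<dots> = ennreal (d\<^sup>2) + (\<Sum>i\<in>I. ennreal (LINT \<omega>|M. (Z i \<omega>)\<^sup>2))"
    by (subst ennreal_plus) (auto intro!: sum_nonneg simp: sum_ennreal)
  also have "\<dots> = ennreal (d\<^sup>2) + (\<Sum>i\<in>I. \<integral>\<^sup>+\<omega>. ennreal ((Z i \<omega>)\<^sup>2) \<partial>M)"
    using sq by (simp add: nn_integral_eq_integral)
  finally show ?thesis .
qed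

end

text \<open>\<open>\<Gamma>\<close> and \<open>\<tau>max\<close> stand for the two sup norms of the
  bound. \<open>X_cov\<close> holds at almost every time only, since a finite total second moment
  gives no control at an individual time.\<close>

locale sample = ranked_times P a b c g n m T
  for P :: "'w measure" and a b c g n m and T :: "nat \<Rightarrow> nat \<Rightarrow> 'w \<Rightarrow> real" +
  fixes Q :: "'x measure" and E :: "'e measure" and \<nu> :: "'u measure"
    and X :: "'x \<Rightarrow> 'u \<Rightarrow> real \<Rightarrow> real" and \<eta> :: "'e \<Rightarrow> 'u \<Rightarrow> real" and \<tau> :: "real \<Rightarrow> real"
    and \<xi> :: "nat \<Rightarrow> 'w \<Rightarrow> 'x" and \<zeta> :: "nat \<Rightarrow> nat \<Rightarrow> 'w \<Rightarrow> 'e"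
    and mmax :: nat and \<Gamma> \<tau>max :: real
  assumes nu: "finite_measure \<nu>" and Q: "prob_space Q"
    and ind_\<xi>: "indep_vars (\<lambda>_. Q) \<xi> {1..n}"
    and dist_\<xi>: "\<And>i. i \<in> {1..n} \<Longrightarrow> distr P Q (\<xi> i) = Q"
    and ind_\<zeta>: "indep_vars (\<lambda>_. E) (\<lambda>(i, j). \<zeta> i j) (visit_set n m)"
    and dist_\<zeta>: "\<And>v. v \<in> visit_set n m \<Longrightarrow> distr P E ((\<lambda>(i, j). \<zeta> i j) v) = E"
    and ind3: "indep_sets
       (\<lambda>c. [generated_sigma P Q \<xi> {1..n},
             generated_sigma P (leb_on a b) (\<lambda>(i, j). T i j) (visit_set n m),
             generated_sigma P E (\<lambda>(i, j). \<zeta> i j) (visit_set n m)] ! c) {..<3::nat}"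
    and X_meas: "(\<lambda>(x, u, t). X x u t) \<in> borel_measurable (Q \<Otimes>\<^sub>M (\<nu> \<Otimes>\<^sub>M leb_on a b))"
    and X_int: "\<And>u t. t \<in> {a..b} \<Longrightarrow> integrable Q (\<lambda>x. X x u t)"
    and X_zero: "\<And>u t. t \<in> {a..b} \<Longrightarrow> (LINT x|Q. X x u t) = 0"
    and X_cov: "AE t in leb_on a b. (\<integral>\<^sup>+u. \<integral>\<^sup>+x. ennreal ((X x u t)\<^sup>2) \<partial>Q \<partial>\<nu>) \<le> ennreal \<Gamma>"
    and \<eta>_meas: "(\<lambda>(e, u). \<eta> e u) \<in> borel_measurable (E \<Otimes>\<^sub>M \<nu>)"
    and \<eta>_int: "\<And>u. integrable E (\<lambda>e. \<eta> e u)"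
    and \<eta>_zero: "\<And>u. (LINT e|E. \<eta> e u) = 0"
    and \<eta>_sq: "\<And>u. integrable E (\<lambda>e. (\<eta> e u)\<^sup>2)" "\<And>u. (LINT e|E. (\<eta> e u)\<^sup>2) = 1"
    and \<tau>_meas: "\<tau> \<in> borel_measurable (leb_on a b)"
    and \<tau>_le: "\<And>t. t \<in> {a..b} \<Longrightarrow> \<bar>\<tau> t\<bar> \<le> \<tau>max"
    and \<Gamma>_nonneg: "0 \<le> \<Gamma>"
    and m_le: "\<And>i. i \<in> {1..n} \<Longrightarrow> m i \<le> mmax"
begin

text \<open>Measurability with respect to \<open>PT\<close> expresses dependence on the outcome
  through the visit times alone; \<open>PN\<close> does the same for fields and errors.\<close>

definition PT :: "'w measure" where
  "PT = sigma (space P) (generated_sigma P lam (\<lambda>(i, j). T i j) (visit_set n m))"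

definition PN :: "'w measure" where
  "PN = sigma (space P) (generated_sigma P Q \<xi> {1..n} \<union> generated_sigma P E (\<lambda>(i, j). \<zeta> i j) (visit_set n m))"

lemma \<xi>_meas: "i \<in> {1..n} \<Longrightarrow> \<xi> i \<in> measurable P Q"
  using ind_\<xi> by (auto simp: indep_vars_def)

lemma \<zeta>_meas: "v \<in> visit_set n m \<Longrightarrow> (\<lambda>(i, j). \<zeta> i j) v \<in> measurable P E"
  using ind_\<zeta> by (auto simp: indep_vars_def)

lemma generated_sigma_events:
  assumes "\<And>i. i \<in> I \<Longrightarrow> Z i \<in> measurable P S"
  shows "generated_sigma P S Z I \<subseteq> sets P"
  unfolding generated_sigma_def using assms by (intro sets.sigma_sets_subset) (auto intro: measurable_sets)

lemma generated_sigma_measurable: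
  assumes "i \<in> I" "\<And>i. i \<in> I \<Longrightarrow> Z i \<in> measurable P S" "generated_sigma P S Z I \<subseteq> G" "G \<subseteq> Pow (space P)"
  shows "Z i \<in> measurable (sigma (space P) G) S"
proof (rule measurableI)
  fix \<omega> assume "\<omega> \<in> space (sigma (space P) G)"
  then show "Z i \<omega> \<in> space S"
    using assms(4) measurable_space[OF assms(2)[OF assms(1)]] by (simp add: space_measure_of)
next
  fix A assume "A \<in> sets S"
  then have "Z i -` A \<inter> space P \<in> generated_sigma P S Z I"
    unfolding generated_sigma_def using assms(1) by (intro sigma_sets.Basic) auto
  then show "Z i -` A \<inter> space (sigma (space P) G) \<in> sets (sigma (space P) G)"
    using assms(3,4) by (auto simp: space_measure_of)
qed

lemma gen_subsets:
  "generated_sigma P Q \<xi> {1..n} \<subseteq> sets P"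
  "generated_sigma P lam (\<lambda>(i, j). T i j) (visit_set n m) \<subseteq> sets P"
  "generated_sigma P E (\<lambda>(i, j). \<zeta> i j) (visit_set n m) \<subseteq> sets P"
  by (intro generated_sigma_events \<xi>_meas \<zeta>_meas T_meas; assumption)+

lemma gen_Pow:
  "generated_sigma P Q \<xi> {1..n} \<subseteq> Pow (space P)"
  "generated_sigma P lam (\<lambda>(i, j). T i j) (visit_set n m) \<subseteq> Pow (space P)"
  "generated_sigma P E (\<lambda>(i, j). \<zeta> i j) (visit_set n m) \<subseteq> Pow (space P)"
  using gen_subsets sets.space_closed[of P] by blast+

lemma space_PT [simp]: "space PT = space P" and space_PN [simp]: "space PN = space P"
  using gen_Pow by (simp_all add: PT_def PN_def space_measure_of)

lemma sets_PT_PN: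
  "sets PT = sigma_sets (space P) (generated_sigma P lam (\<lambda>(i, j). T i j) (visit_set n m))"
  "sets PN = sigma_sets (space P) (generated_sigma P Q \<xi> {1..n} \<union> generated_sigma P E (\<lambda>(i, j). \<zeta> i j) (visit_set n m))"
  using gen_Pow by (simp_all add: PT_def PN_def sets_measure_of)

lemma sets_PT_PN_subset: "sets PT \<subseteq> sets P" "sets PN \<subseteq> sets P"
  unfolding sets_PT_PN using gen_subsets by (auto intro!: sets.sigma_sets_subset)

lemma T_PT: "v \<in> visit_set n m \<Longrightarrow> (\<lambda>(i, j). T i j) v \<in> measurable PT lam"
  unfolding PT_def using gen_Pow T_meas by (intro generated_sigma_measurable[of _ "visit_set n m"]) auto

lemma \<xi>_PN: "i \<in> {1..n} \<Longrightarrow> \<xi> i \<in> measurable PN Q"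
  unfolding PN_def using gen_Pow \<xi>_meas by (intro generated_sigma_measurable[of _ "{1..n}"]) auto

lemma \<zeta>_PN: "v \<in> visit_set n m \<Longrightarrow> (\<lambda>(i, j). \<zeta> i j) v \<in> measurable PN E"
  unfolding PN_def using gen_Pow \<zeta>_meas by (intro generated_sigma_measurable[of _ "visit_set n m"]) auto

text \<open>Of three mutually independent sigma-algebras, the first and the third together generate
  one that is independent of the second.\<close>

lemma indep_PT_PN: "indep_set (sets PT) (sets PN)"
proof -
  let ?G = "\<lambda>c. [generated_sigma P Q \<xi> {1..n},
             generated_sigma P lam (\<lambda>(i, j). T i j) (visit_set n m),
             generated_sigma P E (\<lambda>(i, j). \<zeta> i j) (visit_set n m)] ! c"
  \<comment> \<open>\<open>True\<close> marks the block of the visit times, \<open>False\<close> the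
    block of fields and errors.\<close>
  let ?I = "\<lambda>j. if j then {1} else {0, 2::nat}"
  have stable: "Int_stable (generated_sigma P S Z I)" if "generated_sigma P S Z I \<subseteq> Pow (space P)"
    for S :: "'b measure" and Z :: "'i \<Rightarrow> 'w \<Rightarrow> 'b" and I
  proof -
    have "sigma_algebra (space P) (generated_sigma P S Z I)"
      unfolding generated_sigma_def by (rule sigma_algebra_sigma_sets) auto
    then interpret sigma_algebra "space P" "generated_sigma P S Z I" .
    show ?thesis by (auto simp: Int_stable_def)
  qed
  have "(\<Union>j\<in>UNIV. ?I j) = {..<3::nat}" by (auto simp: UNIV_bool)
  then have "indep_sets ?G (\<Union>j\<in>UNIV. ?I j)" using ind3 by simp
  moreover have "Int_stable (?G i)" if "i \<in> ?I j" for i j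
    using that gen_Pow by (auto split: if_splits intro!: stable)
  moreover have "disjoint_family_on ?I UNIV" by (auto simp: disjoint_family_on_def)
  ultimately have "indep_sets (\<lambda>j. sigma_sets (space P) (\<Union>i\<in>?I j. ?G i)) UNIV"
    by (intro indep_sets_collect_sigma)
  moreover have "(\<lambda>j. sigma_sets (space P) (\<Union>i\<in>?I j. ?G i)) = case_bool (sets PT) (sets PN)"
    by (auto simp: fun_eq_iff sets_PT_PN split: bool.split)
  ultimately show ?thesis by (simp add: indep_set_def)
qed

lemma indep_\<xi>_\<zeta>:
  fixes f :: "'x \<Rightarrow> real" and f' :: "'e \<Rightarrow> real"
  assumes i: "i \<in> {1..n}" and v: "v \<in> visit_set n m"
    and f: "f \<in> borel_measurable Q" and f': "f' \<in> borel_measurable E"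
  shows "indep_var borel (\<lambda>\<omega>. f (\<xi> i \<omega>)) borel (\<lambda>\<omega>. f' ((\<lambda>(i, j). \<zeta> i j) v \<omega>))"
  unfolding indep_var_eq
proof (intro conjI indep_setI)
  let ?z = "(\<lambda>(i, j). \<zeta> i j) v"
  let ?p = "sigma_sets (space P) {(\<lambda>\<omega>. f (\<xi> i \<omega>)) -` A \<inter> space P |A. A \<in> sets borel}"
  let ?q = "sigma_sets (space P) {(\<lambda>\<omega>. f' (?z \<omega>)) -` A \<inter> space P |A. A \<in> sets borel}"
  show rv: "random_variable borel (\<lambda>\<omega>. f (\<xi> i \<omega>))" "random_variable borel (\<lambda>\<omega>. f' (?z \<omega>))"
    using measurable_compose[OF \<xi>_meas[OF i] f] measurable_compose[OF \<zeta>_meas[OF v] f'] .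
  have "{(\<lambda>\<omega>. f (\<xi> i \<omega>)) -` A \<inter> space P |A. A \<in> sets borel} \<subseteq> {\<xi> i -` A \<inter> space P |A. A \<in> sets Q}"
  proof safe
    fix A :: "real set" assume "A \<in> sets borel"
    then show "\<exists>B. (\<lambda>\<omega>. f (\<xi> i \<omega>)) -` A \<inter> space P = \<xi> i -` B \<inter> space P \<and> B \<in> sets Q"
      using measurable_space[OF \<xi>_meas[OF i]]
      by (intro exI[of _ "f -` A \<inter> space Q"] conjI measurable_sets[OF f]) auto
  qed
  then have p: "?p \<subseteq> generated_sigma P Q \<xi> {1..n}"
    unfolding generated_sigma_def by (rule sigma_sets_mono'[OF order_trans]) (use i in blast)
  have "{(\<lambda>\<omega>. f' (?z \<omega>)) -` A \<inter> space P |A. A \<in> sets borel} \<subseteq> {?z -` A \<inter> space P |A. A \<in> sets E}"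
  proof safe
    fix A :: "real set" assume "A \<in> sets borel"
    then show "\<exists>B. (\<lambda>\<omega>. f' (?z \<omega>)) -` A \<inter> space P = ?z -` B \<inter> space P \<and> B \<in> sets E"
      using measurable_space[OF \<zeta>_meas[OF v]]
      by (intro exI[of _ "f' -` A \<inter> space E"] conjI measurable_sets[OF f']) auto
  qed
  then have q: "?q \<subseteq> generated_sigma P E (\<lambda>(i, j). \<zeta> i j) (visit_set n m)"
    unfolding generated_sigma_def by (rule sigma_sets_mono'[OF order_trans]) (use v in blast)
  show "?p \<subseteq> events" "?q \<subseteq> events" using gen_subsets p q by blast+
  fix A B assume AB: "A \<in> ?p" "B \<in> ?q"
  have "prob (\<Inter>k\<in>{0, 2::nat}. if k = 0 then A else B) = (\<Prod>k\<in>{0, 2::nat}. prob (if k = 0 then A else B))"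
    using AB p q by (intro indep_setsD[OF ind3]) auto
  then show "prob (A \<inter> B) = prob A * prob B" by (auto simp: Int_commute)
qed

section \<open>Second moment of the noise at fixed visit times\<close>

abbreviation "V \<equiv> visit_set n m"
abbreviation "Tv v \<equiv> (\<lambda>(i, j). T i j) v"
abbreviation "Zv v \<equiv> (\<lambda>(i, j). \<zeta> i j) v"

text \<open>The outcomes are kept apart: \<omega> supplies the visit times, \<omega>' the fields and
  errors. The noise of the actual sample is the value on the diagonal.\<close>

definition noise :: "(nat \<times> nat \<Rightarrow> real) \<Rightarrow> 'w \<Rightarrow> 'w \<Rightarrow> 'u \<Rightarrow> real" where
  "noise w \<omega> \<omega>' u = (\<Sum>v\<in>V. w v * (X (\<xi> (fst v) \<omega>') u (Tv v \<omega>) + \<tau> (Tv v \<omega>) * \<eta> (Zv v \<omega>') u))"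

lemma fst_V: "v \<in> V \<Longrightarrow> fst v \<in> {1..n}"
  by (auto simp: visit_set_def)

lemma \<xi>_nn_integral: "i \<in> {1..n} \<Longrightarrow> f \<in> borel_measurable Q \<Longrightarrow> (\<integral>\<^sup>+\<omega>. f (\<xi> i \<omega>) \<partial>P) = (\<integral>\<^sup>+x. f x \<partial>Q)"
  using nn_integral_distr[OF \<xi>_meas, of i f] dist_\<xi>[of i] by simp

lemma \<zeta>_nn_integral: "v \<in> V \<Longrightarrow> f \<in> borel_measurable E \<Longrightarrow> (\<integral>\<^sup>+\<omega>. f (Zv v \<omega>) \<partial>P) = (\<integral>\<^sup>+e. f e \<partial>E)"
  using nn_integral_distr[OF \<zeta>_meas, of v f] dist_\<zeta>[of v] by simp

lemma \<xi>_integral: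
  fixes f :: "'x \<Rightarrow> real"
  assumes "i \<in> {1..n}" "f \<in> borel_measurable Q"
  shows "integrable P (\<lambda>\<omega>. f (\<xi> i \<omega>)) \<longleftrightarrow> integrable Q f" "(LINT \<omega>|P. f (\<xi> i \<omega>)) = (LINT x|Q. f x)"
  using integrable_distr_eq[OF \<xi>_meas[OF assms(1)] assms(2)] integral_distr[OF \<xi>_meas[OF assms(1)] assms(2)]
    dist_\<xi>[OF assms(1)] by simp_all

lemma \<zeta>_integral:
  fixes f :: "'e \<Rightarrow> real"
  assumes "v \<in> V" "f \<in> borel_measurable E"
  shows "integrable P (\<lambda>\<omega>. f (Zv v \<omega>)) \<longleftrightarrow> integrable E f" "(LINT \<omega>|P. f (Zv v \<omega>)) = (LINT x|E. f x)"
  using integrable_distr_eq[OF \<zeta>_meas[OF assms(1)] assms(2)] integral_distr[OF \<zeta>_meas[OF assms(1)] assms(2)]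
    dist_\<zeta>[OF assms(1)] by simp_all

text \<open>Visits of one subject share a field and are correlated, so their contributions are first
  collected in \<open>f i\<close>. These sums and the individual errors are centred and pairwise
  orthogonal; finiteness at the given \<open>u\<close> makes them square integrable.\<close>

lemma second_moment_pointwise:
  assumes w: "\<omega> \<in> space P"
    and fin: "\<And>v. v \<in> V \<Longrightarrow> (\<integral>\<^sup>+x. ennreal ((X x u (Tv v \<omega>))\<^sup>2) \<partial>Q) < \<infinity>"
  shows "(\<integral>\<^sup>+\<omega>'. ennreal ((d + noise w \<omega> \<omega>' u)\<^sup>2) \<partial>P) \<le> ennreal (d\<^sup>2) +
    (\<Sum>v\<in>V. ennreal ((w v)\<^sup>2) * (ennreal (real mmax) * (\<integral>\<^sup>+x. ennreal ((X x u (Tv v \<omega>))\<^sup>2) \<partial>Q) + ennreal (\<tau>max\<^sup>2)))"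
proof -
  define S where "S v = (\<integral>\<^sup>+x. ennreal ((X x u (Tv v \<omega>))\<^sup>2) \<partial>Q)" for v
  define f where "f i x = (\<Sum>j=1..m i. w (i, j) * X x u (T i j \<omega>))" for i x
  define e where "e v y = w v * (\<tau> (Tv v \<omega>) * \<eta> y u)" for v y
  have Tin: "T i j \<omega> \<in> {a..b}" if "i \<in> {1..n}" "j \<in> {1..m i}" for i j
    using T_in[of "(i, j)" \<omega>] that w by (simp add: visit_set_def)
  have Xm: "(\<lambda>x. X x u (T i j \<omega>)) \<in> borel_measurable Q" if "i \<in> {1..n}" "j \<in> {1..m i}" for i j
    using X_int[OF Tin[OF that]] by simp
  have f_meas: "f i \<in> borel_measurable Q" if "i \<in> {1..n}" for i
    unfolding f_def by (intro borel_measurable_sum borel_measurable_times borel_measurable_const Xm[OF that])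
  have X1: "integrable Q (\<lambda>x. w (i, j) * X x u (T i j \<omega>))" "(LINT x|Q. w (i, j) * X x u (T i j \<omega>)) = 0"
    if "i \<in> {1..n}" "j \<in> {1..m i}" for i j
    using X_int[OF Tin[OF that]] X_zero[OF Tin[OF that]] by simp_all
  have f_int: "integrable Q (f i)" if i: "i \<in> {1..n}" for i
    unfolding f_def by (rule Bochner_Integration.integrable_sum) (rule X1(1)[OF i])
  have f_zero: "(LINT x|Q. f i x) = 0" if i: "i \<in> {1..n}" for i
    unfolding f_def by (subst Bochner_Integration.integral_sum, rule X1(1)[OF i], assumption)
      (rule sum.neutral, use X1(2)[OF i] in blast)
  have f_sq: "(\<integral>\<^sup>+x. ennreal ((f i x)\<^sup>2) \<partial>Q) \<le> (\<Sum>j=1..m i. ennreal ((w (i, j))\<^sup>2) * (ennreal (real mmax) * S (i, j)))"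
    if i: "i \<in> {1..n}" for i
  proof -
    have "(\<integral>\<^sup>+x. ennreal ((f i x)\<^sup>2) \<partial>Q) \<le> (\<integral>\<^sup>+x. (\<Sum>j=1..m i. ennreal ((w (i, j))\<^sup>2) * (ennreal (real mmax) * ennreal ((X x u (T i j \<omega>))\<^sup>2))) \<partial>Q)"
    proof (rule nn_integral_mono)
      fix x
      have "(f i x)\<^sup>2 \<le> (\<Sum>j=1..m i. (w (i, j) * X x u (T i j \<omega>))\<^sup>2) * real (card {1..m i})"
        unfolding f_def by (rule sum_squared_le_sum_of_squares)
      also have "\<dots> \<le> (\<Sum>j=1..m i. (w (i, j) * X x u (T i j \<omega>))\<^sup>2) * real mmax"
        using m_le[OF i] by (intro mult_left_mono sum_nonneg) auto
      also have "\<dots> = (\<Sum>j=1..m i. (w (i, j))\<^sup>2 * (real mmax * (X x u (T i j \<omega>))\<^sup>2))"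
        by (simp add: sum_distrib_left sum_distrib_right power_mult_distrib mult_ac)
      finally have "ennreal ((f i x)\<^sup>2) \<le> ennreal (\<Sum>j=1..m i. (w (i, j))\<^sup>2 * (real mmax * (X x u (T i j \<omega>))\<^sup>2))"
        by (rule ennreal_leI)
      also have "\<dots> = (\<Sum>j=1..m i. ennreal ((w (i, j))\<^sup>2) * (ennreal (real mmax) * ennreal ((X x u (T i j \<omega>))\<^sup>2)))"
        by (subst sum_ennreal[symmetric]) (simp_all add: ennreal_mult)
      finally show "ennreal ((f i x)\<^sup>2) \<le> \<dots>" .
    qed
    also have "\<dots> = (\<Sum>j=1..m i. ennreal ((w (i, j))\<^sup>2) * (ennreal (real mmax) * S (i, j)))"
    proof -
      have *: "(\<lambda>x. ennreal ((X x u (T i j \<omega>))\<^sup>2)) \<in> borel_measurable Q" if "j \<in> {1..m i}" for j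
        using Xm[OF i that] by simp
      have "(\<integral>\<^sup>+x. (\<Sum>j=1..m i. ennreal ((w (i, j))\<^sup>2) * (ennreal (real mmax) * ennreal ((X x u (T i j \<omega>))\<^sup>2))) \<partial>Q)
          = (\<Sum>j=1..m i. \<integral>\<^sup>+x. ennreal ((w (i, j))\<^sup>2) * (ennreal (real mmax) * ennreal ((X x u (T i j \<omega>))\<^sup>2)) \<partial>Q)"
        by (rule nn_integral_sum) (intro borel_measurable_times_ennreal measurable_const *, auto)
      also have "\<dots> = (\<Sum>j=1..m i. ennreal ((w (i, j))\<^sup>2) * (ennreal (real mmax) * S (i, j)))"
      proof (rule sum.cong[OF refl])
        fix j assume "j \<in> {1..m i}"
        from *[OF this] show "(\<integral>\<^sup>+x. ennreal ((w (i, j))\<^sup>2) * (ennreal (real mmax) * ennreal ((X x u (T i j \<omega>))\<^sup>2)) \<partial>Q)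
            = ennreal ((w (i, j))\<^sup>2) * (ennreal (real mmax) * S (i, j))"
          by (simp add: nn_integral_cmult S_def)
      qed
      finally show ?thesis .
    qed
    finally show ?thesis .
  qed
  have f_fin: "integrable Q (\<lambda>x. (f i x)\<^sup>2)" if i: "i \<in> {1..n}" for i
  proof (rule integrableI_bounded)
    show "(\<lambda>x. (f i x)\<^sup>2) \<in> borel_measurable Q" using f_meas[OF i] by simp
    have "(\<Sum>j=1..m i. ennreal ((w (i, j))\<^sup>2) * (ennreal (real mmax) * S (i, j))) < \<infinity>"
      using fin i by (auto simp: S_def ennreal_mult_less_top visit_set_def)
    from order.strict_trans1[OF f_sq[OF i] this]
    show "(\<integral>\<^sup>+x. ennreal (norm ((f i x)\<^sup>2)) \<partial>Q) < \<infinity>" by simp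
  qed
  have e_meas: "e v \<in> borel_measurable E" for v
    unfolding e_def using \<eta>_int[of u] by simp
  have e_int: "integrable E (e v)" and e_zero: "(LINT y|E. e v y) = 0" for v
    unfolding e_def using \<eta>_int[of u] \<eta>_zero[of u] by simp_all
  have e_sq: "(e v y)\<^sup>2 = (w v * \<tau> (Tv v \<omega>))\<^sup>2 * (\<eta> y u)\<^sup>2" for v y
    by (simp add: e_def power_mult_distrib mult_ac)
  have e_fin: "integrable E (\<lambda>y. (e v y)\<^sup>2)" for v
    unfolding e_sq using \<eta>_sq(1)[of u] by simp
  have e_nn: "(\<integral>\<^sup>+y. ennreal ((e v y)\<^sup>2) \<partial>E) \<le> ennreal ((w v)\<^sup>2) * ennreal (\<tau>max\<^sup>2)" if v: "v \<in> V" for v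
  proof -
    have "(\<integral>\<^sup>+y. ennreal ((e v y)\<^sup>2) \<partial>E) = ennreal ((w v * \<tau> (Tv v \<omega>))\<^sup>2)"
      using e_fin[of v] \<eta>_sq[of u] by (subst nn_integral_eq_integral) (simp_all add: e_sq)
    also have "\<dots> \<le> ennreal ((w v)\<^sup>2 * \<tau>max\<^sup>2)"
    proof (rule ennreal_leI)
      have "\<bar>\<tau> (Tv v \<omega>)\<bar> \<le> \<bar>\<tau>max\<bar>" using \<tau>_le[OF T_in[OF v w]] by linarith
      then have "(\<tau> (Tv v \<omega>))\<^sup>2 \<le> \<tau>max\<^sup>2" by (simp only: abs_le_square_iff)
      then show "(w v * \<tau> (Tv v \<omega>))\<^sup>2 \<le> (w v)\<^sup>2 * \<tau>max\<^sup>2"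
        by (simp add: power_mult_distrib mult_left_mono)
    qed
    finally show ?thesis by (simp add: ennreal_mult)
  qed
  \<comment> \<open>Subjects and visits are merged into one index set, so that a single
    orthogonality statement covers all cross terms.\<close>
  define Z where "Z k \<omega>' = (case k of Inl i \<Rightarrow> f i (\<xi> i \<omega>') | Inr v \<Rightarrow> e v (Zv v \<omega>'))" for k \<omega>'
  let ?I = "{1..n} <+> V"
  have noise_Z: "noise w \<omega> \<omega>' u = (\<Sum>k\<in>?I. Z k \<omega>')" for \<omega>'
  proof -
    have "(\<Sum>v\<in>V. w v * X (\<xi> (fst v) \<omega>') u (Tv v \<omega>)) = (\<Sum>i=1..n. f i (\<xi> i \<omega>'))"
      unfolding visit_set_def f_def by (subst sum.Sigma) (auto intro!: sum.cong)
    then show ?thesis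
      by (simp add: noise_def sum.Plus Z_def o_def e_def distrib_left sum.distrib)
  qed
  have "(\<integral>\<^sup>+\<omega>'. ennreal ((d + (\<Sum>k\<in>?I. Z k \<omega>'))\<^sup>2) \<partial>P) = ennreal (d\<^sup>2) + (\<Sum>k\<in>?I. \<integral>\<^sup>+\<omega>'. ennreal ((Z k \<omega>')\<^sup>2) \<partial>P)"
  proof (rule nn_integral_orthogonal_sum)
    show "finite ?I" by simp
    show "Z k \<in> borel_measurable P" if "k \<in> ?I" for k
      using that measurable_compose[OF \<xi>_meas f_meas] measurable_compose[OF \<zeta>_meas e_meas]
      by (auto simp: Z_def[abs_def])
    show "integrable P (\<lambda>\<omega>'. (Z k \<omega>')\<^sup>2)" if "k \<in> ?I" for k
      using that \<xi>_integral(1)[OF _ borel_measurable_integrable[OF f_fin]]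
        \<zeta>_integral(1)[OF _ borel_measurable_integrable[OF e_fin]] f_fin e_fin
      by (auto simp: Z_def)
    show "(LINT \<omega>'|P. Z k \<omega>') = 0" if "k \<in> ?I" for k
      using that \<xi>_integral(2)[OF _ f_meas] \<zeta>_integral(2)[OF _ e_meas] f_zero e_zero
      by (auto simp: Z_def)
    have fP: "integrable P (\<lambda>\<omega>'. f i (\<xi> i \<omega>'))" "(LINT \<omega>'|P. f i (\<xi> i \<omega>')) = 0" if "i \<in> {1..n}" for i
      using that \<xi>_integral[OF that f_meas[OF that]] f_int f_zero by auto
    have eP: "integrable P (\<lambda>\<omega>'. e v (Zv v \<omega>'))" "(LINT \<omega>'|P. e v (Zv v \<omega>')) = 0" if "v \<in> V" for v
      using that \<zeta>_integral[OF that e_meas] e_int e_zero by auto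
    have mixed: "(LINT \<omega>'|P. f i (\<xi> i \<omega>') * e v (Zv v \<omega>')) = 0" if "i \<in> {1..n}" "v \<in> V" for i v
      using indep_var_lebesgue_integral[OF indep_\<xi>_\<zeta>[OF that f_meas[OF that(1)] e_meas] fP(1)[OF that(1)] eP(1)[OF that(2)]]
        fP(2)[OF that(1)] by simp
    show "(LINT \<omega>'|P. Z k \<omega>' * Z l \<omega>') = 0" if "k \<in> ?I" "l \<in> ?I" "k \<noteq> l" for k l
      using that(1,2)
    proof (elim PlusE)
      fix i i' assume "k = Inl i" "l = Inl i'" "i \<in> {1..n}" "i' \<in> {1..n}"
      with that(3) show ?thesis
        using indep_var_product_zero[OF indep_vars_pair[OF ind_\<xi>] f_meas f_meas fP(1) fP(1) fP(2), of i i']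
        by (simp add: Z_def)
    next
      fix v v' assume "k = Inr v" "l = Inr v'" "v \<in> V" "v' \<in> V"
      with that(3) show ?thesis
        using indep_var_product_zero[OF indep_vars_pair[OF ind_\<zeta>] e_meas e_meas eP(1) eP(1) eP(2), of v v']
        by (simp add: Z_def)
    next
      fix i v assume "k = Inl i" "l = Inr v" "i \<in> {1..n}" "v \<in> V"
      then show ?thesis using mixed by (simp add: Z_def)
    next
      fix i v assume "k = Inr v" "l = Inl i" "v \<in> V" "i \<in> {1..n}"
      then show ?thesis using mixed[of i v] by (simp add: Z_def mult.commute)
    qed
  qed
  also have "(\<Sum>k\<in>?I. \<integral>\<^sup>+\<omega>'. ennreal ((Z k \<omega>')\<^sup>2) \<partial>P) =
      (\<Sum>i=1..n. \<integral>\<^sup>+x. ennreal ((f i x)\<^sup>2) \<partial>Q) + (\<Sum>v\<in>V. \<integral>\<^sup>+y. ennreal ((e v y)\<^sup>2) \<partial>E)"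
  proof -
    have "(\<integral>\<^sup>+\<omega>'. ennreal ((f i (\<xi> i \<omega>'))\<^sup>2) \<partial>P) = (\<integral>\<^sup>+x. ennreal ((f i x)\<^sup>2) \<partial>Q)" if "i \<in> {1..n}" for i
      using that f_meas[OF that] by (intro \<xi>_nn_integral[of i "\<lambda>x. ennreal ((f i x)\<^sup>2)"]) auto
    moreover have "(\<integral>\<^sup>+\<omega>'. ennreal ((e v (Zv v \<omega>'))\<^sup>2) \<partial>P) = (\<integral>\<^sup>+y. ennreal ((e v y)\<^sup>2) \<partial>E)" if "v \<in> V" for v
      using that e_meas by (intro \<zeta>_nn_integral[of v "\<lambda>y. ennreal ((e v y)\<^sup>2)"]) auto
    ultimately show ?thesis by (simp add: sum.Plus Z_def o_def)
  qed
  also have "\<dots> \<le> (\<Sum>i=1..n. \<Sum>j=1..m i. ennreal ((w (i, j))\<^sup>2) * (ennreal (real mmax) * S (i, j))) +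
      (\<Sum>v\<in>V. ennreal ((w v)\<^sup>2) * ennreal (\<tau>max\<^sup>2))"
    by (intro add_mono sum_mono f_sq e_nn)
  also have "(\<Sum>i=1..n. \<Sum>j=1..m i. ennreal ((w (i, j))\<^sup>2) * (ennreal (real mmax) * S (i, j)))
      = (\<Sum>v\<in>V. ennreal ((w v)\<^sup>2) * (ennreal (real mmax) * S v))"
    unfolding visit_set_def by (subst sum.Sigma) (auto intro!: sum.cong)
  finally show ?thesis
    by (simp add: noise_Z S_def distrib_left sum.distrib add_left_mono)
qed

end

section \<open>Errors of the estimated coefficients\<close>

locale estimation = sample P a b c g n m T Q E \<nu> X \<eta> \<tau> \<xi> \<zeta> mmax \<Gamma> \<tau>max
  for P :: "'w measure" and a b c g n m and T :: "nat \<Rightarrow> nat \<Rightarrow> 'w \<Rightarrow> real"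
    and Q :: "'x measure" and E :: "'e measure" and \<nu> :: "'u measure"
    and X \<eta> \<tau> \<xi> \<zeta> mmax \<Gamma> \<tau>max +
  fixes \<phi> :: "nat \<Rightarrow> real \<Rightarrow> real" and \<mu> :: "'u \<Rightarrow> real \<Rightarrow> real"
  assumes ob: "orthonormal_basis_L2 (leb_on a b) \<phi>"
    and \<mu>_meas: "(\<lambda>(u, t). \<mu> u t) \<in> borel_measurable (\<nu> \<Otimes>\<^sub>M leb_on a b)"
    and \<mu>_int: "integrable (\<nu> \<Otimes>\<^sub>M leb_on a b) (\<lambda>(u, t). (\<mu> u t)\<^sup>2)"
begin

abbreviation "\<beta> \<equiv> basis_coeff a b \<phi> \<mu>"

text \<open>The fields and errors belong to visits, not to ranks, and the rank of a visit is random.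
  The sum picks the weight of the one rank at which the visit \<open>v\<close> stands.\<close>

definition visit_weight :: "nat \<Rightarrow> 'w \<Rightarrow> nat \<times> nat \<Rightarrow> real" where
  "visit_weight k \<omega> v = (\<Sum>l=1..M. if ranked_visits n m (times \<omega>) ! (l - 1) = v
      then spacing_weight a b \<phi> n m (times \<omega>) k l else 0)"

definition bias :: "nat \<Rightarrow> 'w \<Rightarrow> 'u \<Rightarrow> real" where
  "bias k \<omega> u = (\<Sum>v\<in>V. visit_weight k \<omega> v * \<mu> u (Tv v \<omega>)) - \<beta> k u"

definition coeff_error :: "nat \<Rightarrow> 'w \<Rightarrow> 'u \<Rightarrow> real" where
  "coeff_error k \<omega> u = spacing_coeff a b \<phi> n m (\<lambda>i j. T i j \<omega>) (observation \<mu> X \<tau> \<eta> \<xi> T \<zeta> \<omega>) k u - \<beta> k u"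

lemma times_fun: "(\<lambda>i j. T i j \<omega>) = times \<omega>"
  by (simp add: times_def fun_eq_iff)

lemma visit_weight_ranked:
  assumes "l \<in> {1..M}"
  shows "visit_weight k \<omega> (ranked_visits n m (times \<omega>) ! (l - 1)) = spacing_weight a b \<phi> n m (times \<omega>) k l"
proof -
  have inj: "inj_on (\<lambda>l. ranked_visits n m (times \<omega>) ! (l - 1)) {1..M}"
    using ranked_visits_bij by (rule bij_betw_imp_inj_on)
  have "visit_weight k \<omega> (ranked_visits n m (times \<omega>) ! (l - 1))
      = (\<Sum>l'=1..M. if l' = l then spacing_weight a b \<phi> n m (times \<omega>) k l' else 0)"
    unfolding visit_weight_def using inj_onD[OF inj _ _ assms] by (intro sum.cong) auto
  also have "\<dots> = spacing_weight a b \<phi> n m (times \<omega>) k l"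
    using assms by (subst sum.delta) auto
  finally show ?thesis .
qed

lemma sum_ranked:
  "(\<Sum>v\<in>V. F v (visit_weight k \<omega> v)) =
    (\<Sum>l=1..M. F (ranked_visits n m (times \<omega>) ! (l - 1)) (spacing_weight a b \<phi> n m (times \<omega>) k l))"
  using visit_weight_ranked
  by (subst sum.reindex_bij_betw[OF ranked_visits_bij[of n m "times \<omega>"], symmetric]) (auto intro!: sum.cong)

lemma coeff_error_eq: "coeff_error k \<omega> u = bias k \<omega> u + noise (visit_weight k \<omega>) \<omega> \<omega> u"
proof -
  let ?y = "\<lambda>v. \<mu> u (Tv v \<omega>) + X (\<xi> (fst v) \<omega>) u (Tv v \<omega>) + \<tau> (Tv v \<omega>) * \<eta> (Zv v \<omega>) u"
  have "ranked_profile n m (times \<omega>) (observation \<mu> X \<tau> \<eta> \<xi> T \<zeta> \<omega>) l u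
      = ?y (ranked_visits n m (times \<omega>) ! (l - 1))" for l
    by (simp add: ranked_profile_def observation_def split: prod.split)
  then have "spacing_coeff a b \<phi> n m (times \<omega>) (observation \<mu> X \<tau> \<eta> \<xi> T \<zeta> \<omega>) k u = (\<Sum>v\<in>V. ?y v * visit_weight k \<omega> v)"
    using sum_ranked[of "\<lambda>v r. ?y v * r" k \<omega>] by (simp add: spacing_coeff_def)
  then show ?thesis
    by (simp add: coeff_error_def times_fun bias_def noise_def algebra_simps sum.distrib)
qed

lemma sum_weights_sq:
  "(\<Sum>v\<in>V. ennreal ((visit_weight k \<omega> v)\<^sup>2)) = (\<Sum>l=1..M. ennreal ((spacing_weight a b \<phi> n m (times \<omega>) k l)\<^sup>2))"
  by (rule sum_ranked[of "\<lambda>v r. ennreal (r\<^sup>2)"])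

lemma \<phi>_meas: "1 \<le> k \<Longrightarrow> \<phi> k \<in> borel_measurable lam"
  by (rule basis_measurable[OF ob])

lemma finite_lam: "finite_measure lam"
proof
  have "emeasure lam (space lam) = ennreal (b - a)"
    using ab by (subst emeasure_leb_on) (auto simp: leb_on_def sets_restrict_space)
  then show "emeasure lam (space lam) \<noteq> \<infinity>" by simp
qed

lemma \<phi>_window_integrable:
  assumes "1 \<le> k" shows "integrable lam (\<lambda>x. \<phi> k x * indicator (spacing_window n m t l) x)"
proof -
  interpret finite_measure lam by (rule finite_lam)
  have m: "(\<lambda>x. indicator (spacing_window n m t l) x :: real) \<in> borel_measurable lam"
    by (intro borel_measurable_leb_on borel_measurable_indicator window_sets)
  show ?thesis
    by (intro integrable_mult_square_integrable \<phi>_meas[OF assms] basis_sq_integrable[OF ob assms] m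
        integrable_const_bound[of _ 1]) (use m in \<open>auto simp: indicator_def\<close>)
qed

lemma smoothed_meas: "smoothed f \<omega> \<in> borel_measurable lam"
  unfolding smoothed_def
  by (intro borel_measurable_divide borel_measurable_sum borel_measurable_times borel_measurable_const
      borel_measurable_leb_on borel_measurable_indicator window_sets)

lemma smoothed_bounded: "\<exists>B. \<forall>x. \<bar>smoothed f \<omega> x\<bar> \<le> B"
proof (intro exI allI)
  fix x
  have "\<bar>smoothed f \<omega> x\<bar> \<le> \<bar>\<Sum>l=1..M. f (order_stat n m (times \<omega>) l) *
      indicator (spacing_window n m (times \<omega>) l) x\<bar> / (2 * real h)"
    by (simp add: smoothed_def)
  also have "\<dots> \<le> (\<Sum>l=1..M. \<bar>f (order_stat n m (times \<omega>) l)\<bar>) / (2 * real h)"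
    by (intro divide_right_mono order_trans[OF sum_abs sum_mono]) (auto simp: indicator_def)
  finally show "\<bar>smoothed f \<omega> x\<bar> \<le> (\<Sum>l=1..M. \<bar>f (order_stat n m (times \<omega>) l)\<bar>) / (2 * real h)" .
qed

lemma smoothed_sq_integrable: "integrable lam (\<lambda>x. (smoothed f \<omega> x)\<^sup>2)"
proof -
  interpret finite_measure lam by (rule finite_lam)
  obtain B where B: "\<And>x. \<bar>smoothed f \<omega> x\<bar> \<le> B" using smoothed_bounded by blast
  have "(smoothed f \<omega> x)\<^sup>2 \<le> B\<^sup>2" for x
    using B[of x] by (intro abs_le_square_iff[THEN iffD1]) auto
  then show ?thesis
    using smoothed_meas by (intro integrable_const_bound[of _ "B\<^sup>2"]) auto
qed

text \<open>Interchanging the sum over ranks with the integral in the weights shows that all biases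
  are coefficients of one and the same function, which is what makes Bessel's inequality
  applicable.\<close>

lemma bias_eq:
  assumes k: "1 \<le> k" and u: "\<mu> u \<in> borel_measurable lam" "integrable lam (\<lambda>t. (\<mu> u t)\<^sup>2)"
  shows "bias k \<omega> u = (LINT x|lam. (smoothed (\<mu> u) \<omega> x - \<mu> u x) * \<phi> k x)"
proof -
  let ?o = "order_stat n m (times \<omega>)" and ?W = "spacing_window n m (times \<omega>)"
  have i1: "integrable lam (\<lambda>x. smoothed (\<mu> u) \<omega> x * \<phi> k x)"
    by (intro integrable_mult_square_integrable smoothed_meas smoothed_sq_integrable \<phi>_meas k basis_sq_integrable[OF ob k])
  have i2: "integrable lam (\<lambda>x. \<mu> u x * \<phi> k x)"
    by (intro integrable_mult_square_integrable u \<phi>_meas k basis_sq_integrable[OF ob k])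
  have "(LINT x|lam. smoothed (\<mu> u) \<omega> x * \<phi> k x)
      = (LINT x|lam. (\<Sum>l=1..M. \<mu> u (?o l) * (1 / (2 * real h)) * (\<phi> k x * indicator (?W l) x)))"
    unfolding smoothed_def sum_divide_distrib sum_distrib_right
    by (intro Bochner_Integration.integral_cong sum.cong refl) simp
  also have "\<dots> = (\<Sum>l=1..M. LINT x|lam. \<mu> u (?o l) * (1 / (2 * real h)) * (\<phi> k x * indicator (?W l) x))"
    by (intro Bochner_Integration.integral_sum integrable_mult_right \<phi>_window_integrable k)
  also have "\<dots> = (\<Sum>l=1..M. \<mu> u (?o l) * spacing_weight a b \<phi> n m (times \<omega>) k l)"
    by (intro sum.cong refl, subst integral_mult_right_zero) (simp add: spacing_weight_def)
  also have "\<dots> = (\<Sum>v\<in>V. \<mu> u (Tv v \<omega>) * visit_weight k \<omega> v)"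
    using sum_ranked[of "\<lambda>v r. \<mu> u (Tv v \<omega>) * r" k \<omega>]
    unfolding order_stat_eq times_eq by simp
  finally have "(\<Sum>v\<in>V. visit_weight k \<omega> v * \<mu> u (Tv v \<omega>)) = (LINT x|lam. smoothed (\<mu> u) \<omega> x * \<phi> k x)"
    by (simp add: mult.commute)
  then show ?thesis
    using i1 i2 by (simp add: bias_def basis_coeff_def left_diff_distrib)
qed

lemma sum_bias_sq_le:
  assumes u: "\<mu> u \<in> borel_measurable lam" "integrable lam (\<lambda>t. (\<mu> u t)\<^sup>2)"
  shows "(\<Sum>k=1..K. ennreal ((bias k \<omega> u)\<^sup>2)) \<le> (\<integral>\<^sup>+x. ennreal ((smoothed (\<mu> u) \<omega> x - \<mu> u x)\<^sup>2) \<partial>lam)"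
proof -
  let ?d = "\<lambda>x. smoothed (\<mu> u) \<omega> x - \<mu> u x"
  have d: "?d \<in> borel_measurable lam" using smoothed_meas u by simp
  have "integrable lam (\<lambda>x. 2 * (smoothed (\<mu> u) \<omega> x * \<mu> u x))"
    by (intro integrable_mult_right integrable_mult_square_integrable smoothed_meas smoothed_sq_integrable u)
  then have "integrable lam (\<lambda>x. (smoothed (\<mu> u) \<omega> x)\<^sup>2 + (\<mu> u x)\<^sup>2 - 2 * (smoothed (\<mu> u) \<omega> x * \<mu> u x))"
    using smoothed_sq_integrable u by simp
  then have d2: "integrable lam (\<lambda>x. (?d x)\<^sup>2)" by (simp add: power2_diff mult.assoc)
  have "(\<Sum>k=1..K. ennreal ((bias k \<omega> u)\<^sup>2)) = ennreal (\<Sum>k=1..K. (LINT x|lam. ?d x * \<phi> k x)\<^sup>2)"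
    by (subst sum_ennreal[symmetric]) (auto intro!: sum.cong simp: bias_eq[OF _ u])
  also have "\<dots> \<le> ennreal (LINT x|lam. (?d x)\<^sup>2)"
    by (intro ennreal_leI bessel_inequality[OF ob d d2])
  also have "\<dots> = (\<integral>\<^sup>+x. ennreal ((?d x)\<^sup>2) \<partial>lam)"
    using d2 by (subst nn_integral_eq_integral) auto
  finally show ?thesis .
qed

lemma \<mu>_sec: "t \<in> {a..b} \<Longrightarrow> (\<lambda>u. \<mu> u t) \<in> borel_measurable \<nu>"
  using measurable_compose[OF measurable_Pair2' \<mu>_meas, of t] by simp

lemma \<beta>_meas: "1 \<le> k \<Longrightarrow> \<beta> k \<in> borel_measurable \<nu>"
  using basis_coeff_measurable[where \<mu> = \<mu> and \<phi> = \<phi>] \<mu>_meas \<phi>_meas by blast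

lemma bias_sec:
  assumes "1 \<le> k" "\<omega> \<in> space P" shows "bias k \<omega> \<in> borel_measurable \<nu>"
  unfolding bias_def
  by (intro borel_measurable_diff borel_measurable_sum borel_measurable_times borel_measurable_const \<mu>_sec \<beta>_meas assms)
    (rule T_in[OF _ assms(2)])

lemma total_bias_le:
  assumes w: "\<omega> \<in> space P"
  shows "(\<Sum>k=1..K. \<integral>\<^sup>+u. ennreal ((bias k \<omega> u)\<^sup>2) \<partial>\<nu>)
    \<le> (\<integral>\<^sup>+x. \<integral>\<^sup>+u. ennreal ((smoothed (\<mu> u) \<omega> x - \<mu> u x)\<^sup>2) \<partial>\<nu> \<partial>lam)"
proof -
  interpret \<nu>: finite_measure \<nu> by (rule nu)
  interpret L: sigma_finite_measure lam by (rule sigma_finite_leb_on)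
  interpret NL: pair_sigma_finite \<nu> lam ..
  note ae = AE_section_square_integrable[OF \<nu>.sigma_finite_measure \<mu>_meas \<mu>_int]
  have bm: "(\<lambda>u. ennreal ((bias k \<omega> u)\<^sup>2)) \<in> borel_measurable \<nu>" if "1 \<le> k" for k
    using bias_sec[OF that w] by simp
  have "(\<Sum>k=1..K. \<integral>\<^sup>+u. ennreal ((bias k \<omega> u)\<^sup>2) \<partial>\<nu>) = (\<integral>\<^sup>+u. (\<Sum>k=1..K. ennreal ((bias k \<omega> u)\<^sup>2)) \<partial>\<nu>)"
    by (rule nn_integral_sum[symmetric], rule bm) simp
  also have "\<dots> \<le> (\<integral>\<^sup>+u. \<integral>\<^sup>+x. ennreal ((smoothed (\<mu> u) \<omega> x - \<mu> u x)\<^sup>2) \<partial>lam \<partial>\<nu>)"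
  proof (rule nn_integral_mono_AE)
    show "AE u in \<nu>. (\<Sum>k=1..K. ennreal ((bias k \<omega> u)\<^sup>2)) \<le> (\<integral>\<^sup>+x. ennreal ((smoothed (\<mu> u) \<omega> x - \<mu> u x)\<^sup>2) \<partial>lam)"
      using ae by eventually_elim (intro sum_bias_sq_le, auto)
  qed
  also have "\<dots> = (\<integral>\<^sup>+x. \<integral>\<^sup>+u. ennreal ((smoothed (\<mu> u) \<omega> x - \<mu> u x)\<^sup>2) \<partial>\<nu> \<partial>lam)"
  proof (rule NL.Fubini'[symmetric])
    have o: "(\<lambda>p. \<mu> (fst p) (order_stat n m (times \<omega>) l)) \<in> borel_measurable (\<nu> \<Otimes>\<^sub>M lam)" if "l \<in> {1..M}" for l
      by (rule measurable_compose[OF measurable_fst \<mu>_sec[OF order_stat_in[OF that w]]])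
    have i: "(\<lambda>p. indicator (spacing_window n m (times \<omega>) l) (snd p) :: real) \<in> borel_measurable (\<nu> \<Otimes>\<^sub>M lam)" for l
      by (rule measurable_compose[OF measurable_snd]) (intro borel_measurable_leb_on borel_measurable_indicator window_sets)
    have "(\<lambda>p. smoothed (\<mu> (fst p)) \<omega> (snd p)) \<in> borel_measurable (\<nu> \<Otimes>\<^sub>M lam)"
      unfolding smoothed_def by (intro borel_measurable_divide borel_measurable_sum borel_measurable_times borel_measurable_const o i)
    then show "(\<lambda>(u, x). ennreal ((smoothed (\<mu> u) \<omega> x - \<mu> u x)\<^sup>2)) \<in> borel_measurable (\<nu> \<Otimes>\<^sub>M lam)"
      using \<mu>_meas by (simp add: case_prod_beta')
  qed
  finally show ?thesis .
qed

lemma M_ge_1: "1 \<le> M"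
proof -
  have "card V \<noteq> 0" using neV by simp
  then show ?thesis by (simp add: M_eq)
qed

lemma T_borel_PT: "(i, j) \<in> V \<Longrightarrow> T i j \<in> borel_measurable PT"
  using borel_measurable_if_leb_on[OF T_PT[of "(i, j)"]] by simp

lemma ranked_visits_PT: "(\<lambda>\<omega>. ranked_visits n m (times \<omega>)) \<in> measurable PT (count_space UNIV)"
  using measurable_ranked_visits[of n m T PT] T_borel_PT unfolding times_fun by blast

lemma order_stat_PT: "l \<in> {1..M} \<Longrightarrow> (\<lambda>\<omega>. order_stat n m (times \<omega>) l) \<in> borel_measurable PT"
  using measurable_order_stat[of n m T PT l] T_borel_PT unfolding times_fun by blast

text \<open>Measurability for \<open>PT\<close> rather than for \<open>P\<close> is the point: the
  weights have to stay fixed when fields and errors are drawn afresh.\<close>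

lemma spacing_weight_meas:
  assumes k: "1 \<le> k"
  shows "(\<lambda>\<omega>. spacing_weight a b \<phi> n m (times \<omega>) k l) \<in> borel_measurable PT"
proof -
  interpret L: sigma_finite_measure lam by (rule sigma_finite_leb_on)
  have refl_meas: "(\<lambda>\<omega>. reflected M (order_stat n m (times \<omega>)) z) \<in> borel_measurable PT" for z
    by (intro measurable_reflected order_stat_PT M_ge_1)
  define lo hi where "lo \<omega> = reflected M (order_stat n m (times \<omega>)) (int l - int h)"
    and "hi \<omega> = reflected M (order_stat n m (times \<omega>)) (int l + int h)" for \<omega>
  have [measurable]: "lo \<in> borel_measurable PT" "hi \<in> borel_measurable PT"
    unfolding lo_def hi_def by (rule refl_meas)+
  have [measurable]: "\<phi> k \<in> borel_measurable lam" by (rule \<phi>_meas[OF k])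
  have [measurable]: "(\<lambda>p. snd p) \<in> borel_measurable (PT \<Otimes>\<^sub>M lam)" by (rule borel_measurable_if_leb_on) simp
  have "(\<lambda>(\<omega>, x). \<phi> k x * (if lo \<omega> \<le> x \<and> x \<le> hi \<omega> then 1 else 0)) \<in> borel_measurable (PT \<Otimes>\<^sub>M lam)"
    unfolding case_prod_beta by measurable
  from L.borel_measurable_lebesgue_integral[OF this]
  have "(\<lambda>\<omega>. 1 / (2 * real h) * (LINT x|lam. \<phi> k x * (if lo \<omega> \<le> x \<and> x \<le> hi \<omega> then 1 else 0))) \<in> borel_measurable PT"
    by simp
  moreover have "indicator (spacing_window n m (times \<omega>) l) x = (if lo \<omega> \<le> x \<and> x \<le> hi \<omega> then 1 else (0::real))" for \<omega> x
    by (simp add: spacing_window_def Let_def lo_def hi_def indicator_def)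
  ultimately show ?thesis by (simp add: spacing_weight_def)
qed

lemma visit_weight_meas:
  assumes k: "1 \<le> k"
  shows "(\<lambda>\<omega>. visit_weight k \<omega> v) \<in> borel_measurable PT"
  unfolding visit_weight_def
proof (rule borel_measurable_sum)
  fix l
  have [measurable]: "Measurable.pred PT (\<lambda>\<omega>. ranked_visits n m (times \<omega>) ! (l - 1) = v)"
    by (rule measurable_compose[OF ranked_visits_PT]) simp
  note [measurable] = spacing_weight_meas[OF k]
  show "(\<lambda>\<omega>. if ranked_visits n m (times \<omega>) ! (l - 1) = v then spacing_weight a b \<phi> n m (times \<omega>) k l else 0) \<in> borel_measurable PT"
    by measurable
qed

text \<open>Joint measurability in the two separated outcomes and \<open>u\<close>. Since
  \<open>X\<close> is evaluated at a random time, this rests on its joint measurability in all three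
  arguments.\<close>

lemma error_meas:
  assumes k: "1 \<le> k"
  shows "(\<lambda>p. bias k (fst (fst p)) (snd p) + noise (visit_weight k (fst (fst p))) (fst (fst p)) (snd (fst p)) (snd p))
    \<in> borel_measurable ((PT \<Otimes>\<^sub>M PN) \<Otimes>\<^sub>M \<nu>)" (is "_ \<in> borel_measurable ?S")
proof -
  have w: "(\<lambda>p. visit_weight k (fst (fst p)) v) \<in> borel_measurable ?S" for v
    by (rule measurable_compose[OF _ visit_weight_meas[OF k]]) measurable
  have T: "(\<lambda>p. Tv v (fst (fst p))) \<in> measurable ?S lam" if "v \<in> V" for v
    by (rule measurable_compose[OF _ T_PT[OF that]]) measurable
  have \<xi>: "(\<lambda>p. \<xi> (fst v) (snd (fst p))) \<in> measurable ?S Q" if "v \<in> V" for v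
    by (rule measurable_compose[OF _ \<xi>_PN[OF fst_V[OF that]]]) measurable
  have \<zeta>: "(\<lambda>p. Zv v (snd (fst p))) \<in> measurable ?S E" if "v \<in> V" for v
    by (rule measurable_compose[OF _ \<zeta>_PN[OF that]]) measurable
  have u: "(\<lambda>p. snd p) \<in> measurable ?S \<nu>" by measurable
  have 1: "(\<lambda>p. \<mu> (snd p) (Tv v (fst (fst p)))) \<in> borel_measurable ?S" if "v \<in> V" for v
    using measurable_compose[OF measurable_Pair[OF u T[OF that]] \<mu>_meas] by simp
  have 2: "(\<lambda>p. X (\<xi> (fst v) (snd (fst p))) (snd p) (Tv v (fst (fst p)))) \<in> borel_measurable ?S" if "v \<in> V" for v
    using measurable_compose[OF measurable_Pair[OF \<xi>[OF that] measurable_Pair[OF u T[OF that]]] X_meas] by simp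
  have 3: "(\<lambda>p. \<eta> (Zv v (snd (fst p))) (snd p)) \<in> borel_measurable ?S" if "v \<in> V" for v
    using measurable_compose[OF measurable_Pair[OF \<zeta>[OF that] u] \<eta>_meas] by simp
  have 4: "(\<lambda>p. \<tau> (Tv v (fst (fst p)))) \<in> borel_measurable ?S" if "v \<in> V" for v
    by (rule measurable_compose[OF T[OF that] \<tau>_meas])
  have 5: "(\<lambda>p. \<beta> k (snd p)) \<in> borel_measurable ?S"
    by (rule measurable_compose[OF u \<beta>_meas[OF k]])
  show ?thesis
    unfolding bias_def noise_def
    by (intro borel_measurable_add borel_measurable_diff borel_measurable_sum borel_measurable_times w 1 2 3 4 5)
qed

lemma id_PT: "(\<lambda>x. x) \<in> measurable P PT" and id_PN: "(\<lambda>x. x) \<in> measurable P PN"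
  using sets_PT_PN_subset by (auto simp: measurable_def sets.Int_space_eq2)

lemma X_sq_sec:
  assumes t: "t \<in> {a..b}"
  shows "(\<lambda>u. \<integral>\<^sup>+x. ennreal ((X x u t)\<^sup>2) \<partial>Q) \<in> borel_measurable \<nu>"
proof -
  interpret Q: prob_space Q by (rule Q)
  have "(\<lambda>p. (snd p, fst p, t)) \<in> measurable (\<nu> \<Otimes>\<^sub>M Q) (Q \<Otimes>\<^sub>M (\<nu> \<Otimes>\<^sub>M lam))"
    using t by (intro measurable_Pair measurable_snd measurable_fst measurable_const) simp
  from measurable_compose[OF this X_meas]
  have "(\<lambda>(u, x). ennreal ((X x u t)\<^sup>2)) \<in> borel_measurable (\<nu> \<Otimes>\<^sub>M Q)" by (simp add: case_prod_beta')
  from Q.borel_measurable_nn_integral[OF this] show ?thesis by simp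
qed

text \<open>Divided by the lower bound \<open>c\<close> of the density this becomes the constant
  \<open>C1\<close>.\<close>

definition noise_level :: real where
  "noise_level = real mmax * \<Gamma> + \<tau>max\<^sup>2 * measure \<nu> (space \<nu>)"

lemma noise_level_nonneg: "0 \<le> noise_level"
  using \<Gamma>_nonneg by (simp add: noise_level_def)

text \<open>Fubini moves the integral over \<open>u\<close> outside. At almost every
  \<open>u\<close> the second moments at all visit times are finite, so the pointwise estimate
  applies there.\<close>

lemma conditional_error_le:
  assumes k: "1 \<le> k" and w: "\<omega> \<in> space P"
    and good: "\<And>v. v \<in> V \<Longrightarrow> (\<integral>\<^sup>+u. \<integral>\<^sup>+x. ennreal ((X x u (Tv v \<omega>))\<^sup>2) \<partial>Q \<partial>\<nu>) \<le> ennreal \<Gamma>"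
  shows "(\<integral>\<^sup>+\<omega>'. \<integral>\<^sup>+u. ennreal ((bias k \<omega> u + noise (visit_weight k \<omega>) \<omega> \<omega>' u)\<^sup>2) \<partial>\<nu> \<partial>P)
    \<le> (\<integral>\<^sup>+u. ennreal ((bias k \<omega> u)\<^sup>2) \<partial>\<nu>) +
      ennreal noise_level * (\<Sum>l=1..M. ennreal ((spacing_weight a b \<phi> n m (times \<omega>) k l)\<^sup>2))"
proof -
  interpret \<nu>: finite_measure \<nu> by (rule nu)
  interpret PN: pair_sigma_finite P \<nu> ..
  let ?S = "\<lambda>v u. \<integral>\<^sup>+x. ennreal ((X x u (Tv v \<omega>))\<^sup>2) \<partial>Q"
  let ?w = "visit_weight k \<omega>"
  have S: "?S v \<in> borel_measurable \<nu>" if "v \<in> V" for v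
    by (rule X_sq_sec) (rule T_in[OF that w])
  have "(\<lambda>p. ((\<omega>, fst p), snd p)) \<in> measurable (P \<Otimes>\<^sub>M \<nu>) ((PT \<Otimes>\<^sub>M PN) \<Otimes>\<^sub>M \<nu>)"
    using w by (intro measurable_Pair measurable_snd measurable_const measurable_compose[OF measurable_fst id_PN]) simp
  from measurable_compose[OF this error_meas[OF k]]
  have fm: "(\<lambda>(\<omega>', u). ennreal ((bias k \<omega> u + noise ?w \<omega> \<omega>' u)\<^sup>2)) \<in> borel_measurable (P \<Otimes>\<^sub>M \<nu>)"
    by (simp add: case_prod_beta')
  have ae: "AE u in \<nu>. \<forall>v\<in>V. ?S v u < \<infinity>"
  proof (rule AE_finite_allI[OF finite_visit_set])
    fix v assume v: "v \<in> V"
    have "(\<integral>\<^sup>+u. ?S v u \<partial>\<nu>) \<noteq> \<infinity>"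
      using good[OF v] by (auto simp: top_unique)
    from nn_integral_PInf_AE[OF S[OF v] this] show "AE u in \<nu>. ?S v u < \<infinity>"
      by eventually_elim (simp add: less_top)
  qed
  have "(\<integral>\<^sup>+\<omega>'. \<integral>\<^sup>+u. ennreal ((bias k \<omega> u + noise ?w \<omega> \<omega>' u)\<^sup>2) \<partial>\<nu> \<partial>P)
      = (\<integral>\<^sup>+u. \<integral>\<^sup>+\<omega>'. ennreal ((bias k \<omega> u + noise ?w \<omega> \<omega>' u)\<^sup>2) \<partial>P \<partial>\<nu>)"
    by (rule PN.Fubini'[symmetric]) (rule fm)
  also have "\<dots> \<le> (\<integral>\<^sup>+u. ennreal ((bias k \<omega> u)\<^sup>2) +
      (\<Sum>v\<in>V. ennreal ((?w v)\<^sup>2) * (ennreal (real mmax) * ?S v u + ennreal (\<tau>max\<^sup>2))) \<partial>\<nu>)"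
    by (rule nn_integral_mono_AE, use ae in eventually_elim) (intro second_moment_pointwise w, blast)
  also have "\<dots> = (\<integral>\<^sup>+u. ennreal ((bias k \<omega> u)\<^sup>2) \<partial>\<nu>) +
      (\<Sum>v\<in>V. ennreal ((?w v)\<^sup>2) * (ennreal (real mmax) * (\<integral>\<^sup>+u. ?S v u \<partial>\<nu>) + ennreal (\<tau>max\<^sup>2) * emeasure \<nu> (space \<nu>)))"
  proof -
    have m: "(\<lambda>u. ennreal ((?w v)\<^sup>2) * (ennreal (real mmax) * ?S v u + ennreal (\<tau>max\<^sup>2))) \<in> borel_measurable \<nu>" if "v \<in> V" for v
      using S[OF that] by simp
    have "(\<integral>\<^sup>+u. ennreal ((?w v)\<^sup>2) * (ennreal (real mmax) * ?S v u + ennreal (\<tau>max\<^sup>2)) \<partial>\<nu>)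
        = ennreal ((?w v)\<^sup>2) * (ennreal (real mmax) * (\<integral>\<^sup>+u. ?S v u \<partial>\<nu>) + ennreal (\<tau>max\<^sup>2) * emeasure \<nu> (space \<nu>))" if "v \<in> V" for v
      using S[OF that] by (simp add: nn_integral_cmult nn_integral_add)
    moreover have "(\<integral>\<^sup>+u. ennreal ((bias k \<omega> u)\<^sup>2) + (\<Sum>v\<in>V. ennreal ((?w v)\<^sup>2) * (ennreal (real mmax) * ?S v u + ennreal (\<tau>max\<^sup>2))) \<partial>\<nu>)
        = (\<integral>\<^sup>+u. ennreal ((bias k \<omega> u)\<^sup>2) \<partial>\<nu>) + (\<Sum>v\<in>V. \<integral>\<^sup>+u. ennreal ((?w v)\<^sup>2) * (ennreal (real mmax) * ?S v u + ennreal (\<tau>max\<^sup>2)) \<partial>\<nu>)"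
    proof (subst nn_integral_add)
      show "(\<lambda>u. ennreal ((bias k \<omega> u)\<^sup>2)) \<in> borel_measurable \<nu>" using bias_sec[OF k w] by simp
      show "(\<lambda>u. \<Sum>v\<in>V. ennreal ((?w v)\<^sup>2) * (ennreal (real mmax) * ?S v u + ennreal (\<tau>max\<^sup>2))) \<in> borel_measurable \<nu>"
        by (rule borel_measurable_sum) (rule m)
    qed (subst nn_integral_sum, rule m, assumption, rule refl)
    ultimately show ?thesis by simp
  qed
  also have "\<dots> \<le> (\<integral>\<^sup>+u. ennreal ((bias k \<omega> u)\<^sup>2) \<partial>\<nu>) + (\<Sum>v\<in>V. ennreal ((?w v)\<^sup>2) * ennreal noise_level)"
  proof (intro add_left_mono sum_mono mult_left_mono)
    fix v assume v: "v \<in> V"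
    have "ennreal (real mmax) * (\<integral>\<^sup>+u. ?S v u \<partial>\<nu>) + ennreal (\<tau>max\<^sup>2) * emeasure \<nu> (space \<nu>)
        \<le> ennreal (real mmax) * ennreal \<Gamma> + ennreal (\<tau>max\<^sup>2) * ennreal (measure \<nu> (space \<nu>))"
      using good[OF v] by (intro add_mono mult_left_mono) (auto simp: \<nu>.emeasure_eq_measure)
    also have "\<dots> = ennreal noise_level"
      using \<Gamma>_nonneg by (simp add: noise_level_def ennreal_mult ennreal_plus)
    finally show "ennreal (real mmax) * (\<integral>\<^sup>+u. ?S v u \<partial>\<nu>) + ennreal (\<tau>max\<^sup>2) * emeasure \<nu> (space \<nu>) \<le> ennreal noise_level" .
  qed simp
  also have "(\<Sum>v\<in>V. ennreal ((?w v)\<^sup>2) * ennreal noise_level)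
      = ennreal noise_level * (\<Sum>l=1..M. ennreal ((spacing_weight a b \<phi> n m (times \<omega>) k l)\<^sup>2))"
    unfolding sum_distrib_right[symmetric] sum_weights_sq by (rule mult.commute)
  finally show ?thesis .
qed

lemma AE_good_visits:
  "AE \<omega> in P. \<forall>v\<in>V. (\<integral>\<^sup>+u. \<integral>\<^sup>+x. ennreal ((X x u (Tv v \<omega>))\<^sup>2) \<partial>Q \<partial>\<nu>) \<le> ennreal \<Gamma>"
  by (rule AE_finite_allI[OF finite_visit_set]) (rule AE_T[OF X_cov])

lemma expected_coeff_error_le:
  assumes k: "1 \<le> k"
  shows "(\<integral>\<^sup>+\<omega>. \<integral>\<^sup>+u. ennreal ((coeff_error k \<omega> u)\<^sup>2) \<partial>\<nu> \<partial>P)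
    \<le> (\<integral>\<^sup>+\<omega>. \<integral>\<^sup>+u. ennreal ((bias k \<omega> u)\<^sup>2) \<partial>\<nu> \<partial>P) + ennreal (noise_level * (S_sp M / c))"
    and "(\<lambda>\<omega>. \<integral>\<^sup>+u. ennreal ((coeff_error k \<omega> u)\<^sup>2) \<partial>\<nu>) \<in> borel_measurable P"
    and "(\<lambda>\<omega>. \<integral>\<^sup>+u. ennreal ((bias k \<omega> u)\<^sup>2) \<partial>\<nu>) \<in> borel_measurable P"
proof -
  interpret \<nu>: finite_measure \<nu> by (rule nu)
  define F where "F p = (\<integral>\<^sup>+u. ennreal ((bias k (fst p) u + noise (visit_weight k (fst p)) (fst p) (snd p) u)\<^sup>2) \<partial>\<nu>)" for p
  have F: "F \<in> borel_measurable (PT \<Otimes>\<^sub>M PN)"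
    unfolding F_def using error_meas[OF k]
    by (intro \<nu>.borel_measurable_nn_integral) (simp add: case_prod_beta')
  have diag: "(\<lambda>\<omega>. (\<omega>, \<omega>)) \<in> measurable P (PT \<Otimes>\<^sub>M PN)"
    by (intro measurable_Pair id_PT id_PN)
  show "(\<lambda>\<omega>. \<integral>\<^sup>+u. ennreal ((coeff_error k \<omega> u)\<^sup>2) \<partial>\<nu>) \<in> borel_measurable P"
    using measurable_compose[OF diag F] by (simp add: F_def coeff_error_eq)
  have Wm: "(\<lambda>\<omega>. ennreal ((spacing_weight a b \<phi> n m (times \<omega>) k l)\<^sup>2)) \<in> borel_measurable P" for l
    using measurable_compose[OF id_PT spacing_weight_meas[OF k]] by simp
  show bm: "(\<lambda>\<omega>. \<integral>\<^sup>+u. ennreal ((bias k \<omega> u)\<^sup>2) \<partial>\<nu>) \<in> borel_measurable P"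
  proof -
    have w: "(\<lambda>p. visit_weight k (fst p) v) \<in> borel_measurable (P \<Otimes>\<^sub>M \<nu>)" for v
      by (rule measurable_compose[OF measurable_compose[OF measurable_fst id_PT] visit_weight_meas[OF k]])
    have T: "(\<lambda>p. \<mu> (snd p) (Tv v (fst p))) \<in> borel_measurable (P \<Otimes>\<^sub>M \<nu>)" if "v \<in> V" for v
      using measurable_compose[OF measurable_Pair[OF measurable_snd measurable_compose[OF measurable_fst T_meas[OF that]]] \<mu>_meas] by simp
    have \<beta>: "(\<lambda>p. \<beta> k (snd p)) \<in> borel_measurable (P \<Otimes>\<^sub>M \<nu>)"
      by (rule measurable_compose[OF measurable_snd \<beta>_meas[OF k]])
    have "(\<lambda>p. bias k (fst p) (snd p)) \<in> borel_measurable (P \<Otimes>\<^sub>M \<nu>)"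
      unfolding bias_def by (intro borel_measurable_diff borel_measurable_sum borel_measurable_times w T \<beta>)
    then show ?thesis
      by (intro \<nu>.borel_measurable_nn_integral) (simp add: case_prod_beta')
  qed
  have "(\<integral>\<^sup>+\<omega>. \<integral>\<^sup>+u. ennreal ((coeff_error k \<omega> u)\<^sup>2) \<partial>\<nu> \<partial>P) = (\<integral>\<^sup>+\<omega>. F (\<omega>, \<omega>) \<partial>P)"
    by (simp add: F_def coeff_error_eq)
  also have "\<dots> = (\<integral>\<^sup>+\<omega>. \<integral>\<^sup>+\<omega>'. F (\<omega>, \<omega>') \<partial>P \<partial>P)"
    by (intro nn_integral_diagonal_indep[OF _ _ _ _ indep_PT_PN F]) (simp_all add: sets_PT_PN_subset)
  also have "\<dots> \<le> (\<integral>\<^sup>+\<omega>. (\<integral>\<^sup>+u. ennreal ((bias k \<omega> u)\<^sup>2) \<partial>\<nu>) +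
      ennreal noise_level * (\<Sum>l=1..M. ennreal ((spacing_weight a b \<phi> n m (times \<omega>) k l)\<^sup>2)) \<partial>P)"
  proof (rule nn_integral_mono_AE)
    show "AE \<omega> in P. (\<integral>\<^sup>+\<omega>'. F (\<omega>, \<omega>') \<partial>P) \<le> (\<integral>\<^sup>+u. ennreal ((bias k \<omega> u)\<^sup>2) \<partial>\<nu>) +
      ennreal noise_level * (\<Sum>l=1..M. ennreal ((spacing_weight a b \<phi> n m (times \<omega>) k l)\<^sup>2))"
      using AE_good_visits AE_space
    proof eventually_elim
      case (elim \<omega>)
      then show ?case
        unfolding F_def fst_conv snd_conv by (intro conditional_error_le k) blast+
    qed
  qed
  also have "\<dots> = (\<integral>\<^sup>+\<omega>. \<integral>\<^sup>+u. ennreal ((bias k \<omega> u)\<^sup>2) \<partial>\<nu> \<partial>P) +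
      ennreal noise_level * (\<integral>\<^sup>+\<omega>. (\<Sum>l=1..M. ennreal ((spacing_weight a b \<phi> n m (times \<omega>) k l)\<^sup>2)) \<partial>P)"
    using bm Wm by (simp add: nn_integral_add nn_integral_cmult)
  also have "\<dots> \<le> (\<integral>\<^sup>+\<omega>. \<integral>\<^sup>+u. ennreal ((bias k \<omega> u)\<^sup>2) \<partial>\<nu> \<partial>P) + ennreal noise_level * ennreal (S_sp M / c)"
  proof (intro add_left_mono mult_left_mono expected_weights_le \<phi>_meas k)
    show "(\<integral>\<^sup>+x. ennreal ((\<phi> k x)\<^sup>2) \<partial>lam) \<le> 1"
      using basis_sq_integrable[OF ob k] basis_orthonormal[OF ob k k]
      by (subst nn_integral_eq_integral) (auto simp: power2_eq_square)
  qed simp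
  also have "ennreal noise_level * ennreal (S_sp M / c) = ennreal (noise_level * (S_sp M / c))"
    using noise_level_nonneg by (rule ennreal_mult'[symmetric])
  finally show "(\<integral>\<^sup>+\<omega>. \<integral>\<^sup>+u. ennreal ((coeff_error k \<omega> u)\<^sup>2) \<partial>\<nu> \<partial>P)
    \<le> (\<integral>\<^sup>+\<omega>. \<integral>\<^sup>+u. ennreal ((bias k \<omega> u)\<^sup>2) \<partial>\<nu> \<partial>P) + ennreal (noise_level * (S_sp M / c))" .
qed

end

section \<open>The risk bound\<close>

context estimation
begin

lemma coeff_error_sec:
  assumes k: "1 \<le> k" and w: "\<omega> \<in> space P"
  shows "coeff_error k \<omega> \<in> borel_measurable \<nu>"
proof -
  have "(\<lambda>u. ((\<omega>, \<omega>), u)) \<in> measurable \<nu> ((PT \<Otimes>\<^sub>M PN) \<Otimes>\<^sub>M \<nu>)"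
    using w by (intro measurable_Pair measurable_const measurable_ident) (simp_all add: space_pair_measure)
  from measurable_compose[OF this error_meas[OF k]] show ?thesis
    by (simp add: coeff_error_eq[abs_def])
qed

text \<open>For almost every \<open>u\<close> Pythagoras is applied with the estimated coefficients,
  written as the true ones plus their errors.\<close>

lemma integrated_error_le:
  assumes w: "\<omega> \<in> space P" and K0: "{k. 1 \<le> k \<and> real k \<le> K} = {1..K0}"
  shows "(\<integral>\<^sup>+(u, x). ennreal ((spacing_estimator a b \<phi> n m (\<lambda>i j. T i j \<omega>)
        (observation \<mu> X \<tau> \<eta> \<xi> T \<zeta> \<omega>) K u x - \<mu> u x)\<^sup>2) \<partial>(\<nu> \<Otimes>\<^sub>M lam))
    \<le> (\<Sum>k=1..K0. \<integral>\<^sup>+u. ennreal ((coeff_error k \<omega> u)\<^sup>2) \<partial>\<nu>) +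
      (\<integral>\<^sup>+u. ennreal ((LINT t|lam. (\<mu> u t)\<^sup>2) - (\<Sum>k=1..K0. (\<beta> k u)\<^sup>2)) \<partial>\<nu>)"
proof -
  interpret \<nu>: finite_measure \<nu> by (rule nu)
  interpret Lm: sigma_finite_measure lam by (rule sigma_finite_leb_on)
  interpret NL: pair_sigma_finite \<nu> lam ..
  let ?d = "\<lambda>k u. coeff_error k \<omega> u + \<beta> k u"
  let ?tail = "\<lambda>u. (LINT t|lam. (\<mu> u t)\<^sup>2) - (\<Sum>k=1..K0. (\<beta> k u)\<^sup>2)"
  have est: "spacing_estimator a b \<phi> n m (\<lambda>i j. T i j \<omega>) (observation \<mu> X \<tau> \<eta> \<xi> T \<zeta> \<omega>) K u x
      = (\<Sum>k=1..K0. ?d k u * \<phi> k x)" for u x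
    unfolding spacing_estimator_def K0 coeff_error_def by simp
  have em: "(\<lambda>(u, x). ennreal (((\<Sum>k=1..K0. ?d k u * \<phi> k x) - \<mu> u x)\<^sup>2)) \<in> borel_measurable (\<nu> \<Otimes>\<^sub>M lam)"
  proof -
    have "(\<lambda>p. coeff_error k \<omega> (fst p) + \<beta> k (fst p)) \<in> borel_measurable (\<nu> \<Otimes>\<^sub>M lam)" if "1 \<le> k" for k
      using measurable_compose[OF measurable_fst coeff_error_sec[OF that w]]
        measurable_compose[OF measurable_fst \<beta>_meas[OF that]] by (intro borel_measurable_add)
    moreover have "(\<lambda>p. \<phi> k (snd p)) \<in> borel_measurable (\<nu> \<Otimes>\<^sub>M lam)" if "1 \<le> k" for k
      by (rule measurable_compose[OF measurable_snd \<phi>_meas[OF that]])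
    ultimately have "(\<lambda>p. \<Sum>k=1..K0. ?d k (fst p) * \<phi> k (snd p)) \<in> borel_measurable (\<nu> \<Otimes>\<^sub>M lam)"
      by (intro borel_measurable_sum borel_measurable_times) auto
    then show ?thesis using \<mu>_meas by (simp add: case_prod_beta')
  qed
  note good = AE_section_square_integrable[OF \<nu>.sigma_finite_measure \<mu>_meas \<mu>_int]
  have "(\<integral>\<^sup>+(u, x). ennreal (((\<Sum>k=1..K0. ?d k u * \<phi> k x) - \<mu> u x)\<^sup>2) \<partial>(\<nu> \<Otimes>\<^sub>M lam))
      = (\<integral>\<^sup>+u. \<integral>\<^sup>+x. ennreal (((\<Sum>k=1..K0. ?d k u * \<phi> k x) - \<mu> u x)\<^sup>2) \<partial>lam \<partial>\<nu>)"
    using Lm.nn_integral_fst[OF em] by simp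
  also have "\<dots> = (\<integral>\<^sup>+u. (\<Sum>k=1..K0. ennreal ((coeff_error k \<omega> u)\<^sup>2)) + ennreal (?tail u) \<partial>\<nu>)"
  proof (rule nn_integral_cong_AE)
    show "AE u in \<nu>. (\<integral>\<^sup>+x. ennreal (((\<Sum>k=1..K0. ?d k u * \<phi> k x) - \<mu> u x)\<^sup>2) \<partial>lam)
        = (\<Sum>k=1..K0. ennreal ((coeff_error k \<omega> u)\<^sup>2)) + ennreal (?tail u)"
      using good
    proof eventually_elim
      case (elim u)
      then have m: "\<mu> u \<in> borel_measurable lam" and i: "integrable lam (\<lambda>t. (\<mu> u t)\<^sup>2)" by auto
      have "(\<integral>\<^sup>+x. ennreal (((\<Sum>k=1..K0. ?d k u * \<phi> k x) - \<mu> u x)\<^sup>2) \<partial>lam)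
          = ennreal (LINT x|lam. ((\<Sum>k=1..K0. ?d k u * \<phi> k x) - \<mu> u x)\<^sup>2)"
        by (rule nn_integral_eq_integral[OF L2_expansion(1)[OF ob m i]]) simp
      also have "(LINT x|lam. ((\<Sum>k=1..K0. ?d k u * \<phi> k x) - \<mu> u x)\<^sup>2) = (\<Sum>k=1..K0. (coeff_error k \<omega> u)\<^sup>2) + ?tail u"
        unfolding L2_expansion(2)[OF ob m i] by (simp add: basis_coeff_def)
      also have "ennreal \<dots> = ennreal (\<Sum>k=1..K0. (coeff_error k \<omega> u)\<^sup>2) + ennreal (?tail u)"
        using bessel_inequality[OF ob m i, of K0]
        by (intro ennreal_plus sum_nonneg) (auto simp: basis_coeff_def)
      also have "ennreal (\<Sum>k=1..K0. (coeff_error k \<omega> u)\<^sup>2) = (\<Sum>k=1..K0. ennreal ((coeff_error k \<omega> u)\<^sup>2))"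
        by (rule sum_ennreal[symmetric]) simp
      finally show ?case .
    qed
  qed
  also have "\<dots> = (\<integral>\<^sup>+u. (\<Sum>k=1..K0. ennreal ((coeff_error k \<omega> u)\<^sup>2)) \<partial>\<nu>) + (\<integral>\<^sup>+u. ennreal (?tail u) \<partial>\<nu>)"
  proof (rule nn_integral_add)
    show "(\<lambda>u. \<Sum>k=1..K0. ennreal ((coeff_error k \<omega> u)\<^sup>2)) \<in> borel_measurable \<nu>"
    proof (rule borel_measurable_sum)
      fix k assume "k \<in> {1..K0}"
      then show "(\<lambda>u. ennreal ((coeff_error k \<omega> u)\<^sup>2)) \<in> borel_measurable \<nu>"
        using coeff_error_sec[of k \<omega>] w by simp
    qed
    have "(\<lambda>(u, t). (\<mu> u t)\<^sup>2) \<in> borel_measurable (\<nu> \<Otimes>\<^sub>M lam)"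
      using \<mu>_meas by (simp add: case_prod_beta')
    from Lm.borel_measurable_lebesgue_integral[OF this]
    have "(\<lambda>u. ?tail u) \<in> borel_measurable \<nu>"
      by (intro borel_measurable_diff borel_measurable_sum borel_measurable_power \<beta>_meas) auto
    then show "(\<lambda>u. ennreal (?tail u)) \<in> borel_measurable \<nu>" by simp
  qed
  also have "(\<integral>\<^sup>+u. (\<Sum>k=1..K0. ennreal ((coeff_error k \<omega> u)\<^sup>2)) \<partial>\<nu>)
      = (\<Sum>k=1..K0. \<integral>\<^sup>+u. ennreal ((coeff_error k \<omega> u)\<^sup>2) \<partial>\<nu>)"
  proof (rule nn_integral_sum)
    fix k assume "k \<in> {1..K0}"
    then show "(\<lambda>u. ennreal ((coeff_error k \<omega> u)\<^sup>2)) \<in> borel_measurable \<nu>"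
      using coeff_error_sec[of k \<omega>] w by simp
  qed
  finally show ?thesis unfolding est by simp
qed

text \<open>A real level \<open>K\<close> retains the first floor(K) coefficients. Their number is
  at most \<open>K\<close>, and every omitted index exceeds \<open>K\<close>, so both the noise part
  and the tail are bounded by their expressions at \<open>K\<close> itself.\<close>

lemma spacing_risk_le:
  assumes S: "\<And>t. t \<in> {a..b} \<Longrightarrow> (\<integral>\<^sup>+u. ennreal ((\<mu> u t)\<^sup>2) \<partial>\<nu>) \<le> ennreal S" and S0: "0 \<le> S"
    and L: "L \<in> borel_measurable \<nu>" "\<And>u. 0 \<le> L u" "(\<integral>\<^sup>+u. ennreal ((L u)\<^sup>2) \<partial>\<nu>) \<le> ennreal L2" "0 \<le> L2"
    and hold: "\<And>u t t'. t \<in> {a..b} \<Longrightarrow> t' \<in> {a..b} \<Longrightarrow> \<bar>\<mu> u t - \<mu> u t'\<bar> \<le> L u * \<bar>t - t'\<bar> powr \<alpha>"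
    and \<alpha>: "0 < \<alpha>" "\<alpha> \<le> 1" and s: "0 < s" "0 \<le> Cs"
    and sm: "summable (\<lambda>k. real (Suc k) powr (2 * s) * L2_norm_sq \<nu> (\<beta> (Suc k)))"
      "(\<Sum>k. real (Suc k) powr (2 * s) * L2_norm_sq \<nu> (\<beta> (Suc k))) \<le> Cs"
    and K: "0 < K"
  shows "spacing_risk a b \<nu> \<mu> X \<tau> \<eta> \<phi> n m P \<xi> T \<zeta> K \<le>
    ennreal (risk_bound \<alpha> s (noise_level / c) (12 * L2 / c powr (2 * \<alpha> + 1)) (8 * S / c) Cs M K)"
proof -
  define K0 where "K0 = nat \<lfloor>K\<rfloor>"
  have K0: "{k. 1 \<le> k \<and> real k \<le> K} = {1..K0}"
    using K by (auto simp: K0_def le_nat_floor) linarith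
  have K1: "K < real (Suc K0)" "real K0 \<le> K" using K by (auto simp: K0_def) linarith+
  interpret \<nu>: finite_measure \<nu> by (rule nu)
  let ?nl = "noise_level * (S_sp M / c)"
  let ?B = "2 * L2 / c powr (2 * \<alpha> + 1) * (2 * real h / (real M + 1)) powr (2 * \<alpha>) + 8 * S / c * (real h / (real M + 1))"
  let ?e = "\<lambda>k \<omega>. \<integral>\<^sup>+u. ennreal ((coeff_error k \<omega> u)\<^sup>2) \<partial>\<nu>"
  let ?b = "\<lambda>k \<omega>. \<integral>\<^sup>+u. ennreal ((bias k \<omega> u)\<^sup>2) \<partial>\<nu>"
  have "spacing_risk a b \<nu> \<mu> X \<tau> \<eta> \<phi> n m P \<xi> T \<zeta> K \<le> (\<integral>\<^sup>+\<omega>. (\<Sum>k=1..K0. ?e k \<omega>) + ennreal (Cs * K powr (- 2 * s)) \<partial>P)"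
    unfolding spacing_risk_def
  proof (rule nn_integral_mono)
    fix \<omega> assume w: "\<omega> \<in> space P"
    show "(\<integral>\<^sup>+(u, x). ennreal ((spacing_estimator a b \<phi> n m (\<lambda>i j. T i j \<omega>)
        (observation \<mu> X \<tau> \<eta> \<xi> T \<zeta> \<omega>) K u x - \<mu> u x)\<^sup>2) \<partial>(\<nu> \<Otimes>\<^sub>M lam)) \<le> (\<Sum>k=1..K0. ?e k \<omega>) + ennreal (Cs * K powr (- 2 * s))"
      using truncation_tail[OF \<nu>.sigma_finite_measure ob \<mu>_meas \<mu>_int s(1) sm K K1(1)]
      by (intro order_trans[OF integrated_error_le[OF w K0]] add_left_mono)
  qed
  also have "\<dots> = (\<Sum>k=1..K0. \<integral>\<^sup>+\<omega>. ?e k \<omega> \<partial>P) + ennreal (Cs * K powr (- 2 * s))"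
  proof -
    have m: "?e k \<in> borel_measurable P" if "k \<in> {1..K0}" for k
      using expected_coeff_error_le(2)[of k] that by simp
    have "(\<integral>\<^sup>+\<omega>. (\<Sum>k=1..K0. ?e k \<omega>) + ennreal (Cs * K powr (- 2 * s)) \<partial>P)
        = (\<integral>\<^sup>+\<omega>. (\<Sum>k=1..K0. ?e k \<omega>) \<partial>P) + (\<integral>\<^sup>+\<omega>. ennreal (Cs * K powr (- 2 * s)) \<partial>P)"
      by (intro nn_integral_add borel_measurable_sum m) auto
    also have "(\<integral>\<^sup>+\<omega>. (\<Sum>k=1..K0. ?e k \<omega>) \<partial>P) = (\<Sum>k=1..K0. \<integral>\<^sup>+\<omega>. ?e k \<omega> \<partial>P)"
      by (rule nn_integral_sum) (rule m)
    finally show ?thesis by (simp add: emeasure_space_1)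
  qed
  also have "\<dots> \<le> (\<Sum>k=1..K0. (\<integral>\<^sup>+\<omega>. ?b k \<omega> \<partial>P) + ennreal ?nl) + ennreal (Cs * K powr (- 2 * s))"
    by (intro add_right_mono sum_mono expected_coeff_error_le(1)) simp
  also have "(\<Sum>k=1..K0. (\<integral>\<^sup>+\<omega>. ?b k \<omega> \<partial>P) + ennreal ?nl) = (\<Sum>k=1..K0. \<integral>\<^sup>+\<omega>. ?b k \<omega> \<partial>P) + ennreal (real K0 * ?nl)"
  proof -
    have "0 \<le> ?nl" using noise_level_nonneg c_pos S_sp_pos[of M] by simp
    then have "(\<Sum>k=1..K0. ennreal ?nl) = ennreal (\<Sum>k=1..K0. ?nl)" by (intro sum_ennreal)
    then show ?thesis by (simp add: sum.distrib)
  qed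
  also have "(\<Sum>k=1..K0. \<integral>\<^sup>+\<omega>. ?b k \<omega> \<partial>P) = (\<integral>\<^sup>+\<omega>. (\<Sum>k=1..K0. ?b k \<omega>) \<partial>P)"
    by (rule nn_integral_sum[symmetric], rule expected_coeff_error_le(3)) simp
  also have "\<dots> \<le> (\<integral>\<^sup>+\<omega>. \<integral>\<^sup>+x. \<integral>\<^sup>+u. ennreal ((smoothed (\<mu> u) \<omega> x - \<mu> u x)\<^sup>2) \<partial>\<nu> \<partial>lam \<partial>P)"
    by (intro nn_integral_mono total_bias_le)
  also have "\<dots> \<le> ennreal ?B"
    by (rule expected_bias_le[OF \<mu>_sec S S0 L hold \<alpha>])
  finally have "spacing_risk a b \<nu> \<mu> X \<tau> \<eta> \<phi> n m P \<xi> T \<zeta> K \<le> ennreal ?B + ennreal (real K0 * ?nl) + ennreal (Cs * K powr (- 2 * s))"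
    by (simp add: add_right_mono)
  also have "\<dots> = ennreal (?B + real K0 * ?nl + Cs * K powr (- 2 * s))"
  proof -
    have "0 \<le> ?B" using L(4) S0 c_pos by simp
    moreover have "0 \<le> real K0 * ?nl" using noise_level_nonneg c_pos S_sp_pos[of M] by simp
    moreover have "0 \<le> Cs * K powr (- 2 * s)" using s by simp
    ultimately show ?thesis by (metis add_nonneg_nonneg ennreal_plus)
  qed
  also have "\<dots> \<le> ennreal (risk_bound \<alpha> s (noise_level / c) (12 * L2 / c powr (2 * \<alpha> + 1)) (8 * S / c) Cs M K)"
  proof (rule ennreal_leI)
    \<comment> \<open>Passage to the stated constants: \<open>K0\<close> grows to \<open>K\<close>,
      the factor 2 in front of \<open>L2\<close> to 12, and \<open>h\<close> to
      \<open>2 * h + 1\<close>.\<close>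
    have "real K0 * ?nl \<le> K * ?nl"
      using K1 noise_level_nonneg c_pos S_sp_pos[of M] by (intro mult_right_mono) auto
    moreover have "2 * L2 / c powr (2 * \<alpha> + 1) * (2 * real h / (real M + 1)) powr (2 * \<alpha>)
        \<le> 12 * L2 / c powr (2 * \<alpha> + 1) * (2 * real h / (real M + 1)) powr (2 * \<alpha>)"
      using L(4) by (intro mult_right_mono divide_right_mono) auto
    moreover have "8 * S / c * (real h / (real M + 1)) \<le> 8 * S / c * ((2 * real h + 1) / (real M + 1))"
      using S0 c_pos by (intro mult_left_mono divide_right_mono) auto
    ultimately show "?B + real K0 * ?nl + Cs * K powr (- 2 * s)
        \<le> risk_bound \<alpha> s (noise_level / c) (12 * L2 / c powr (2 * \<alpha> + 1)) (8 * S / c) Cs M K"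
      unfolding risk_bound_def remainder_sp_def by (simp add: mult_ac)
  qed
  finally show ?thesis .
qed

end

section \<open>From the hypotheses of the theorem to those of the locales\<close>

lemma AE_covariance_le:
  fixes X :: "'x \<Rightarrow> 'u \<Rightarrow> real \<Rightarrow> real"
  assumes Q: "sigma_finite_measure Q" and nu: "sigma_finite_measure \<nu>"
    and X: "(\<lambda>(x, u, t). X x u t) \<in> borel_measurable (Q \<Otimes>\<^sub>M (\<nu> \<Otimes>\<^sub>M leb_on a b))"
    and fin: "(\<integral>\<^sup>+x. (\<integral>\<^sup>+(u, t). ennreal ((X x u t)\<^sup>2) \<partial>(\<nu> \<Otimes>\<^sub>M leb_on a b)) \<partial>Q) < \<infinity>"
    and \<Gamma>: "\<And>t. t \<in> {a..b} \<Longrightarrow> cov_kernel Q \<nu> X t t \<le> \<Gamma>"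
  shows "AE t in leb_on a b. (\<integral>\<^sup>+u. \<integral>\<^sup>+x. ennreal ((X x u t)\<^sup>2) \<partial>Q \<partial>\<nu>) \<le> ennreal \<Gamma>"
proof -
  let ?lam = "leb_on a b"
  interpret Q: sigma_finite_measure Q by (rule Q)
  interpret \<nu>: sigma_finite_measure \<nu> by (rule nu)
  interpret Lm: sigma_finite_measure ?lam by (rule sigma_finite_leb_on)
  interpret NL: pair_sigma_finite \<nu> ?lam ..
  interpret QL: pair_sigma_finite Q ?lam ..
  interpret QN: pair_sigma_finite Q \<nu> ..
  have joint: "(\<lambda>p. ennreal ((X (fst (fst p)) (snd p) (snd (fst p)))\<^sup>2)) \<in> borel_measurable ((Q \<Otimes>\<^sub>M ?lam) \<Otimes>\<^sub>M \<nu>)"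
  proof -
    have "(\<lambda>p. (fst (fst p), snd p, snd (fst p))) \<in> measurable ((Q \<Otimes>\<^sub>M ?lam) \<Otimes>\<^sub>M \<nu>) (Q \<Otimes>\<^sub>M (\<nu> \<Otimes>\<^sub>M ?lam))"
      by measurable
    from measurable_compose[OF this X] show ?thesis by simp
  qed
  have inner: "(\<lambda>(x, t). \<integral>\<^sup>+u. ennreal ((X x u t)\<^sup>2) \<partial>\<nu>) \<in> borel_measurable (Q \<Otimes>\<^sub>M ?lam)"
    using \<nu>.borel_measurable_nn_integral[of "\<lambda>q u. ennreal ((X (fst q) u (snd q))\<^sup>2)" "Q \<Otimes>\<^sub>M ?lam"] joint
    by (simp add: case_prod_beta')
  have "(\<integral>\<^sup>+t. \<integral>\<^sup>+x. \<integral>\<^sup>+u. ennreal ((X x u t)\<^sup>2) \<partial>\<nu> \<partial>Q \<partial>?lam) = (\<integral>\<^sup>+x. \<integral>\<^sup>+t. \<integral>\<^sup>+u. ennreal ((X x u t)\<^sup>2) \<partial>\<nu> \<partial>?lam \<partial>Q)"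
    by (rule QL.Fubini'[OF inner])
  also have "\<dots> = (\<integral>\<^sup>+x. (\<integral>\<^sup>+(u, t). ennreal ((X x u t)\<^sup>2) \<partial>(\<nu> \<Otimes>\<^sub>M ?lam)) \<partial>Q)"
  proof (rule nn_integral_cong)
    fix x assume x: "x \<in> space Q"
    have "(\<lambda>(u, t). ennreal ((X x u t)\<^sup>2)) \<in> borel_measurable (\<nu> \<Otimes>\<^sub>M ?lam)"
      using measurable_compose[OF measurable_Pair1'[OF x] X] by (simp add: case_prod_beta')
    from NL.nn_integral_snd[OF this]
    show "(\<integral>\<^sup>+t. \<integral>\<^sup>+u. ennreal ((X x u t)\<^sup>2) \<partial>\<nu> \<partial>?lam) = (\<integral>\<^sup>+(u, t). ennreal ((X x u t)\<^sup>2) \<partial>(\<nu> \<Otimes>\<^sub>M ?lam))"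
      by simp
  qed
  finally have fin': "(\<integral>\<^sup>+t. \<integral>\<^sup>+x. \<integral>\<^sup>+u. ennreal ((X x u t)\<^sup>2) \<partial>\<nu> \<partial>Q \<partial>?lam) \<noteq> \<infinity>"
    using fin by simp
  have outer: "(\<lambda>t. \<integral>\<^sup>+x. \<integral>\<^sup>+u. ennreal ((X x u t)\<^sup>2) \<partial>\<nu> \<partial>Q) \<in> borel_measurable ?lam"
    using measurable_compose[OF measurable_pair_swap' inner]
    by (intro Q.borel_measurable_nn_integral) (simp add: case_prod_beta')
  \<comment> \<open>\<open>cov_kernel\<close> is built from Bochner integrals with default value 0,
    so a bound on it is informative where the second moment is finite. Tonelli provides this for
    almost every time.\<close>
  have "AE t in ?lam. (\<integral>\<^sup>+x. \<integral>\<^sup>+u. ennreal ((X x u t)\<^sup>2) \<partial>\<nu> \<partial>Q) \<noteq> \<infinity>"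
    by (rule nn_integral_PInf_AE[OF outer fin'])
  then show ?thesis
    using AE_space
  proof eventually_elim
    case (elim t)
    then have t: "t \<in> {a..b}" by simp
    have "(\<lambda>p. (fst p, snd p, t)) \<in> measurable (Q \<Otimes>\<^sub>M \<nu>) (Q \<Otimes>\<^sub>M (\<nu> \<Otimes>\<^sub>M ?lam))"
      using t by (intro measurable_Pair measurable_fst measurable_snd measurable_const) simp
    from measurable_compose[OF this X]
    have m: "(\<lambda>(x, u). (X x u t)\<^sup>2) \<in> borel_measurable (Q \<Otimes>\<^sub>M \<nu>)" by (simp add: case_prod_beta')
    then have m': "(\<lambda>(x, u). ennreal ((X x u t)\<^sup>2)) \<in> borel_measurable (Q \<Otimes>\<^sub>M \<nu>)" by (simp add: case_prod_beta')
    have nn: "(\<integral>\<^sup>+p. ennreal ((\<lambda>(x, u). (X x u t)\<^sup>2) p) \<partial>(Q \<Otimes>\<^sub>M \<nu>)) = (\<integral>\<^sup>+x. \<integral>\<^sup>+u. ennreal ((X x u t)\<^sup>2) \<partial>\<nu> \<partial>Q)"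
      using \<nu>.nn_integral_fst[OF m'] by (simp add: case_prod_beta')
    have i: "integrable (Q \<Otimes>\<^sub>M \<nu>) (\<lambda>(x, u). (X x u t)\<^sup>2)"
    proof (rule integrableI_nonneg[OF m])
      show "AE p in Q \<Otimes>\<^sub>M \<nu>. 0 \<le> (\<lambda>(x, u). (X x u t)\<^sup>2) p" by (simp add: case_prod_beta')
      show "(\<integral>\<^sup>+p. ennreal ((\<lambda>(x, u). (X x u t)\<^sup>2) p) \<partial>(Q \<Otimes>\<^sub>M \<nu>)) < \<infinity>"
        unfolding nn using elim by (simp add: less_top)
    qed
    have "(\<integral>\<^sup>+u. \<integral>\<^sup>+x. ennreal ((X x u t)\<^sup>2) \<partial>Q \<partial>\<nu>) = (\<integral>\<^sup>+x. \<integral>\<^sup>+u. ennreal ((X x u t)\<^sup>2) \<partial>\<nu> \<partial>Q)"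
      by (rule QN.Fubini'[OF m'])
    also have "\<dots> = ennreal (LINT p|(Q \<Otimes>\<^sub>M \<nu>). (\<lambda>(x, u). (X x u t)\<^sup>2) p)"
      unfolding nn[symmetric] by (rule nn_integral_eq_integral[OF i]) (simp add: case_prod_beta')
    also have "(LINT p|(Q \<Otimes>\<^sub>M \<nu>). (\<lambda>(x, u). (X x u t)\<^sup>2) p) = cov_kernel Q \<nu> X t t"
      using QN.integral_fst'[OF i] by (simp add: cov_kernel_def power2_eq_square)
    also have "ennreal \<dots> \<le> ennreal \<Gamma>" by (rule ennreal_leI[OF \<Gamma>[OF t]])
    finally show ?case .
  qed
qed

text \<open>Joint square integrability yields one time \<open>t0\<close> with a square integrable
  section, and the Hoelder condition carries this to all times with a common bound. The set of norms
  is therefore bounded, and its real-valued \<open>SUP\<close> is a true supremum.\<close>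

lemma section_norms_bounded:
  fixes \<mu> :: "'u \<Rightarrow> real \<Rightarrow> real"
  assumes ab: "a < b" and nu: "sigma_finite_measure \<nu>" and \<alpha>: "0 < \<alpha>"
    and mu: "(\<lambda>(u, t). \<mu> u t) \<in> borel_measurable (\<nu> \<Otimes>\<^sub>M leb_on a b)"
      "integrable (\<nu> \<Otimes>\<^sub>M leb_on a b) (\<lambda>(u, t). (\<mu> u t)\<^sup>2)"
    and L: "L \<in> borel_measurable \<nu>" "\<And>u. 0 \<le> L u" "integrable \<nu> (\<lambda>u. (L u)\<^sup>2)"
    and hold: "\<And>u t t'. t \<in> {a..b} \<Longrightarrow> t' \<in> {a..b} \<Longrightarrow> \<bar>\<mu> u t - \<mu> u t'\<bar> \<le> L u * \<bar>t - t'\<bar> powr \<alpha>"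
    and t: "t \<in> {a..b}"
  shows "(\<integral>\<^sup>+u. ennreal ((\<mu> u t)\<^sup>2) \<partial>\<nu>) \<le> ennreal (SUP t\<in>{a..b}. L2_norm_sq \<nu> (\<lambda>u. \<mu> u t))"
    and "0 \<le> (SUP t\<in>{a..b}. L2_norm_sq \<nu> (\<lambda>u. \<mu> u t))"
proof -
  let ?lam = "leb_on a b"
  interpret \<nu>: sigma_finite_measure \<nu> by (rule nu)
  interpret Lm: sigma_finite_measure ?lam by (rule sigma_finite_leb_on)
  interpret NL: pair_sigma_finite \<nu> ?lam ..
  have sec: "(\<lambda>u. \<mu> u t) \<in> borel_measurable \<nu>" if "t \<in> {a..b}" for t
    using measurable_compose[OF measurable_Pair2' mu(1), of t] that by simp
  have "AE t in ?lam. integrable \<nu> (\<lambda>u. (\<mu> u t)\<^sup>2)"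
    using NL.AE_integrable_snd[OF mu(2)] by simp
  moreover have "emeasure ?lam (space ?lam) \<noteq> 0"
    using ab by (subst emeasure_leb_on) (auto simp: leb_on_def sets_restrict_space)
  ultimately obtain t0 where t0: "t0 \<in> {a..b}" "integrable \<nu> (\<lambda>u. (\<mu> u t0)\<^sup>2)"
  proof -
    assume ae: "AE t in ?lam. integrable \<nu> (\<lambda>u. (\<mu> u t)\<^sup>2)" and pos: "emeasure ?lam (space ?lam) \<noteq> 0"
    have "\<exists>t\<in>space ?lam. integrable \<nu> (\<lambda>u. (\<mu> u t)\<^sup>2)"
    proof (rule ccontr)
      assume n: "\<not> ?thesis"
      have "AE t in ?lam. False" using ae AE_space by eventually_elim (use n in auto)
      then show False using pos AE_iff_measurable[OF sets.top[of ?lam], of "\<lambda>_. False"] by (simp del: space_leb_on)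
    qed
    with that show thesis by auto
  qed
  let ?c = "(b - a) powr \<alpha>"
  have bound: "(\<mu> u t)\<^sup>2 \<le> 2 * (\<mu> u t0)\<^sup>2 + 2 * (?c\<^sup>2 * (L u)\<^sup>2)" if t: "t \<in> {a..b}" for t u
  proof -
    have "\<bar>\<mu> u t - \<mu> u t0\<bar> \<le> L u * \<bar>t - t0\<bar> powr \<alpha>" by (rule hold[OF t t0(1)])
    also have "\<dots> \<le> L u * ?c"
      using t t0(1) \<alpha> L(2) by (intro mult_left_mono powr_mono2) auto
    finally have "(\<mu> u t - \<mu> u t0)\<^sup>2 \<le> (L u * ?c)\<^sup>2"
      by (intro abs_le_square_iff[THEN iffD1]) simp
    moreover have "(\<mu> u t)\<^sup>2 \<le> 2 * (\<mu> u t0)\<^sup>2 + 2 * (\<mu> u t - \<mu> u t0)\<^sup>2"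
      using sum_squares_bound[of "\<mu> u t0" "\<mu> u t - \<mu> u t0"] power2_sum[of "\<mu> u t0" "\<mu> u t - \<mu> u t0"] by simp
    ultimately show ?thesis by (simp add: power_mult_distrib mult.commute)
  qed
  let ?B = "\<lambda>u. 2 * (\<mu> u t0)\<^sup>2 + 2 * (?c\<^sup>2 * (L u)\<^sup>2)"
  have iB: "integrable \<nu> ?B" using t0(2) L(3) by simp
  have it: "integrable \<nu> (\<lambda>u. (\<mu> u t)\<^sup>2)" if "t \<in> {a..b}" for t
    using bound[OF that] sec[OF that] by (intro Bochner_Integration.integrable_bound[OF iB]) (auto intro!: AE_I2)
  have bdd: "bdd_above ((\<lambda>t. L2_norm_sq \<nu> (\<lambda>u. \<mu> u t)) ` {a..b})"
  proof (rule bdd_aboveI2)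
    fix t assume "t \<in> {a..b}"
    then show "L2_norm_sq \<nu> (\<lambda>u. \<mu> u t) \<le> (LINT u|\<nu>. ?B u)"
      unfolding L2_norm_sq_def by (intro integral_mono it iB bound)
  qed
  have le: "L2_norm_sq \<nu> (\<lambda>u. \<mu> u t) \<le> (SUP t\<in>{a..b}. L2_norm_sq \<nu> (\<lambda>u. \<mu> u t))"
    by (rule cSUP_upper[OF t bdd])
  have "(\<integral>\<^sup>+u. ennreal ((\<mu> u t)\<^sup>2) \<partial>\<nu>) = ennreal (L2_norm_sq \<nu> (\<lambda>u. \<mu> u t))"
    unfolding L2_norm_sq_def by (rule nn_integral_eq_integral[OF it[OF t]]) simp
  also have "\<dots> \<le> ennreal (SUP t\<in>{a..b}. L2_norm_sq \<nu> (\<lambda>u. \<mu> u t))" by (rule ennreal_leI[OF le])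
  finally show "(\<integral>\<^sup>+u. ennreal ((\<mu> u t)\<^sup>2) \<partial>\<nu>) \<le> ennreal (SUP t\<in>{a..b}. L2_norm_sq \<nu> (\<lambda>u. \<mu> u t))" .
  have "0 \<le> L2_norm_sq \<nu> (\<lambda>u. \<mu> u t)" unfolding L2_norm_sq_def by (rule integral_nonneg_AE) simp
  with le show "0 \<le> (SUP t\<in>{a..b}. L2_norm_sq \<nu> (\<lambda>u. \<mu> u t))" by linarith
qed

text \<open>Boundedness has to be supplied, since a real-valued \<open>SUP\<close> over an unbounded
  set carries no information.\<close>

lemma abs_le_sup_norm:
  assumes "bounded (f ` A)" "x \<in> A"
  shows "\<bar>f x\<bar> \<le> sup_norm A f"
proof -
  obtain B where "\<And>y. y \<in> A \<Longrightarrow> \<bar>f y\<bar> \<le> B"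
    using assms(1) unfolding bounded_iff by auto
  then show ?thesis
    unfolding sup_norm_def by (intro cSUP_upper assms(2) bdd_aboveI2[of _ _ B])
qed

text \<open>All constants are fixed before the sample, so the last constant depends neither on
  \<open>n\<close> and \<open>m\<close> nor on \<open>P\<close>. The clauses on \<open>K_opt\<close>
  ask for \<open>0 < C1\<close> because \<open>K_opt\<close> divides by \<open>C1\<close>; for
  \<open>C1 = 0\<close> the bound decreases strictly in \<open>K\<close> and has no
  minimizer.\<close>

theorem theorem4:
  fixes a b :: real
    and \<nu> :: "'u::{metric_space, second_countable_topology} measure"
    and \<mu> :: "'u \<Rightarrow> real \<Rightarrow> real"
    and Q :: "'x measure" and X :: "'x \<Rightarrow> 'u \<Rightarrow> real \<Rightarrow> real"
    and g \<tau> :: "real \<Rightarrow> real"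
    and E :: "'e measure" and \<eta> :: "'e \<Rightarrow> 'u \<Rightarrow> real"
    and \<phi> :: "nat \<Rightarrow> real \<Rightarrow> real"
    and \<alpha> s Cs C1 C2 C3 g_min :: real
    and L_\<mu> :: "'u \<Rightarrow> real"
    and m_max :: nat
  assumes interval: "a < b"
    and nu: "sets \<nu> = sets borel" "finite_measure \<nu>"
    and mu_L2: "(\<lambda>(u, t). \<mu> u t) \<in> borel_measurable (\<nu> \<Otimes>\<^sub>M leb_on a b)"
      "integrable (\<nu> \<Otimes>\<^sub>M leb_on a b) (\<lambda>(u, t). (\<mu> u t)\<^sup>2)"
    and X_field: "prob_space Q"
      "(\<lambda>(x, u, t). X x u t) \<in> borel_measurable (Q \<Otimes>\<^sub>M (\<nu> \<Otimes>\<^sub>M leb_on a b))"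
      "(\<integral>\<^sup>+x. (\<integral>\<^sup>+(u, t). ennreal ((X x u t)\<^sup>2) \<partial>(\<nu> \<Otimes>\<^sub>M leb_on a b)) \<partial>Q) < \<infinity>"
      "\<forall>u. \<forall>t\<in>{a..b}. integrable Q (\<lambda>x. X x u t) \<and> (LINT x|Q. X x u t) = 0"
    and g_density: "\<exists>L. L-lipschitz_on {a..b} g" "\<forall>t\<in>{a..b}. 0 < g t"
    and tau: "\<tau> \<in> borel_measurable (leb_on a b)" "\<forall>t\<in>{a..b}. 0 \<le> \<tau> t"
      "bounded (\<tau> ` {a..b})"
    and eta_field: "prob_space E" "(\<lambda>(e, u). \<eta> e u) \<in> borel_measurable (E \<Otimes>\<^sub>M \<nu>)"
      "\<forall>u. integrable E (\<lambda>e. \<eta> e u) \<and> (LINT e|E. \<eta> e u) = 0"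
      "\<forall>u. prob_space.variance E (\<lambda>e. \<eta> e u) = 1"
    and basis: "orthonormal_basis_L2 (leb_on a b) \<phi>"
      "\<forall>k\<ge>1. \<exists>L. L-lipschitz_on {a..b} (\<phi> k)"
    and holder: "0 < \<alpha>" "\<alpha> \<le> 1" "L_\<mu> \<in> borel_measurable borel" "\<forall>u. 0 \<le> L_\<mu> u"
      "integrable \<nu> (\<lambda>u. (L_\<mu> u)\<^sup>2)"
      "\<forall>u. \<forall>t\<in>{a..b}. \<forall>t'\<in>{a..b}. \<bar>\<mu> u t - \<mu> u t'\<bar> \<le> L_\<mu> u * \<bar>t - t'\<bar> powr \<alpha>"
    and smooth: "0 < s" "0 < Cs"
      "summable (\<lambda>k. real (Suc k) powr (2 * s) * L2_norm_sq \<nu> (basis_coeff a b \<phi> \<mu> (Suc k)))"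
      "(\<Sum>k. real (Suc k) powr (2 * s) * L2_norm_sq \<nu> (basis_coeff a b \<phi> \<mu> (Suc k))) \<le> Cs"
    and Gamma_cont: "continuous_on ({a..b} \<times> {a..b}) (\<lambda>(t, t'). cov_kernel Q \<nu> X t t')"
    and g_min: "g_min = (INF t\<in>{a..b}. g t)"
    and C1: "C1 = (real m_max * sup_norm ({a..b} \<times> {a..b}) (\<lambda>(t, t'). cov_kernel Q \<nu> X t t')
                   + (sup_norm {a..b} \<tau>)\<^sup>2 * measure \<nu> UNIV) / g_min"
    and C2: "C2 = 12 * L2_norm_sq \<nu> L_\<mu> / g_min powr (2 * \<alpha> + 1)"
    and C3: "C3 = 8 * (SUP t\<in>{a..b}. L2_norm_sq \<nu> (\<lambda>u. \<mu> u t)) / g_min"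
  shows
    "(\<forall>n\<ge>1. \<forall>m (P :: 'w measure) \<xi> T \<zeta>.
        (\<forall>i\<in>{1..n}. 1 \<le> m i \<and> m i \<le> m_max) \<longrightarrow>
        longitudinal_sample a b Q g E n m P \<xi> T \<zeta> \<longrightarrow>
        (let M = total_visits n m; K_star = K_opt s C1 Cs M;
             risk = spacing_risk a b \<nu> \<mu> X \<tau> \<eta> \<phi> n m P \<xi> T \<zeta>;
             bound = risk_bound \<alpha> s C1 C2 C3 Cs M
         in (\<forall>K::nat. 1 \<le> K \<longrightarrow> risk (real K) \<le> ennreal (bound (real K))) \<and>
            (0 < C1 \<longrightarrow>
               0 < K_star \<and> (\<forall>K>0. K \<noteq> K_star \<longrightarrow> bound K_star < bound K) \<and>
               risk K_star \<le> ennreal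
                 ((2 * s + 1) / (2 * s) * (2 * s * Cs * C1 powr (2 * s)) powr (1 / (2 * s + 1))
                    * (real M * S_sp M) powr (2 * s / (2 * s + 1))
                    * real M powr (- (2 * s / (2 * s + 1)))
                  + remainder_sp \<alpha> C2 C3 M)))) \<and>
     (0 < C1 \<longrightarrow> s / (2 * s + 1) < \<alpha> \<longrightarrow>
       (\<exists>C>0. \<forall>n\<ge>1. \<forall>m (P :: 'w measure) \<xi> T \<zeta>.
          (\<forall>i\<in>{1..n}. 1 \<le> m i \<and> m i \<le> m_max) \<longrightarrow>
          longitudinal_sample a b Q g E n m P \<xi> T \<zeta> \<longrightarrow>
          (let M = total_visits n m
           in spacing_risk a b \<nu> \<mu> X \<tau> \<eta> \<phi> n m P \<xi> T \<zeta> (K_opt s C1 Cs M)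
                \<le> ennreal (C * real M powr (- (2 * s / (2 * s + 1)))))))"
proof -
  interpret Q: prob_space Q by (rule X_field(1))
  interpret E: prob_space E by (rule eta_field(1))
  interpret \<nu>: finite_measure \<nu> by (rule nu(2))
  define \<Gamma> where "\<Gamma> = sup_norm ({a..b} \<times> {a..b}) (\<lambda>(t, t'). cov_kernel Q \<nu> X t t')"
  define \<tau>m where "\<tau>m = sup_norm {a..b} \<tau>"
  define S where "S = (SUP t\<in>{a..b}. L2_norm_sq \<nu> (\<lambda>u. \<mu> u t))"
  let ?L2 = "L2_norm_sq \<nu> L_\<mu>"
  have aI: "a \<in> {a..b}" using interval by simp
  have space_\<nu>: "space \<nu> = UNIV" using sets_eq_imp_space_eq[OF nu(1)] by simp
  have L_meas: "L_\<mu> \<in> borel_measurable \<nu>"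
    using holder(3) nu(1) by (simp cong: measurable_cong_sets)
  have L2_nonneg: "0 \<le> ?L2" unfolding L2_norm_sq_def by (rule integral_nonneg_AE) simp
  have L2: "(\<integral>\<^sup>+u. ennreal ((L_\<mu> u)\<^sup>2) \<partial>\<nu>) \<le> ennreal ?L2"
    unfolding L2_norm_sq_def using holder(5) by (subst nn_integral_eq_integral) auto
  have hold: "\<bar>\<mu> u t - \<mu> u t'\<bar> \<le> L_\<mu> u * \<bar>t - t'\<bar> powr \<alpha>" if "t \<in> {a..b}" "t' \<in> {a..b}" for u t t'
    using holder(6) that by blast
  have L_nonneg: "0 \<le> L_\<mu> u" for u using holder(4) by blast
  note S_facts = section_norms_bounded[OF interval \<nu>.sigma_finite_measure holder(1) mu_L2 L_meas L_nonneg holder(5) hold]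
  have S: "(\<integral>\<^sup>+u. ennreal ((\<mu> u t)\<^sup>2) \<partial>\<nu>) \<le> ennreal S" if "t \<in> {a..b}" for t
    unfolding S_def by (rule S_facts(1)[OF _ _ that])
  have S0: "0 \<le> S" unfolding S_def by (rule S_facts(2)[OF _ _ aI])
  obtain Lg where "Lg-lipschitz_on {a..b} g" using g_density(1) by blast
  then have "continuous_on {a..b} g" by (rule lipschitz_on_continuous_on)
  \<comment> \<open>A continuous density attains its infimum on the compact interval, so pointwise
    positivity makes \<open>g_min\<close> positive.\<close>
  then obtain t0 where t0: "t0 \<in> {a..b}" "\<And>t. t \<in> {a..b} \<Longrightarrow> g t0 \<le> g t"
    using continuous_attains_inf[of "{a..b}" g] aI by auto
  have g_le: "g_min \<le> g t" if "t \<in> {a..b}" for t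
    unfolding g_min using t0(2) that by (intro cINF_lower bdd_belowI2[of _ "g t0"])
  have "g t0 \<le> g_min"
    unfolding g_min using t0(2) aI by (intro cINF_greatest) auto
  then have g_pos: "0 < g_min" using g_density(2) t0(1) by force
  \<comment> \<open>Continuity on the compact square makes the sup norm finite, so that it dominates
    the kernel on the diagonal.\<close>
  have "bounded ((\<lambda>(t, t'). cov_kernel Q \<nu> X t t') ` ({a..b} \<times> {a..b}))"
    using compact_continuous_image[OF Gamma_cont] by (intro compact_imp_bounded) (simp add: compact_Times)
  from abs_le_sup_norm[OF this] have \<Gamma>: "\<bar>cov_kernel Q \<nu> X t t\<bar> \<le> \<Gamma>" if "t \<in> {a..b}" for t
    using that by (force simp: \<Gamma>_def)
  have \<Gamma>0: "0 \<le> \<Gamma>" using \<Gamma>[OF aI] by linarith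
  have \<tau>_le: "\<bar>\<tau> t\<bar> \<le> \<tau>m" if "t \<in> {a..b}" for t
    unfolding \<tau>m_def by (rule abs_le_sup_norm[OF tau(3) that])
  have cov: "AE t in leb_on a b. (\<integral>\<^sup>+u. \<integral>\<^sup>+x. ennreal ((X x u t)\<^sup>2) \<partial>Q \<partial>\<nu>) \<le> ennreal \<Gamma>"
  proof (rule AE_covariance_le[OF Q.sigma_finite_measure_axioms \<nu>.sigma_finite_measure X_field(2,3)])
    fix t assume "t \<in> {a..b}"
    from \<Gamma>[OF this] show "cov_kernel Q \<nu> X t t \<le> \<Gamma>" by linarith
  qed
  have \<eta>_var: "(LINT e|E. (\<eta> e u)\<^sup>2) = 1" for u
    using eta_field(3,4) by simp
  \<comment> \<open>If the square were not integrable, its Bochner integral would be 0 instead of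
    1.\<close>
  have \<eta>_sq: "integrable E (\<lambda>e. (\<eta> e u)\<^sup>2)" for u
  proof (rule ccontr)
    assume "\<not> ?thesis"
    from not_integrable_integral_eq[OF this] \<eta>_var[of u] show False by simp
  qed
  have C1_eq: "C1 = (real m_max * \<Gamma> + \<tau>m\<^sup>2 * measure \<nu> (space \<nu>)) / g_min"
    unfolding C1 \<Gamma>_def \<tau>m_def space_\<nu> by simp
  have C2_eq: "C2 = 12 * ?L2 / g_min powr (2 * \<alpha> + 1)" by (rule C2)
  have C3_eq: "C3 = 8 * S / g_min" unfolding C3 S_def by simp
  have C2_nonneg: "0 \<le> C2" and C3_nonneg: "0 \<le> C3"
    using L2_nonneg S0 g_pos by (simp_all add: C2_eq C3_eq)
  have risk: "spacing_risk a b \<nu> \<mu> X \<tau> \<eta> \<phi> n m P \<xi> T \<zeta> K \<le> ennreal (risk_bound \<alpha> s C1 C2 C3 Cs (total_visits n m) K)"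
    and M: "1 \<le> total_visits n m"
    if n: "1 \<le> n" and m: "\<forall>i\<in>{1..n}. 1 \<le> m i \<and> m i \<le> m_max"
      and samp: "longitudinal_sample a b Q g E n m P \<xi> T \<zeta>" and K: "0 < K"
    for n m K \<xi> T \<zeta> and P :: "'w measure"
  proof -
    have "(1, 1) \<in> visit_set n m" using n m by (auto simp: visit_set_def)
    then have V: "visit_set n m \<noteq> {}" by blast
    then show "1 \<le> total_visits n m"
      using card_gt_0_iff[of "visit_set n m"] by (simp add: card_visit_set)
    note samp' = samp[unfolded longitudinal_sample_def]
    interpret estimation P a b g_min g n m T Q E \<nu> X \<eta> \<tau> \<xi> \<zeta> m_max \<Gamma> \<tau>m \<phi> \<mu>
    proof (intro estimation.intro sample.intro ranked_times.intro visit_times.intro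
        visit_times_axioms.intro sample_axioms.intro estimation_axioms.intro)
      fix v assume v: "v \<in> visit_set n m"
      show "distributed P (leb_on a b) ((\<lambda>(i, j). T i j) v) (\<lambda>t. ennreal (g t))"
        using samp' v by (cases v) auto
      show "distr P E ((\<lambda>(i, j). \<zeta> i j) v) = E"
        using samp' v by (cases v) auto
    qed (use samp' interval V g_pos g_le nu X_field cov eta_field \<eta>_sq \<eta>_var tau \<tau>_le \<Gamma>0 m basis mu_L2 in
        \<open>auto intro: X_field eta_field\<close>)
    have nl: "noise_level / g_min = C1" by (simp add: noise_level_def C1_eq)
    show "spacing_risk a b \<nu> \<mu> X \<tau> \<eta> \<phi> n m P \<xi> T \<zeta> K \<le> ennreal (risk_bound \<alpha> s C1 C2 C3 Cs (total_visits n m) K)"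
      using spacing_risk_le[OF S S0 L_meas L_nonneg L2 L2_nonneg hold holder(1,2) smooth(1) less_imp_le[OF smooth(2)]
          smooth(3,4) K]
      unfolding nl C2_eq C3_eq .
  qed
  have part1: "let M = total_visits n m; K_star = K_opt s C1 Cs M;
             risk = spacing_risk a b \<nu> \<mu> X \<tau> \<eta> \<phi> n m P \<xi> T \<zeta>;
             bound = risk_bound \<alpha> s C1 C2 C3 Cs M
         in (\<forall>K::nat. 1 \<le> K \<longrightarrow> risk (real K) \<le> ennreal (bound (real K))) \<and>
            (0 < C1 \<longrightarrow>
               0 < K_star \<and> (\<forall>K>0. K \<noteq> K_star \<longrightarrow> bound K_star < bound K) \<and>
               risk K_star \<le> ennreal
                 ((2 * s + 1) / (2 * s) * (2 * s * Cs * C1 powr (2 * s)) powr (1 / (2 * s + 1))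
                    * (real M * S_sp M) powr (2 * s / (2 * s + 1))
                    * real M powr (- (2 * s / (2 * s + 1)))
                  + remainder_sp \<alpha> C2 C3 M))"
    if "1 \<le> n" "\<forall>i\<in>{1..n}. 1 \<le> m i \<and> m i \<le> m_max" "longitudinal_sample a b Q g E n m P \<xi> T \<zeta>"
    for n m \<xi> T \<zeta> and P :: "'w measure"
  proof -
    \<comment> \<open>\<open>M\<close> was proved together with \<open>risk\<close> and shares its
      truncation level; the value 1 fills that slot.\<close>
    note K = K_opt_bound[OF smooth(1,2) _ M[OF that, of 1], of C1]
    show ?thesis
      unfolding Let_def
    proof (intro conjI allI impI)
      fix K :: nat assume "1 \<le> K"
      then show "spacing_risk a b \<nu> \<mu> X \<tau> \<eta> \<phi> n m P \<xi> T \<zeta> (real K) \<le>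
          ennreal (risk_bound \<alpha> s C1 C2 C3 Cs (total_visits n m) (real K))"
        by (intro risk[OF that]) simp
    next
      assume C1: "0 < C1"
      show Kp: "0 < K_opt s C1 Cs (total_visits n m)" using K(1)[OF C1] by simp
      show "risk_bound \<alpha> s C1 C2 C3 Cs (total_visits n m) (K_opt s C1 Cs (total_visits n m))
          < risk_bound \<alpha> s C1 C2 C3 Cs (total_visits n m) K'"
        if "0 < K'" "K' \<noteq> K_opt s C1 Cs (total_visits n m)" for K'
        using K(2)[OF C1] that by simp
      show "spacing_risk a b \<nu> \<mu> X \<tau> \<eta> \<phi> n m P \<xi> T \<zeta> (K_opt s C1 Cs (total_visits n m)) \<le> ennreal
          ((2 * s + 1) / (2 * s) * (2 * s * Cs * C1 powr (2 * s)) powr (1 / (2 * s + 1))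
            * (real (total_visits n m) * S_sp (total_visits n m)) powr (2 * s / (2 * s + 1))
            * real (total_visits n m) powr (- (2 * s / (2 * s + 1)))
          + remainder_sp \<alpha> C2 C3 (total_visits n m))"
        using risk[OF that Kp] K(3)[OF C1, of \<alpha> C2 C3] by simp
    qed
  qed
  have part2: "\<exists>C>0. \<forall>n\<ge>1. \<forall>m (P :: 'w measure) \<xi> T \<zeta>.
          (\<forall>i\<in>{1..n}. 1 \<le> m i \<and> m i \<le> m_max) \<longrightarrow>
          longitudinal_sample a b Q g E n m P \<xi> T \<zeta> \<longrightarrow>
          (let M = total_visits n m
           in spacing_risk a b \<nu> \<mu> X \<tau> \<eta> \<phi> n m P \<xi> T \<zeta> (K_opt s C1 Cs M)
                \<le> ennreal (C * real M powr (- (2 * s / (2 * s + 1)))))"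
    if C1: "0 < C1" and s\<alpha>: "s / (2 * s + 1) < \<alpha>"
  proof -
    obtain D where D: "0 < D"
      "\<And>M. 1 \<le> M \<Longrightarrow> remainder_sp \<alpha> C2 C3 M \<le> D * real M powr (- (2 * s / (2 * s + 1)))"
      using remainder_sp_bounded[OF smooth(1) holder(1) s\<alpha> C2_nonneg C3_nonneg] by blast
    define A where "A = (2 * s + 1) / (2 * s) * (2 * s * Cs * C1 powr (2 * s)) powr (1 / (2 * s + 1))"
    have A: "0 \<le> A" using smooth(1) by (simp add: A_def)
    show ?thesis
    proof (intro exI conjI allI impI)
      \<comment> \<open>The power of 2 bounds the factor
        \<open>(real M * S_sp M) powr (2 * s / (2 * s + 1))\<close>, and \<open>D\<close> takes care
        of the remainder.\<close>
      show "0 < A * 2 powr (2 * s / (2 * s + 1)) + D" using A D(1) by (simp add: add_nonneg_pos)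
      fix n m and P :: "'w measure" and \<xi> T \<zeta>
      assume hyp: "1 \<le> n" "\<forall>i\<in>{1..n}. 1 \<le> m i \<and> m i \<le> m_max" "longitudinal_sample a b Q g E n m P \<xi> T \<zeta>"
      let ?M = "total_visits n m" and ?q = "2 * s / (2 * s + 1)"
      have M1: "1 \<le> ?M" by (rule M[OF hyp, of 1]) simp
      have "(real ?M * S_sp ?M) powr ?q \<le> 2 powr ?q"
        using M_S_sp_le[of ?M] S_sp_pos[of ?M] smooth(1) by (intro powr_mono2) auto
      then have "A * (real ?M * S_sp ?M) powr ?q * real ?M powr (- ?q) \<le> A * 2 powr ?q * real ?M powr (- ?q)"
        using A by (intro mult_right_mono mult_left_mono) auto
      then have le: "A * (real ?M * S_sp ?M) powr ?q * real ?M powr (- ?q) + remainder_sp \<alpha> C2 C3 ?M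
          \<le> (A * 2 powr ?q + D) * real ?M powr (- ?q)"
        using D(2)[OF M1] by (simp add: distrib_right)
      have "spacing_risk a b \<nu> \<mu> X \<tau> \<eta> \<phi> n m P \<xi> T \<zeta> (K_opt s C1 Cs ?M)
          \<le> ennreal (A * (real ?M * S_sp ?M) powr ?q * real ?M powr (- ?q) + remainder_sp \<alpha> C2 C3 ?M)"
        using part1[OF hyp] C1 unfolding Let_def A_def by blast
      also have "\<dots> \<le> ennreal ((A * 2 powr ?q + D) * real ?M powr (- ?q))"
        by (rule ennreal_leI[OF le])
      finally show "let M = ?M in spacing_risk a b \<nu> \<mu> X \<tau> \<eta> \<phi> n m P \<xi> T \<zeta> (K_opt s C1 Cs M)
          \<le> ennreal ((A * 2 powr ?q + D) * real M powr (- ?q))" by (simp add: Let_def)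
    qed
  qed
  show ?thesis
    using part1 part2 by blast
qed

end
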